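(* Let $\ell>0$, $\sigma\in[0,1)$, $\Omega=(0,\pi)\times(-\ell,\ell)$, let $\mathcal{H}=\{(x,y)\in\mathbb{R}^2:x\leq\frac{\pi}{2}\}$, and let $G$ be the Green function of the biharmonic operator on $\Omega$ with partially hinged boundary conditions. Write $\overline x=\pi-x$ and $\overline\rho=\pi-\rho$. For $(x,y)\in\mathcal{H}\cap\overline\Omega$ and $(\rho,w)\in\mathcal{H}\cap\overline\Omega$: \begin{itemize} \item[$(i)$] $G(x,y,\rho,w)\geq\max\{G(\overline x,y,\rho,w),G(x,y,\overline\rho,w)\}$, with strict inequality if $x,\rho\neq0,\frac{\pi}{2}$; \item[$(ii)$] $G(x,y,\rho,w)=G(\overline x,y,\overline\rho,w)$; \item[$(iii)$] $G(\overline x,y,\rho,w)=G(x,y,\overline\rho,w)$. \end{itemize}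
   Context: $H^2_*(\Omega)=\{u\in H^2(\Omega): u=0 \text{ on } \{0,\pi\}\times(-\ell,\ell)\}$ (it embeds into continuous functions on $\overline\Omega$), a Hilbert space with the scalar product $$(u,v)_{H^2_*(\Omega)}=\int_\Omega\left[\Delta u\,\Delta v+(1-\sigma)(2u_{xy}v_{xy}-u_{xx}v_{yy}-u_{yy}v_{xx})\right]dx\,dy.$$ This is the weak form of $\Delta^2$ in $\Omega$ with the partially hinged boundary conditions $u=u_{xx}=0$ at $x=0,\pi$ and $u_{yy}+\sigma u_{xx}=u_{yyy}+(2-\sigma)u_{xxy}=0$ at $y=\pm\ell$. For $p=(\rho,w)\in\overline\Omega$, the Green function $G(\cdot,p)=G(\cdot,\cdot,\rho,w)$ is the unique element of $H^2_*(\Omega)$ with $(G(\cdot,p),\varphi)_{H^2_*(\Omega)}=\varphi(p)$ for all $\varphi\in H^2_*(\Omega)$. It is known that $G\in C^0(\overline\Omega\times\overline\Omega)$. *)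

theory Defs
  imports "HOL-Analysis.Analysis"
begin

section \<open>Test functions, weak derivatives and Sobolev functions in the plane\<close>

definition pdx :: "(real \<times> real \<Rightarrow> real) \<Rightarrow> real \<times> real \<Rightarrow> real" where
  "pdx f = (\<lambda>(x, y). deriv (\<lambda>s. f (s, y)) x)"

definition pdy :: "(real \<times> real \<Rightarrow> real) \<Rightarrow> real \<times> real \<Rightarrow> real" where
  "pdy f = (\<lambda>(x, y). deriv (\<lambda>t. f (x, t)) y)"

primrec Ck :: "nat \<Rightarrow> (real \<times> real \<Rightarrow> real) \<Rightarrow> bool" where
  "Ck 0 f \<longleftrightarrow> continuous_on UNIV f"
| "Ck (Suc k) f \<longleftrightarrow> f differentiable_on UNIV \<and> Ck k (pdx f) \<and> Ck k (pdy f)"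

definition test_function :: "(real \<times> real) set \<Rightarrow> (real \<times> real \<Rightarrow> real) \<Rightarrow> bool" where
  "test_function S \<phi> \<longleftrightarrow>
     (\<forall>k. Ck k \<phi>) \<and> compact (closure {p. \<phi> p \<noteq> 0}) \<and> closure {p. \<phi> p \<noteq> 0} \<subseteq> S"

text \<open>Functions stand for their classes modulo null sets; every class of Lebesgue measurable
  functions has a Borel measurable representative, so Borel measurability loses nothing.\<close>

definition L2 :: "(real \<times> real) set \<Rightarrow> (real \<times> real \<Rightarrow> real) set" where
  "L2 S = {u. set_borel_measurable lborel S u \<and> set_integrable lborel S (\<lambda>p. (u p)\<^sup>2)}"

text \<open>\<open>g\<close> is a weak derivative of \<open>u\<close> on \<open>S\<close>, of order \<open>i\<close> in \<open>x\<close> and order \<open>j\<close> in \<open>y\<close>.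
  Integrals of non-integrable functions are \<open>0\<close> by convention, so this is only meaningful for
  locally integrable \<open>u\<close> and \<open>g\<close>; below, both are always required to be in \<open>L2 S\<close>.\<close>

definition has_weak_deriv ::
    "(real \<times> real) set \<Rightarrow> nat \<Rightarrow> nat \<Rightarrow> (real \<times> real \<Rightarrow> real) \<Rightarrow> (real \<times> real \<Rightarrow> real) \<Rightarrow> bool" where
  "has_weak_deriv S i j u g \<longleftrightarrow>
     (\<forall>\<phi>. test_function S \<phi> \<longrightarrow>
        (LINT p:S|lborel. u p * (pdx ^^ i) ((pdy ^^ j) \<phi>) p)
          = (-1) ^ (i + j) * (LINT p:S|lborel. g p * \<phi> p))"

definition H2 :: "(real \<times> real) set \<Rightarrow> (real \<times> real \<Rightarrow> real) set" where
  "H2 S = {u \<in> L2 S. \<forall>i j. i + j \<le> 2 \<longrightarrow> (\<exists>g \<in> L2 S. has_weak_deriv S i j u g)}"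

text \<open>A representative of the weak derivative, which is determined up to a null set.\<close>

definition weak_deriv ::
    "(real \<times> real) set \<Rightarrow> nat \<Rightarrow> nat \<Rightarrow> (real \<times> real \<Rightarrow> real) \<Rightarrow> real \<times> real \<Rightarrow> real" where
  "weak_deriv S i j u = (SOME g. g \<in> L2 S \<and> has_weak_deriv S i j u g)"

section \<open>The partially hinged plate\<close>

definition Omega :: "real \<Rightarrow> (real \<times> real) set" where
  "Omega l = {0<..<pi} \<times> {-l<..<l}"

text \<open>Elements are taken to be the representatives that are continuous up to the boundary; by
  the Sobolev embedding, each class in \<open>H2 (Omega l)\<close> has one, unique on the closure. Boundary and
  point values refer to it. Values outside the closure are irrelevant.\<close>

definition H2star :: "real \<Rightarrow> (real \<times> real \<Rightarrow> real) set" where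
  "H2star l = {u \<in> H2 (Omega l). continuous_on (closure (Omega l)) u
                 \<and> (\<forall>p \<in> {0, pi} \<times> {-l<..<l}. u p = 0)}"

definition H2star_inner ::
    "real \<Rightarrow> real \<Rightarrow> (real \<times> real \<Rightarrow> real) \<Rightarrow> (real \<times> real \<Rightarrow> real) \<Rightarrow> real" where
  "H2star_inner l \<sigma> u v =
     (let D = weak_deriv (Omega l);
          uxx = D 2 0 u; uxy = D 1 1 u; uyy = D 0 2 u;
          vxx = D 2 0 v; vxy = D 1 1 v; vyy = D 0 2 v
      in LINT p:Omega l|lborel.
           (uxx p + uyy p) * (vxx p + vyy p)
           + (1 - \<sigma>) * (2 * uxy p * vxy p - uxx p * vyy p - uyy p * vxx p))"

definition green_function ::
    "real \<Rightarrow> real \<Rightarrow> (real \<Rightarrow> real \<Rightarrow> real \<Rightarrow> real \<Rightarrow> real) \<Rightarrow> bool" where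
  "green_function l \<sigma> G \<longleftrightarrow>
     (\<forall>(\<rho>, w) \<in> closure (Omega l).
        (\<lambda>(x, y). G x y \<rho> w) \<in> H2star l \<and>
        (\<forall>\<phi> \<in> H2star l. H2star_inner l \<sigma> (\<lambda>(x, y). G x y \<rho> w) \<phi> = \<phi> (\<rho>, w)))"

definition left_half :: "(real \<times> real) set" where
  "left_half = {(x, y). x \<le> pi / 2}"

end

theory Submission
  imports Defs
begin

text \<open>The sine coefficients of \<open>x \<mapsto> G x y \<rho> w\<close> are \<open>sin (m \<rho>) g\<^sub>m(y, w)\<close>, where \<open>g\<^sub>m(\<cdot>, w)\<close> is the Green
  function on \<open>(-l, l)\<close> of \<open>g'''' - 2 m\<^sup>2 g'' + m\<^sup>4 g\<close> with the natural boundary conditions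
  \<open>g'' = \<sigma> m\<^sup>2 g\<close>, \<open>g''' = (2 - \<sigma>) m\<^sup>2 g'\<close>; this is seen by testing with \<open>sin (m x) g\<^sub>m(y, y\<^sub>0)\<close>. Since
  \<open>g\<^sub>m\<close> is symmetric, (ii) and (iii) follow. From an explicit formula one gets \<open>\<bar>g\<^sub>m''\<bar> < m\<^sup>2 g\<^sub>m\<close>, and
  comparing the energy forms for two frequencies shows that \<open>m\<^sup>2 g\<^sub>m(y, w)\<close> is strictly decreasing
  in \<open>m\<close>. In \<open>G x y \<rho> w - G (pi - x) y \<rho> w\<close> only even frequencies survive, so (i) reduces to
  the positivity of \<open>\<Sum>k. c\<^sub>k sin (k a) sin (k b) / k\<^sup>2\<close> for \<open>0 < a, b < pi\<close> and decreasing \<open>c\<^sub>k > 0\<close>,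
  which follows from the Fejer--Jackson inequality by summation by parts.\<close>

section \<open>Sine series\<close>

text \<open>The obstacle is regularity. Membership in \<open>H2star l\<close> provides weak
  derivatives against compactly supported smooth functions and a continuous representative, but no
  boundary values of first derivatives, whereas the mode sin (m x) g_m(y) does not vanish at y = -l,
  l and its third derivative jumps. The natural boundary conditions resolve this: in the scalar
  product u_yy is multiplied by sin (m x) (g_m'' - \<sigma> m^2 g_m), which vanishes at y = -l, l,
  and u_xx by a multiple of sin (m x), which vanishes at x = 0, pi. Two integrations by parts then
  involve boundary values of u only. They are proved in one variable, for a continuous function with
  a weak derivative and multipliers with a corner, and applied to slices. The explicit formula
  supplies signs only: m enters it through exponentials of m l, m y and m w, so monotonicity in m is
  hard to read off. The weight m^2 is the natural one because one integration of the Fejer-Jackson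
  sum produces exactly the factors 1 / k^2.\<close>

lemma sum_cos_telescope:
  "2 * sin (t / 2) * (\<Sum>k=1..n. cos (real k * t)) = 2 * sin (real n * t / 2) * cos ((real n + 1) * t / 2)"
proof (induction n)
  case (Suc n)
  have 1: "2 * sin (real n * t / 2) * cos ((real n + 1) * t / 2) = sin ((real n + 1/2) * t) - sin (t / 2)" for n
    using sin_times_cos[of "real n * t / 2" "(real n + 1) * t / 2"] sin_minus[of "t / 2"]
    by (simp add: field_simps)
  have 2: "2 * sin (t / 2) * cos (real (Suc n) * t) = sin ((real (Suc n) + 1/2) * t) - sin ((real n + 1/2) * t)"
    using cos_times_sin[of "real (Suc n) * t" "t / 2"] by (simp add: field_simps)
  have "2 * sin (t / 2) * (\<Sum>k=1..Suc n. cos (real k * t))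
      = 2 * sin (t / 2) * (\<Sum>k=1..n. cos (real k * t)) + 2 * sin (t / 2) * cos (real (Suc n) * t)"
    by (simp add: distrib_left)
  then show ?case unfolding Suc 1 2 by simp
qed simp

text \<open>At an interior minimum of the \<open>n\<close>-th sum the derivative
  \<open>\<Sum> cos (k t)\<close> vanishes, which forces \<open>sin (n t) \<ge> 0\<close>, so the \<open>(n - 1)\<close>-th sum is no larger.\<close>
lemma Fejer_Jackson:
  assumes "n \<ge> 1" "0 < t" "t < pi"
  shows "(\<Sum>k=1..n. sin (real k * t) / real k) > 0"
  using assms
proof (induction n arbitrary: t rule: nat_induct_at_least)
  case base
  then show ?case by (simp add: sin_gt_zero)
next
  case (Suc n)
  define F where "F = (\<lambda>m t. \<Sum>k=1..m. sin (real k * t) / real k)"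
  have IH: "F n t > 0" if "0 < t" "t < pi" for t using Suc.IH that by (simp add: F_def)
  have dF: "(F m has_real_derivative (\<Sum>k=1..m. cos (real k * t))) (at t)" for m t
    unfolding F_def by (rule DERIV_sum) (auto intro!: derivative_eq_intros)
  have FS: "F (Suc n) t = F n t + sin (real (Suc n) * t) / real (Suc n)" for t
    by (simp add: F_def)
  have F0: "F m 0 = 0" "F m pi = 0" for m by (simp_all add: F_def)
  have "continuous_on {0..pi} (F (Suc n))"
    using dF by (meson DERIV_isCont continuous_at_imp_continuous_on)
  then obtain s where s: "s \<in> {0..pi}" "\<And>u. u \<in> {0..pi} \<Longrightarrow> F (Suc n) s \<le> F (Suc n) u"
    using continuous_attains_inf[of "{0..pi}" "F (Suc n)"] by auto
  have inner: "F (Suc n) s > 0" if m: "0 < s" "s < pi" "\<And>u. u \<in> {0..pi} \<Longrightarrow> F (Suc n) s \<le> F (Suc n) u" for s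
  proof -
    have "(\<Sum>k=1..Suc n. cos (real k * s)) = 0"
    proof (rule DERIV_local_min[OF dF])
      show "0 < min s (pi - s)" using m by simp
      show "\<forall>u. \<bar>s - u\<bar> < min s (pi - s) \<longrightarrow> F (Suc n) s \<le> F (Suc n) u"
        using m by (auto simp: abs_if split: if_splits)
    qed
    \<comment> \<open>The product form of the Dirichlet sum splits the critical points into two
      families, one for each factor.\<close>
    then have z: "sin (real (Suc n) * s / 2) * cos ((real (Suc n) + 1) * s / 2) = 0"
      using sum_cos_telescope[of s "Suc n"] by simp
    have "sin (real (Suc n) * s) \<ge> 0"
    proof (cases "sin (real (Suc n) * s / 2) = 0")
      case True
      then show ?thesis using sin_double[of "real (Suc n) * s / 2"] by simp
    next
      case False
      then have c: "cos ((real (Suc n) + 1) * s / 2) = 0" using z by simp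
      \<comment> \<open>Where the cosine of the half angle vanishes, the doubled angle is an odd
        multiple of pi; subtracting s leaves sin s, which is nonnegative.\<close>
      have "sin (real (Suc n) * s) = sin (2 * ((real (Suc n) + 1) * s / 2) - s)"
        by (rule arg_cong[where f = sin]) (simp add: field_simps)
      also have "\<dots> = sin s"
        unfolding sin_diff sin_double cos_double sin_squared_eq c by simp
      finally show ?thesis using m by (simp add: sin_ge_zero)
    qed
    then show ?thesis using IH[of s] m by (simp add: FS add_pos_nonneg)
  qed
  show ?case
  proof (rule ccontr)
    assume "\<not> 0 < (\<Sum>k = 1..Suc n. sin (real k * t) / real k)"
    then have t: "F (Suc n) t \<le> 0" by (simp add: F_def)
    show False
    proof (cases "0 < s \<and> s < pi")
      case True
      then show ?thesis using inner[OF _ _ s(2)] s(2)[of t] t Suc.prems by fastforce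
    next
      \<comment> \<open>A minimum attained at an endpoint has value 0, so the point t with a
        nonpositive value is itself an interior minimiser and \<open>inner\<close> applies to
        t.\<close>
      case False
      then have "F (Suc n) s = 0" using s(1) F0 by (cases "s = 0") (auto simp: order_less_le)
      then have "\<And>u. u \<in> {0..pi} \<Longrightarrow> F (Suc n) t \<le> F (Suc n) u" using s(2) t by fastforce
      then show ?thesis using inner[OF Suc.prems] t by fastforce
    qed
  qed
qed

lemma sum_cos_squares_decreasing:
  assumes "n \<ge> 1" "0 \<le> s" "s < t" "t \<le> pi"
  shows "(\<Sum>k=1..n. cos (real k * t) / (real k)\<^sup>2) < (\<Sum>k=1..n. cos (real k * s) / (real k)\<^sup>2)"
proof (rule DERIV_neg_imp_decreasing_open[OF assms(3)])
  fix x assume x: "s < x" "x < t"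
  have "((\<lambda>t. \<Sum>k=1..n. cos (real k * t) / (real k)\<^sup>2) has_real_derivative (\<Sum>k=1..n. - (sin (real k * x) / real k))) (at x)"
    by (rule DERIV_sum) (auto intro!: derivative_eq_intros simp: power2_eq_square)
  then show "\<exists>y. ((\<lambda>t. \<Sum>k=1..n. cos (real k * t) / (real k)\<^sup>2) has_real_derivative y) (at x) \<and> y < 0"
    using Fejer_Jackson[OF assms(1), of x] x assms by (intro exI conjI) (auto simp: sum_negf)
next
  show "continuous_on {s..t} (\<lambda>t. \<Sum>k=1..n. cos (real k * t) / (real k)\<^sup>2)"
    by (intro continuous_intros)  auto
qed

lemma sum_sin_sin_pos:
  assumes "n \<ge> 1" "0 < a" "a < pi" "0 < b" "b < pi"
  shows "(\<Sum>k=1..n. sin (real k * a) * sin (real k * b) / (real k)\<^sup>2) > 0"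
proof -
  define S where "S = (\<lambda>t. \<Sum>k=1..n. cos (real k * t) / (real k)\<^sup>2)"
  \<comment> \<open>\<open>c\<close> folds a + b back into [0, pi], as S is even and 2 pi periodic.
    That \<bar>a - b\<bar> < c is where a and b lying in (0, pi) enters.\<close>
  define c where "c = (if a + b \<le> pi then a + b else 2 * pi - (a + b))"
  have abs: "S \<bar>t\<bar> = S t" for t by (auto simp: S_def abs_if)
  have per: "S (2 * pi - t) = S t" for t
  proof -
    have "cos (real k * (2 * pi - t)) = cos (2 * real k * pi - real k * t)" for k
      by (rule arg_cong[where f = cos]) (simp add: algebra_simps)
    then show ?thesis unfolding S_def cos_diff cos_2npi sin_2npi by simp
  qed
  have "S c < S \<bar>a - b\<bar>" unfolding S_def
    by (rule sum_cos_squares_decreasing) (use assms in \<open>auto simp: c_def\<close>)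
  moreover have "S c = S (a + b)" using per[of "a + b"] by (simp add: c_def)
  ultimately have "S (a - b) - S (a + b) > 0" by (simp add: abs)
  moreover have "S (a - b) - S (a + b) = 2 * (\<Sum>k=1..n. sin (real k * a) * sin (real k * b) / (real k)\<^sup>2)"
    unfolding S_def sum_subtractf[symmetric] sum_distrib_left
    by (intro sum.cong refl) (simp add: algebra_simps cos_add cos_diff diff_divide_distrib[symmetric])
  ultimately show ?thesis by simp
qed

text \<open>Abel summation gives nonnegative terms. Keeping the first one yields a bound independent
  of n, so strict positivity survives the passage to the limit.\<close>

lemma sum_by_parts_ge:
  fixes C s :: "nat \<Rightarrow> real"
  assumes dec: "\<And>k. k \<ge> 1 \<Longrightarrow> C (Suc k) < C k" and pos: "\<And>k. k \<ge> 1 \<Longrightarrow> C k > 0"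
    and T: "\<And>n. n \<ge> 1 \<Longrightarrow> (\<Sum>k=1..n. s k) > 0" and n: "n \<ge> 2"
  shows "(\<Sum>k=1..n. C k * s k) \<ge> (C 1 - C 2) * s 1"
proof -
  have main: "(\<Sum>k=1..n. C k * s k) = (\<Sum>k=1..<n. (C k - C (Suc k)) * (\<Sum>j=1..k. s j)) + C n * (\<Sum>k=1..n. s k)"
    using order.trans[OF one_le_numeral n] by (induction n rule: nat_induct_at_least) (simp_all add: algebra_simps)
  have nn: "(C k - C (Suc k)) * (\<Sum>j=1..k. s j) \<ge> 0" if "k \<ge> 1" for k
    using dec[OF that] T[OF that] by (intro mult_nonneg_nonneg) auto
  have "(C 1 - C (Suc 1)) * (\<Sum>j=1..1. s j) \<le> (\<Sum>k=1..<n. (C k - C (Suc k)) * (\<Sum>j=1..k. s j))"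
    by (rule member_le_sum[of "1::nat" _ "\<lambda>k. (C k - C (Suc k)) * (\<Sum>j=1..k. s j)"]) (use nn n in auto)
  moreover have "C n * (\<Sum>k=1..n. s k) \<ge> 0" using pos[of n] T[of n] n by (intro mult_nonneg_nonneg) auto
  ultimately show "(\<Sum>k=1..n. C k * s k) \<ge> (C 1 - C 2) * s 1"
    unfolding main by (simp add: numeral_2_eq_2)
qed

lemma sine_series_pos:
  fixes C :: "nat \<Rightarrow> real"
  assumes dec: "\<And>k. k \<ge> 1 \<Longrightarrow> C (Suc k) < C k" and pos: "\<And>k. k \<ge> 1 \<Longrightarrow> C k > 0"
    and ab: "0 < a" "a < pi" "0 < b" "b < pi"
    and sums: "(\<lambda>k. C (Suc k) / (real (Suc k))\<^sup>2 * (sin (real (Suc k) * a) * sin (real (Suc k) * b))) sums x"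
  shows "x > 0"
proof -
  define s where "s = (\<lambda>k. sin (real k * a) * sin (real k * b) / (real k)\<^sup>2)"
  have T: "(\<Sum>k=1..n. s k) > 0" if "n \<ge> 1" for n
    using sum_sin_sin_pos[OF that ab] by (simp add: s_def)
  have s1: "s 1 > 0" using T[of 1] by simp
  have "(\<lambda>n. \<Sum>k<n. C (Suc k) * s (Suc k)) \<longlonglongrightarrow> x"
    using sums by (simp add: sums_def s_def)
  moreover have "(\<Sum>k<n. C (Suc k) * s (Suc k)) = (\<Sum>k=1..n. C k * s k)" for n
    using sum.atLeast1_atMost_eq[of "\<lambda>k. C k * s k" n] by simp
  ultimately have lim: "(\<lambda>n. \<Sum>k=1..n. C k * s k) \<longlonglongrightarrow> x" by simp
  have "(C 1 - C 2) * s 1 \<le> x"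
    by (rule LIMSEQ_le_const[OF lim])
       (use sum_by_parts_ge[of C s, OF dec pos T] in \<open>auto intro!: exI[of _ 2]\<close>)
  moreover have "(C 1 - C 2) * s 1 > 0" using dec[of 1] s1 by (simp add: numeral_2_eq_2)
  ultimately show ?thesis by linarith
qed

section \<open>Completeness of the sine system\<close>

lemma sin_times_poly_cos:
  fixes h :: "real \<Rightarrow> real"
  assumes h: "continuous_on {0..pi} h"
    and orth: "\<And>m. m \<ge> 1 \<Longrightarrow> integral {0..pi} (\<lambda>x. h x * sin (real m * x)) = 0"
  shows "integral {0..pi} (\<lambda>x. h x * (sin (real m * x) * cos x ^ j)) = 0"
proof (induction j arbitrary: m)
  case 0
  then show ?case using orth[of m] by (cases m) auto
next
  case (Suc j)
  have int: "(\<lambda>x. h x * (sin (real k * x) * cos x ^ j)) integrable_on {0..pi}" for k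
    by (intro integrable_continuous_real continuous_intros h)
  show ?case
  proof (cases m)
    case 0
    then show ?thesis by simp
  next
    case (Suc i)
    have e: "sin (real m * x) * cos x = (sin (real (Suc m) * x) + sin (real i * x)) / 2" for x
      using sin_times_cos[of "real m * x" x] Suc by (simp add: algebra_simps)
    have "h x * (sin (real m * x) * cos x ^ Suc j)
       = (h x * (sin (real (Suc m) * x) * cos x ^ j) + h x * (sin (real i * x) * cos x ^ j)) / 2" for x
    proof -
      have "h x * (sin (real m * x) * cos x ^ Suc j) = h x * ((sin (real m * x) * cos x) * cos x ^ j)" by simp
      then show ?thesis unfolding e by (simp add: field_simps)
    qed
    then have "integral {0..pi} (\<lambda>x. h x * (sin (real m * x) * cos x ^ Suc j))
      = integral {0..pi} (\<lambda>x. h x * (sin (real (Suc m) * x) * cos x ^ j) + h x * (sin (real i * x) * cos x ^ j)) / 2"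
      by (simp only: integral_divide)
    also have "\<dots> = 0"
      using Suc.IH[of "Suc m"] Suc.IH[of i] integral_add[OF int[of "Suc m"] int[of i]] by simp
    finally show ?thesis .
  qed
qed

text \<open>By Weierstrass, \<open>h\<close> is a uniform limit of polynomials in
  \<open>cos x\<close>, and \<open>sin x * p (cos x)\<close> is a combination of the \<open>sin (m x)\<close>; hence \<open>\<integral>h\<^sup>2 sin = 0\<close>.\<close>
lemma sine_system_complete:
  fixes h :: "real \<Rightarrow> real"
  assumes h: "continuous_on {0..pi} h"
    and orth: "\<And>m. m \<ge> 1 \<Longrightarrow> integral {0..pi} (\<lambda>x. h x * sin (real m * x)) = 0"
    and x: "x \<in> {0..pi}"
  shows "h x = 0"
proof -
  define I where "I = integral {0..pi} (\<lambda>x. (h x)\<^sup>2 * sin x)"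
  obtain B where B: "\<And>x. x \<in> {0..pi} \<Longrightarrow> \<bar>h x\<bar> \<le> B" "B > 0"
    using compact_imp_bounded[OF compact_continuous_image[OF h compact_Icc]]
    unfolding bounded_pos by (metis imageI real_norm_def)
  have le: "\<bar>I\<bar> \<le> e * (B * pi)" if e: "e > 0" for e
  proof -
    \<comment> \<open>On [0, pi] the cosine is invertible, so h is a continuous function of cos x
      and the Weierstrass theorem applies on [-1, 1].\<close>
    have "continuous_on {-1..1} (\<lambda>y. h (arccos y))"
      by (intro continuous_on_compose2[OF h] continuous_on_arccos' ) (auto simp: arccos_lbound arccos_ubound)
    from Stone_Weierstrass_real_polynomial_function[OF compact_Icc this e]
    obtain p where p: "real_polynomial_function p" "\<And>y. y \<in> {-1..1} \<Longrightarrow> \<bar>h (arccos y) - p y\<bar> < e" by metis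
    obtain a n where pa: "p = (\<lambda>x. \<Sum>i\<le>n. a i * x ^ i)"
      using p(1) by (auto simp: real_polynomial_function_iff_sum)
    have pc: "\<bar>h x - p (cos x)\<bar> < e" if "x \<in> {0..pi}" for x
      using p(2)[of "cos x"] that by (simp add: arccos_cos)
    have ip: "integral {0..pi} (\<lambda>x. h x * (sin x * p (cos x))) = 0"
    proof -
      have "integral {0..pi} (\<lambda>x. h x * (sin x * p (cos x))) = integral {0..pi} (\<lambda>x. \<Sum>i\<le>n. a i * (h x * (sin x * cos x ^ i)))"
        by (simp add: pa sum_distrib_left mult_ac)
      also have "\<dots> = (\<Sum>i\<le>n. a i * integral {0..pi} (\<lambda>x. h x * (sin x * cos x ^ i)))"
        by (subst integral_sum) (auto intro!: integrable_continuous_real continuous_intros h)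
      also have "\<dots> = 0" using sin_times_poly_cos[OF h orth, of 1] by simp
      finally show ?thesis .
    qed
    have cp: "continuous_on {0..pi} (\<lambda>x. p (cos x))" unfolding pa by (intro continuous_intros)
    \<comment> \<open>Subtracting an integral that vanishes turns h^2 into h (h - p (cos x)), which
      is as small as the approximation error.\<close>
    have "I = integral {0..pi} (\<lambda>x. (h x)\<^sup>2 * sin x) - integral {0..pi} (\<lambda>x. h x * (sin x * p (cos x)))"
      unfolding I_def ip by simp
    also have "\<dots> = integral {0..pi} (\<lambda>x. (h x)\<^sup>2 * sin x - h x * (sin x * p (cos x)))"
      by (rule integral_diff[symmetric]; intro integrable_continuous_real continuous_intros h cp)
    also have "\<dots> = integral {0..pi} (\<lambda>x. h x * sin x * (h x - p (cos x)))"
      by (rule integral_cong) (simp add: power2_eq_square algebra_simps)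
    finally have "I = integral {0..pi} (\<lambda>x. h x * sin x * (h x - p (cos x)))" .
    also have "norm \<dots> \<le> (e * B) * (pi - 0)"
    proof (rule integral_bound)
      show "norm (h x * sin x * (h x - p (cos x))) \<le> e * B" if "x \<in> {0..pi}" for x
      proof -
        have "\<bar>h x\<bar> * \<bar>sin x\<bar> * \<bar>h x - p (cos x)\<bar> \<le> (B * 1) * e"
          using B that pc[OF that] by (intro mult_mono) auto
        then show ?thesis by (simp add: abs_mult mult.commute)
      qed
    qed (auto intro!: continuous_intros h cp)
    finally show ?thesis by (simp add: mult.assoc)
  qed
  have "I = 0"
  proof (rule ccontr)
    assume "I \<noteq> 0"
    then have "\<bar>I\<bar> \<le> (\<bar>I\<bar> / (2 * (B * pi))) * (B * pi)" using B by (intro le) auto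
    then show False using \<open>I \<noteq> 0\<close> B by (simp add: field_simps)
  qed
  then have "(\<lambda>x. (h x)\<^sup>2 * sin x) x = 0" using x unfolding I_def
    by (subst (asm) integral_eq_0_iff) (auto intro!: continuous_intros h simp: sin_ge_zero)
  then have inner: "h y = 0" if "y \<in> {0<..<pi}" for y
  proof -
    have "(\<lambda>x. (h x)\<^sup>2 * sin x) y = 0" using \<open>I = 0\<close> that unfolding I_def
      by (subst (asm) integral_eq_0_iff) (auto intro!: continuous_intros h simp: sin_ge_zero)
    then show ?thesis using sin_gt_zero[of y] that by auto
  qed
  have "closure {0<..<pi} = {0..pi}" by simp
  then show ?thesis
    using continuous_constant_on_closure[of "{0<..<pi}" h 0] h inner x by auto
qed

section \<open>The one-dimensional Green functions\<close>

text \<open>Both profiles solve f'''' - 2 f'' + f = 0. Differentiation exchanges them and lowers c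
  by 2, so a k-th derivative is a profile with c - 2 k; \<open>corr\<close> encodes its derivatives
  in this way.\<close>

definition even_prof :: "real \<Rightarrow> real \<Rightarrow> real" where
  "even_prof c y = c * cosh y - 2 * y * sinh y"
definition odd_prof :: "real \<Rightarrow> real \<Rightarrow> real" where
  "odd_prof c y = c * sinh y - 2 * y * cosh y"

lemma even_prof_deriv: "(even_prof c has_real_derivative odd_prof (c - 2) y) (at y)"
  unfolding even_prof_def odd_prof_def
  by (auto intro!: derivative_eq_intros simp: algebra_simps)
lemma odd_prof_deriv: "(odd_prof c has_real_derivative even_prof (c - 2) y) (at y)"
  unfolding even_prof_def odd_prof_def
  by (auto intro!: derivative_eq_intros simp: algebra_simps)

text \<open>The ratio weights the mirror images of the source at 2 L - w and - 2 L - w: exp (- 2 L)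
  cosh (y + w) is the mean of exp (- (2 L - y - w)) and exp (- (2 L + y + w)). For 0 \<le> \<sigma>
  < 1 it is at least 3, and the sign estimates use it through this bound.\<close>

definition hinge_Q :: "real \<Rightarrow> real" where "hinge_Q \<sigma> = (3 + \<sigma>) / (1 - \<sigma>)"
definition even_den :: "real \<Rightarrow> real \<Rightarrow> real" where "even_den \<sigma> L = hinge_Q \<sigma> * sinh (2 * L) - 2 * L"
definition odd_den :: "real \<Rightarrow> real \<Rightarrow> real" where "odd_den \<sigma> L = hinge_Q \<sigma> * sinh (2 * L) + 2 * L"
text \<open>For this value of c the two boundary operators f'' - \<sigma> f and f''' - (2 -
  \<sigma>) f' agree on the profile at L. Their common value is - (1 - \<sigma>) exp (- L) times the
  matching denominator, see \<open>profile_bc\<close>.\<close>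

definition even_coef :: "real \<Rightarrow> real \<Rightarrow> real" where
  "even_coef \<sigma> L = 2 * L + 1 + hinge_Q \<sigma> * exp (- 2 * L)"
definition odd_coef :: "real \<Rightarrow> real \<Rightarrow> real" where
  "odd_coef \<sigma> L = 2 * L + 1 - hinge_Q \<sigma> * exp (- 2 * L)"

text \<open>For the rescaled problem (frequency \<open>1\<close>, half length \<open>L = m l\<close>) four times the Green function is
  \<open>(1 + \<bar>y - w\<bar>) exp (- \<bar>y - w\<bar>)\<close>, the kernel of the whole line, plus this smooth correction, which is
  forced by the boundary conditions. Here and below \<open>k\<close> is the order of the derivative in \<open>y\<close>.\<close>
definition corr :: "real \<Rightarrow> real \<Rightarrow> real \<Rightarrow> nat \<Rightarrow> real \<Rightarrow> real" where
  "corr \<sigma> L w k y =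
     (if even k then
        hinge_Q \<sigma> * exp (- 2 * L) * cosh (y + w)
        + even_prof (even_coef \<sigma> L - 2 * k) y * even_prof (even_coef \<sigma> L) w / (2 * even_den \<sigma> L)
        + odd_prof (odd_coef \<sigma> L - 2 * k) y * odd_prof (odd_coef \<sigma> L) w / (2 * odd_den \<sigma> L)
      else
        hinge_Q \<sigma> * exp (- 2 * L) * sinh (y + w)
        + odd_prof (even_coef \<sigma> L - 2 * k) y * even_prof (even_coef \<sigma> L) w / (2 * even_den \<sigma> L)
        + even_prof (odd_coef \<sigma> L - 2 * k) y * odd_prof (odd_coef \<sigma> L) w / (2 * odd_den \<sigma> L))"

lemma corr_deriv: "(corr \<sigma> L w k has_real_derivative corr \<sigma> L w (Suc k) y) (at y)"
proof -
  have d: "((\<lambda>y. r * cosh (y + w) + even_prof a y * c + odd_prof b y * d) has_real_derivative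
      r * sinh (y + w) + odd_prof (a - 2) y * c + even_prof (b - 2) y * d) (at y)"
    "((\<lambda>y. r * sinh (y + w) + odd_prof a y * c + even_prof b y * d) has_real_derivative
      r * cosh (y + w) + even_prof (a - 2) y * c + odd_prof (b - 2) y * d) (at y)" for r a b c d
    by (auto intro!: derivative_eq_intros even_prof_deriv odd_prof_deriv)
  have s: "c - real (2 * k) - 2 = c - real (2 * Suc k)" for c by simp
  show ?thesis
  proof (cases "even k")
    case True
    then show ?thesis
      using d(1)[of "hinge_Q \<sigma> * exp (- 2 * L)" "even_coef \<sigma> L - real (2 * k)"
          "even_prof (even_coef \<sigma> L) w / (2 * even_den \<sigma> L)" "odd_coef \<sigma> L - real (2 * k)"
          "odd_prof (odd_coef \<sigma> L) w / (2 * odd_den \<sigma> L)"]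
      unfolding corr_def[abs_def] s times_divide_eq_right by (simp only: if_True if_False even_Suc not_not simp_thms)
  next
    case False
    then show ?thesis
      using d(2)[of "hinge_Q \<sigma> * exp (- 2 * L)" "even_coef \<sigma> L - real (2 * k)"
          "even_prof (even_coef \<sigma> L) w / (2 * even_den \<sigma> L)" "odd_coef \<sigma> L - real (2 * k)"
          "odd_prof (odd_coef \<sigma> L) w / (2 * odd_den \<sigma> L)"]
      unfolding corr_def[abs_def] s times_divide_eq_right by (simp only: if_True if_False even_Suc not_not simp_thms)
  qed
qed

text \<open>The polynomial factors come from differentiating the whole-line kernel k times on either
  side of w. Both pieces live on the entire line, so derivatives at w are two-sided.\<close>

definition left_br :: "real \<Rightarrow> real \<Rightarrow> real \<Rightarrow> nat \<Rightarrow> real \<Rightarrow> real" where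
  "left_br \<sigma> L w k y = (1 - real k - (y - w)) * exp (y - w) + corr \<sigma> L w k y"
definition right_br :: "real \<Rightarrow> real \<Rightarrow> real \<Rightarrow> nat \<Rightarrow> real \<Rightarrow> real" where
  "right_br \<sigma> L w k y = (-1) ^ k * (1 - real k + (y - w)) * exp (- (y - w)) + corr \<sigma> L w k y"

lemma left_br_deriv: "(left_br \<sigma> L w k has_real_derivative left_br \<sigma> L w (Suc k) y) (at y)"
  unfolding left_br_def
  by (auto intro!: derivative_eq_intros corr_deriv simp: algebra_simps)
lemma right_br_deriv: "(right_br \<sigma> L w k has_real_derivative right_br \<sigma> L w (Suc k) y) (at y)"
  unfolding right_br_def
  by (auto intro!: derivative_eq_intros corr_deriv simp: algebra_simps)

lemma even_prof_minus [simp]: "even_prof c (- y) = even_prof c y"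
  by (simp add: even_prof_def)
lemma odd_prof_minus [simp]: "odd_prof c (- y) = - odd_prof c y"
  by (simp add: odd_prof_def)

text \<open>Reflecting both variables exchanges the branches; \<open>left_bc\<close> and
  \<open>left_br_sum_pos\<close> are obtained from the right branch in this way.\<close>

lemma right_br_reflect: "right_br \<sigma> L (- w) k (- y) = (-1) ^ k * left_br \<sigma> L w k y"
proof -
  have c: "cosh (- y - w) = cosh (y + w)" "sinh (- y - w) = - sinh (w + y)"
    using cosh_minus[of "y + w"] sinh_minus[of "w + y"] by (simp_all only: minus_add_distrib diff_conv_add_uminus add.commute[of "- w"])
  have c': "sinh (- w - y) = - sinh (w + y)" "cosh (- w - y) = cosh (w + y)"
    using sinh_minus[of "w + y"] cosh_minus[of "w + y"] by (simp_all only: minus_add_distrib diff_conv_add_uminus)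
  show ?thesis
    by (cases "even k") (simp_all add: right_br_def left_br_def corr_def c c' algebra_simps del: cosh_real_eq_iff)
qed

lemma branches_agree: "k \<le> 2 \<Longrightarrow> left_br \<sigma> L w k w = right_br \<sigma> L w k w"
proof -
  assume "k \<le> 2"
  then have "k = 0 \<or> k = 1 \<or> k = 2" by auto
  then show ?thesis by (auto simp: left_br_def right_br_def)
qed

text \<open>The correction is smooth at w, so the jump is that of the whole-line kernel; 4 is the
  normalisation that \<open>beam_green\<close> divides out.\<close>

lemma branches_jump: "right_br \<sigma> L w 3 w - left_br \<sigma> L w 3 w = 4"
  by (simp add: left_br_def right_br_def)

lemma corr_ode: "corr \<sigma> L w 4 y - 2 * corr \<sigma> L w 2 y + corr \<sigma> L w 0 y = 0"
  by (simp add: corr_def even_prof_def odd_prof_def) (simp add: algebra_simps add_divide_distrib diff_divide_distrib)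
lemma left_br_ode: "left_br \<sigma> L w 4 y = 2 * left_br \<sigma> L w 2 y - left_br \<sigma> L w 0 y"
  using corr_ode[of \<sigma> L w y] by (simp add: left_br_def algebra_simps)
lemma right_br_ode: "right_br \<sigma> L w 4 y = 2 * right_br \<sigma> L w 2 y - right_br \<sigma> L w 0 y"
  using corr_ode[of \<sigma> L w y] by (simp add: right_br_def algebra_simps)

section \<open>Signs and boundary conditions of the rescaled kernel\<close>

context
  fixes \<sigma> L :: real
  assumes sg: "0 \<le> \<sigma>" "\<sigma> < 1" and L: "L > 0"
begin

lemma hinge_Q_ge: "hinge_Q \<sigma> \<ge> 3"
  using sg by (simp add: hinge_Q_def field_simps)

lemma sinh_ge: "(x::real) \<ge> 0 \<Longrightarrow> sinh x \<ge> x"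
proof -
  assume x: "x \<ge> 0"
  have "(\<lambda>x::real. sinh x - x) 0 \<le> (\<lambda>x. sinh x - x) x"
  proof (rule DERIV_nonneg_imp_nondecreasing[OF x])
    fix t :: real
    show "\<exists>y. ((\<lambda>x. sinh x - x) has_real_derivative y) (at t) \<and> 0 \<le> y"
      by (rule exI[of _ "cosh t - 1"]) (auto intro!: derivative_eq_intros simp: cosh_real_ge_1)
  qed
  then show ?thesis by simp
qed

lemma even_den_pos: "even_den \<sigma> L > 0"
proof -
  have "3 * sinh (2 * L) \<le> hinge_Q \<sigma> * sinh (2 * L)"
    using hinge_Q_ge L by (intro mult_right_mono) auto
  then show ?thesis using sinh_ge[of "2 * L"] L unfolding even_den_def by linarith
qed

lemma odd_den_ge: "even_den \<sigma> L \<le> odd_den \<sigma> L" using L by (simp add: even_den_def odd_den_def)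
lemma odd_den_pos: "odd_den \<sigma> L > 0" using odd_den_ge even_den_pos by linarith

text \<open>Sum and difference of the two profiles are combinations of exp w and exp (- w) whose
  coefficients are positive as long as \<bar>w\<bar> \<le> L.\<close>

lemma odd_prof_lt_even_prof:
  assumes "\<bar>w\<bar> \<le> L"
  shows "\<bar>odd_prof (odd_coef \<sigma> L) w\<bar> < even_prof (even_coef \<sigma> L) w"
proof -
  let ?r = "hinge_Q \<sigma> * exp (- 2 * L)"
  have r: "?r > 0" using hinge_Q_ge by simp
  have e: "even_prof (even_coef \<sigma> L) w + odd_prof (odd_coef \<sigma> L) w
      = (2 * L + 1 - 2 * w) * exp w + ?r * exp (- w)"
   "even_prof (even_coef \<sigma> L) w - odd_prof (odd_coef \<sigma> L) w
      = (2 * L + 1 + 2 * w) * exp (- w) + ?r * exp w"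
    by (simp_all add: even_prof_def odd_prof_def even_coef_def odd_coef_def cosh_field_def sinh_field_def field_simps)
  have "2 * L + 1 - 2 * w > 0" "2 * L + 1 + 2 * w > 0" using assms by auto
  then have "(2 * L + 1 - 2 * w) * exp w + ?r * exp (- w) > 0"
    "(2 * L + 1 + 2 * w) * exp (- w) + ?r * exp w > 0"
    using r by (auto intro!: add_pos_pos mult_pos_pos)
  then show ?thesis using e by linarith
qed

text \<open>The odd part of the correction may be negative, but its numerator is smaller in absolute
  value than that of the even part and its denominator is at least as large.\<close>

lemma two_term_pos:
  fixes a b c d :: real
  assumes "\<bar>b\<bar> < a" "\<bar>d\<bar> < c" 
  shows "0 < a * c / (2 * even_den \<sigma> L) + b * d / (2 * odd_den \<sigma> L)"
proof -
  have "\<bar>b * d\<bar> < a * c"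
    unfolding abs_mult using assms by (intro mult_strict_mono) auto
  moreover have "\<bar>b * d / (2 * odd_den \<sigma> L)\<bar> \<le> \<bar>b * d\<bar> / (2 * even_den \<sigma> L)"
    using odd_den_ge even_den_pos odd_den_pos by (auto simp: abs_mult intro!: divide_left_mono mult_pos_pos)
  moreover have "\<bar>b * d\<bar> / (2 * even_den \<sigma> L) < a * c / (2 * even_den \<sigma> L)"
    using calculation(1) even_den_pos by (intro divide_strict_right_mono) auto
  ultimately show ?thesis by linarith
qed

lemma corr_pos:
  assumes "\<bar>w\<bar> \<le> L" "\<bar>y\<bar> \<le> L"
  shows "corr \<sigma> L w 0 y > 0"
proof -
  have "hinge_Q \<sigma> * exp (- 2 * L) * cosh (y + w) > 0" using hinge_Q_ge by simp
  then show ?thesis using two_term_pos[OF odd_prof_lt_even_prof[OF assms(2)] odd_prof_lt_even_prof[OF assms(1)]]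
    by (simp add: corr_def)
qed

lemma abs_sinh_lt_cosh: "\<bar>sinh x\<bar> < cosh (x::real)"
  by (auto simp: abs_if cosh_field_def sinh_field_def field_simps)

text \<open>Two differentiations reproduce the image term, which cancels. Lowering c by 4 subtracts
  4 cosh y or 4 sinh y, so the difference again has the shape of
  \<open>two_term_pos\<close>.\<close>

lemma corr_diff_pos:
  assumes "\<bar>w\<bar> \<le> L"
  shows "corr \<sigma> L w 0 y - corr \<sigma> L w 2 y > 0"
proof -
  have "\<bar>4 * sinh y\<bar> < 4 * cosh y" using abs_sinh_lt_cosh[of y] by (simp add: abs_mult)
  from two_term_pos[OF this odd_prof_lt_even_prof[OF assms]]
  show ?thesis
    by (simp add: corr_def even_prof_def[of _ y] odd_prof_def[of _ y])
       (simp add: algebra_simps add_divide_distrib diff_divide_distrib)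
qed

lemma br_pos:
  assumes "\<bar>w\<bar> \<le> L" "\<bar>y\<bar> \<le> L"
  shows "y \<le> w \<Longrightarrow> left_br \<sigma> L w 0 y > 0" "w \<le> y \<Longrightarrow> right_br \<sigma> L w 0 y > 0"
  using corr_pos[OF assms] by (auto simp: left_br_def right_br_def intro!: add_nonneg_pos mult_nonneg_nonneg)

lemma br_diff_pos:
  assumes "\<bar>w\<bar> \<le> L"
  shows "left_br \<sigma> L w 0 y - left_br \<sigma> L w 2 y > 0" "right_br \<sigma> L w 0 y - right_br \<sigma> L w 2 y > 0"
proof -
  have "left_br \<sigma> L w 0 y - left_br \<sigma> L w 2 y = 2 * exp (y - w) + (corr \<sigma> L w 0 y - corr \<sigma> L w 2 y)"
    "right_br \<sigma> L w 0 y - right_br \<sigma> L w 2 y = 2 * exp (- (y - w)) + (corr \<sigma> L w 0 y - corr \<sigma> L w 2 y)"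
    by (simp_all add: left_br_def right_br_def algebra_simps)
  then show "left_br \<sigma> L w 0 y - left_br \<sigma> L w 2 y > 0" "right_br \<sigma> L w 0 y - right_br \<sigma> L w 2 y > 0"
    using corr_diff_pos[OF assms, of y] by (auto intro!: add_pos_pos simp del: diff_gt_0_iff_gt)
qed

lemma sinh2_exp: "sinh (2 * L) = (1 / exp (-2 * L) - exp (-2 * L)) / 2"
  by (simp add: sinh_field_def exp_minus inverse_eq_divide)

text \<open>On the diagonal the whole-line kernel and its second derivative cancel, so the minimum
  principle below depends on the correction alone. Completing the squares suffices when r < 1. For r
  \<ge> 1 the even denominator may be too small for that, but then A \<ge> 2 cosh w makes the even
  part nonnegative.\<close>

lemma corr_diag_pos:
  assumes w: "\<bar>w\<bar> \<le> L"
  shows "corr \<sigma> L w 0 w + corr \<sigma> L w 2 w > 0"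
proof -
  define A where "A = even_prof (even_coef \<sigma> L) w"
  define B where "B = odd_prof (odd_coef \<sigma> L) w"
  define r where "r = hinge_Q \<sigma> * exp (- 2 * L)"
  define dE where "dE = even_den \<sigma> L"
  define dO where "dO = odd_den \<sigma> L"
  have d: "0 < dE" "dE \<le> dO" "0 < dO"
    using even_den_pos odd_den_ge odd_den_pos by (auto simp: dE_def dO_def)
  have r: "r > 0" using hinge_Q_ge by (simp add: r_def)
  have A0: "A > 0" using odd_prof_lt_even_prof[OF w] by (auto simp: A_def)
  have 1: "corr \<sigma> L w 0 w + corr \<sigma> L w 2 w
     = 2 * r * cosh (2 * w) + (A * (A - 2 * cosh w)) / dE + (B * (B - 2 * sinh w)) / dO"
    by (simp add: corr_def even_prof_def odd_prof_def A_def B_def r_def dE_def dO_def flip: mult_2)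
       (simp add: algebra_simps add_divide_distrib diff_divide_distrib)
  have qe: "\<And>c::real. A * (A - 2 * c) \<ge> - c\<^sup>2" "\<And>c::real. B * (B - 2 * c) \<ge> - c\<^sup>2"
  proof -
    fix c :: real
    show "A * (A - 2 * c) \<ge> - c\<^sup>2" "B * (B - 2 * c) \<ge> - c\<^sup>2"
      using zero_le_power2[of "A - c"] zero_le_power2[of "B - c"]
      by (auto simp: power2_eq_square algebra_simps)
  qed
  have cd: "cosh (2 * w) = (cosh w)\<^sup>2 + (sinh w)\<^sup>2" by (simp add: cosh_double)
  have B1: "(B * (B - 2 * sinh w)) / dO \<ge> - (sinh w)\<^sup>2 / dO"
    using qe(2)[of "sinh w"] d by (intro divide_right_mono) auto
  show ?thesis
  proof (cases "r \<ge> 1")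
    case True
    have "A \<ge> 2 * cosh w"
    proof -
      have "2 * (\<bar>w\<bar> * \<bar>sinh w\<bar>) \<le> 2 * (L * cosh w)"
        using w abs_sinh_lt_cosh[of w] L by (intro mult_left_mono mult_mono) auto
      moreover have "w * sinh w \<le> \<bar>w\<bar> * \<bar>sinh w\<bar>" by (metis abs_ge_self abs_mult)
      ultimately have "2 * w * sinh w \<le> 2 * L * cosh w" by linarith
      moreover have "cosh w \<le> r * cosh w" using True by simp
      ultimately show ?thesis
        unfolding A_def even_prof_def even_coef_def r_def[symmetric] distrib_right
          using cosh_real_pos[of w] by linarith
    qed
    then have "(A * (A - 2 * cosh w)) / dE \<ge> 0" using A0 d by auto
    moreover have "(sinh w)\<^sup>2 / dO < 2 * r * cosh (2 * w)"
    proof -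
      have "3 * sinh (2 * L) \<le> hinge_Q \<sigma> * sinh (2 * L)"
        using hinge_Q_ge L by (intro mult_right_mono) auto
      then have "sinh (2 * L) * 3 \<le> dO"
        using L unfolding dO_def odd_den_def by linarith
      moreover have "(sinh w)\<^sup>2 \<le> (sinh L)\<^sup>2"
        using w by (metis abs_le_square_iff abs_of_pos L sinh_real_abs sinh_real_le_iff sinh_real_pos_iff)
      moreover have "(sinh L)\<^sup>2 \<le> sinh (2 * L)"
      proof -
        have "sinh L * sinh L \<le> sinh L * (2 * cosh L)"
          using abs_sinh_lt_cosh[of L] cosh_real_pos[of L] sinh_real_pos_iff[of L] L
          by (intro mult_left_mono) linarith+
        then show ?thesis by (simp add: sinh_double power2_eq_square)
      qed
      ultimately have "(sinh w)\<^sup>2 / dO \<le> 1" using d L by (simp add: field_simps)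
      also have "1 < 2 * r * cosh (2 * w)" 
        using True mult_mono[of 1 r 1 "cosh (2 * w)"] by (simp add: cosh_real_ge_1)
      finally show ?thesis .
    qed
    ultimately show ?thesis unfolding 1 using B1 by linarith
  next
    case False
    define Q where "Q = hinge_Q \<sigma>"
    define q where "q = exp (- 2 * L)"
    have Q: "Q \<ge> 3" using hinge_Q_ge by (simp add: Q_def)
    have q: "q > 0" "Q * q < 1" using False by (auto simp: q_def Q_def r_def)
    have Lq: "4 * L * q \<le> 2"
    proof -
      have "2 * L \<le> exp (2 * L)" using exp_ge_add_one_self[of "2 * L"] by linarith
      then have "2 * L * q \<le> exp (2 * L) * q" using q by (intro mult_right_mono) auto
      also have "\<dots> = 1" by (simp add: q_def flip: exp_add)
      finally show ?thesis by simp
    qed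
    \<comment> \<open>The two subtracted terms are at most 1 and 2 Q, while Q^2 \<ge> 3 Q; the value
      is therefore at least Q - 1 \<ge> 2.\<close>
    have "2 * r * dE = Q\<^sup>2 - (Q * q)\<^sup>2 - Q * (4 * L * q)"
      using q unfolding r_def dE_def even_den_def sinh2_exp Q_def[symmetric] q_def[symmetric]
      by (simp add: field_simps power2_eq_square)
    moreover have "(Q * q)\<^sup>2 \<le> 1" using q Q by (simp add: power_le_one)
    moreover have "Q * (4 * L * q) \<le> Q * 2" using Lq Q by (intro mult_left_mono) auto
    moreover have "3 * Q \<le> Q\<^sup>2" using Q by (simp add: power2_eq_square)
    ultimately have rd: "2 * r * dE > 1" using Q by linarith
    have "(A * (A - 2 * cosh w)) / dE \<ge> - (cosh w)\<^sup>2 / dE"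
      using qe(1)[of "cosh w"] d by (intro divide_right_mono) auto
    moreover have "(sinh w)\<^sup>2 / dO \<le> (sinh w)\<^sup>2 / dE" using d by (intro divide_left_mono) auto
    moreover have "(cosh w)\<^sup>2 / dE + (sinh w)\<^sup>2 / dE = cosh (2 * w) / dE" by (simp add: cd add_divide_distrib)
    moreover have "cosh (2 * w) / dE < 2 * r * cosh (2 * w)"
      using rd d mult_strict_right_mono[OF rd, of "cosh (2 * w)"] by (simp add: field_simps)
    ultimately show ?thesis unfolding 1 using B1 by (simp add: minus_divide_left[symmetric])
  qed
qed

lemma exp_m2: "exp (- 2 * L) = exp (- L) * exp (- L)" "exp (2*L) = exp L * exp L" "exp L * exp (-L) = 1"
  by (simp_all flip: exp_add)

lemma profile_bc:
  "even_prof (even_coef \<sigma> L - 4) L - \<sigma> * even_prof (even_coef \<sigma> L) L = - (1 - \<sigma>) * exp (- L) * even_den \<sigma> L"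
  "odd_prof (odd_coef \<sigma> L - 4) L - \<sigma> * odd_prof (odd_coef \<sigma> L) L = - (1 - \<sigma>) * exp (- L) * odd_den \<sigma> L"
  "odd_prof (even_coef \<sigma> L - 6) L - (2 - \<sigma>) * odd_prof (even_coef \<sigma> L - 2) L = - (1 - \<sigma>) * exp (- L) * even_den \<sigma> L"
  "even_prof (odd_coef \<sigma> L - 6) L - (2 - \<sigma>) * even_prof (odd_coef \<sigma> L - 2) L = - (1 - \<sigma>) * exp (- L) * odd_den \<sigma> L"
proof -
  define E where "E = exp L"
  have E: "E > 0" "exp (- L) = 1 / E" by (auto simp: E_def exp_minus inverse_eq_divide)
  have s: "cosh L = (E + 1 / E) / 2" "sinh L = (E - 1 / E) / 2" "sinh (2 * L) = (E * E - 1 / (E * E)) / 2"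
     "exp (- 2 * L) = 1 / (E * E)"
    using exp_m2 by (auto simp: cosh_field_def sinh_field_def E(2) exp_minus inverse_eq_divide simp flip: E_def)
  have h: "hinge_Q \<sigma> * (1 - \<sigma>) = 3 + \<sigma>" using sg by (simp add: hinge_Q_def)
  define Q where "Q = hinge_Q \<sigma>"
  have "\<sigma> * (Q + 1) = Q - 3" using h by (simp add: Q_def algebra_simps)
  \<comment> \<open>Inverting \<open>hinge_Q\<close> makes everything rational in L, E and Q, so the
    four claims become polynomial identities.\<close>
  then have sQ: "\<sigma> = (Q - 3) / (Q + 1)" using hinge_Q_ge by (simp add: Q_def field_simps)
  have Q: "Q + 1 > 0" using hinge_Q_ge by (simp add: Q_def)
  show "even_prof (even_coef \<sigma> L - 4) L - \<sigma> * even_prof (even_coef \<sigma> L) L = - (1 - \<sigma>) * exp (- L) * even_den \<sigma> L"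
    using E(1) Q unfolding even_prof_def odd_prof_def even_coef_def odd_coef_def even_den_def odd_den_def s E(2) Q_def[symmetric] unfolding sQ
    by (simp add: divide_simps) algebra
  show "odd_prof (odd_coef \<sigma> L - 4) L - \<sigma> * odd_prof (odd_coef \<sigma> L) L = - (1 - \<sigma>) * exp (- L) * odd_den \<sigma> L"
    using E(1) Q unfolding even_prof_def odd_prof_def even_coef_def odd_coef_def even_den_def odd_den_def s E(2) Q_def[symmetric] unfolding sQ
    by (simp add: divide_simps) algebra
  show "odd_prof (even_coef \<sigma> L - 6) L - (2 - \<sigma>) * odd_prof (even_coef \<sigma> L - 2) L = - (1 - \<sigma>) * exp (- L) * even_den \<sigma> L"
    using E(1) Q unfolding even_prof_def odd_prof_def even_coef_def odd_coef_def even_den_def odd_den_def s E(2) Q_def[symmetric] unfolding sQ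
    by (simp add: divide_simps) algebra
  show "even_prof (odd_coef \<sigma> L - 6) L - (2 - \<sigma>) * even_prof (odd_coef \<sigma> L - 2) L = - (1 - \<sigma>) * exp (- L) * odd_den \<sigma> L"
    using E(1) Q unfolding even_prof_def odd_prof_def even_coef_def odd_coef_def even_den_def odd_den_def s E(2) Q_def[symmetric] unfolding sQ
    by (simp add: divide_simps) algebra
qed

text \<open>By \<open>profile_bc\<close> the denominators cancel and both operators see the same
  multiple of A + B, which is a combination of two exponentials. These balance the whole-line kernel
  and the image term; X and Y are the exponentials that remain at y = L.\<close>

lemma right_bc:
  "right_br \<sigma> L w 2 L = \<sigma> * right_br \<sigma> L w 0 L"
  "right_br \<sigma> L w 3 L = (2 - \<sigma>) * right_br \<sigma> L w 1 L"
proof -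
  have h: "hinge_Q \<sigma> * (1 - \<sigma>) = 3 + \<sigma>" using sg by (simp add: hinge_Q_def)
  have d: "even_den \<sigma> L \<noteq> 0" "odd_den \<sigma> L \<noteq> 0" using even_den_pos odd_den_pos by auto
  define A where "A = even_prof (even_coef \<sigma> L) w"
  define B where "B = odd_prof (odd_coef \<sigma> L) w"
  define r where "r = hinge_Q \<sigma> * exp (- 2 * L)"
  have r: "(1 - \<sigma>) * r = (3 + \<sigma>) * exp (- 2 * L)" using h by (simp add: r_def mult.assoc[symmetric] mult.commute)
  have AB: "A + B = (2 * L + 1 - 2 * w) * exp w + r * exp (- w)"
    by (simp add: A_def B_def r_def even_prof_def odd_prof_def even_coef_def odd_coef_def cosh_field_def sinh_field_def field_simps)
  have e: "exp (- (L - w)) = exp (- L) * exp w" "exp (- 2 * L) * exp (L + w) = exp (- L) * exp w"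
    "exp (- 2 * L) * exp (- (L + w)) = exp (- 3 * L) * exp (- w)" "exp (- 2 * L) * exp (- L) = exp (- 3 * L)"
    by (simp_all flip: exp_add)
  define X where "X = exp (- L) * exp w"
  define Y where "Y = exp (- 3 * L) * exp (- w)"
  have rX: "(1 - \<sigma>) * r * exp (L + w) = (3 + \<sigma>) * X" "(1 - \<sigma>) * r * exp (- (L + w)) = (3 + \<sigma>) * Y"
    unfolding r by (simp_all only: X_def Y_def mult.assoc e(2,3))
  have "(1 - \<sigma>) * exp (- L) * (r * exp (- w)) = ((1 - \<sigma>) * r) * (exp (- L) * exp (- w))"
    by (simp only: mult.assoc mult.left_commute)
  also have "\<dots> = (3 + \<sigma>) * ((exp (- 2 * L) * exp (- L)) * exp (- w))" unfolding r by (simp only: mult.assoc)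
  finally have rX3: "(1 - \<sigma>) * exp (- L) * (r * exp (- w)) = (3 + \<sigma>) * Y"
    unfolding e(4) Y_def .
  have AB': "(1 - \<sigma>) * exp (- L) * (A + B) = (1 - \<sigma>) * (2 * L + 1 - 2 * w) * X + (3 + \<sigma>) * Y"
    unfolding AB distrib_left rX3 by (simp add: X_def)
  have ch: "(1 - \<sigma>) * r * cosh (L + w) = ((3 + \<sigma>) * X + (3 + \<sigma>) * Y) / 2"
    "(1 - \<sigma>) * r * sinh (L + w) = ((3 + \<sigma>) * X - (3 + \<sigma>) * Y) / 2"
    unfolding rX(1)[symmetric] rX(2)[symmetric] cosh_field_def sinh_field_def by (simp_all add: algebra_simps)
  have "right_br \<sigma> L w 2 L - \<sigma> * right_br \<sigma> L w 0 L =
     ((L - w - 1) - \<sigma> * (1 + (L - w))) * exp (- (L - w)) + (1 - \<sigma>) * r * cosh (L + w)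
     + (even_prof (even_coef \<sigma> L - 4) L - \<sigma> * even_prof (even_coef \<sigma> L) L) * A / (2 * even_den \<sigma> L)
     + (odd_prof (odd_coef \<sigma> L - 4) L - \<sigma> * odd_prof (odd_coef \<sigma> L) L) * B / (2 * odd_den \<sigma> L)"
    by (simp add: right_br_def corr_def A_def B_def r_def algebra_simps add_divide_distrib diff_divide_distrib)
  also have "\<dots> = ((L - w - 1) - \<sigma> * (1 + (L - w))) * exp (- (L - w)) + (1 - \<sigma>) * r * cosh (L + w)
      - (1 - \<sigma>) * exp (- L) * (A + B) / 2"
    unfolding profile_bc using d by (simp add: field_simps)
  also have "\<dots> = 0" unfolding e(1) X_def[symmetric] AB' ch by (simp add: field_simps)
  finally show "right_br \<sigma> L w 2 L = \<sigma> * right_br \<sigma> L w 0 L" by simp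
  have "right_br \<sigma> L w 3 L - (2 - \<sigma>) * right_br \<sigma> L w 1 L =
     ((2 - (L - w)) + (2 - \<sigma>) * (L - w)) * exp (- (L - w)) - (1 - \<sigma>) * r * sinh (L + w)
     + (odd_prof (even_coef \<sigma> L - 6) L - (2 - \<sigma>) * odd_prof (even_coef \<sigma> L - 2) L) * A / (2 * even_den \<sigma> L)
     + (even_prof (odd_coef \<sigma> L - 6) L - (2 - \<sigma>) * even_prof (odd_coef \<sigma> L - 2) L) * B / (2 * odd_den \<sigma> L)"
    by (simp add: right_br_def corr_def A_def B_def r_def algebra_simps add_divide_distrib diff_divide_distrib)
  also have "\<dots> = ((2 - (L - w)) + (2 - \<sigma>) * (L - w)) * exp (- (L - w)) - (1 - \<sigma>) * r * sinh (L + w)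
      - (1 - \<sigma>) * exp (- L) * (A + B) / 2"
    unfolding profile_bc using d by (simp add: field_simps)
  also have "\<dots> = 0" unfolding e(1) X_def[symmetric] AB' ch by (simp add: field_simps)
  finally show "right_br \<sigma> L w 3 L = (2 - \<sigma>) * right_br \<sigma> L w 1 L" by simp
qed

lemma left_bc:
  "left_br \<sigma> L w 2 (- L) = \<sigma> * left_br \<sigma> L w 0 (- L)"
  "left_br \<sigma> L w 3 (- L) = (2 - \<sigma>) * left_br \<sigma> L w 1 (- L)"
  using right_bc[of "- w"] right_br_reflect[of \<sigma> L w _ "- L"] by simp_all

text \<open>Minimum principle: writing \<open>F\<close> for the branch, \<open>z = F + F''\<close> satisfies \<open>z'' = z - 2 (F - F'') < z\<close>, and it is
  positive at the boundary by the boundary condition and on the diagonal by the explicit formula.\<close>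
lemma right_br_sum_pos:
  assumes w: "\<bar>w\<bar> \<le> L" and y: "w \<le> y" "y \<le> L"
  shows "right_br \<sigma> L w 0 y + right_br \<sigma> L w 2 y > 0"
proof -
  define z where "z = (\<lambda>k y. right_br \<sigma> L w k y + right_br \<sigma> L w (k + 2) y)"
  have dz: "(z k has_real_derivative z (Suc k) t) (at t)" for k t
    unfolding z_def by (auto intro!: derivative_eq_intros right_br_deriv)
  have z2: "z 2 t < z 0 t" for t
    using br_diff_pos(2)[OF w, of t] right_br_ode[of \<sigma> L w t] by (simp add: z_def eval_nat_numeral)
  \<comment> \<open>At y = w the whole-line kernel contributes 1 - 1, which leaves the quantity of
    \<open>corr_diag_pos\<close>.\<close>
  have zw: "z 0 w > 0"
    using corr_diag_pos[OF w] by (simp add: z_def right_br_def numeral_2_eq_2)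
  have zL: "z 0 L > 0"
  proof -
    have p: "0 < right_br \<sigma> L w 0 L" using br_pos(2)[OF w, of L] w L by simp
    then have "0 \<le> \<sigma> * right_br \<sigma> L w 0 L" using sg by simp
    then show ?thesis using p right_bc(1)[of w] by (simp add: z_def numeral_2_eq_2)
  qed
  have "continuous_on {w..L} (z 0)"
    using dz by (meson DERIV_isCont continuous_at_imp_continuous_on)
  then obtain t where t: "t \<in> {w..L}" "\<And>u. u \<in> {w..L} \<Longrightarrow> z 0 t \<le> z 0 u"
    using continuous_attains_inf[of "{w..L}" "z 0"] y by auto
  have "z 0 t > 0"
  proof (rule ccontr)
    assume n: "\<not> z 0 t > 0"
    then have ti: "w < t" "t < L" using t(1) zw zL by (auto simp: order_less_le)
    have z1: "z 1 t = 0"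
    proof (rule DERIV_local_min)
      show "(z 0 has_real_derivative z 1 t) (at t)" using dz[of 0 t] by simp
      show "0 < min (t - w) (L - t)" using ti by simp
      show "\<forall>u. \<bar>t - u\<bar> < min (t - w) (L - t) \<longrightarrow> z 0 t \<le> z 0 u"
        using t(2) by (auto simp: abs_if split: if_splits)
    qed
    \<comment> \<open>At a nonpositive minimum z'' is negative, so z' becomes negative just to the
      right of t and z drops below its minimum.\<close>
    have "z 2 t < 0" using z2[of t] n by simp
    then obtain d where d: "d > 0" "\<And>h. \<lbrakk>0 < h; h < d\<rbrakk> \<Longrightarrow> z 1 (t + h) < z 1 t"
      using DERIV_neg_dec_right[of "z 1" "z 2 t" t] dz[of 1 t] by (auto simp: numeral_2_eq_2)
    define h where "h = min (d / 2) ((L - t) / 2)"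
    have h: "0 < h" "h < d" "t + h < L" using d ti by (auto simp: h_def min_def field_simps)
    have "z 0 (t + h) < z 0 t"
    proof (rule DERIV_neg_imp_decreasing_open[of t "t + h"])
      show "t < t + h" using h by simp
      show "\<exists>y. (z 0 has_real_derivative y) (at x) \<and> y < 0" if "t < x" "x < t + h" for x
        using dz[of 0 x] d(2)[of "x - t"] that h z1 by (intro exI[of _ "z 1 x"]) auto
      show "continuous_on {t..t + h} (z 0)" using dz by (meson DERIV_isCont continuous_at_imp_continuous_on)
    qed
    moreover have "z 0 t \<le> z 0 (t + h)" using t(2)[of "t + h"] h t(1) by auto
    ultimately show False by simp
  qed
  also have "z 0 t \<le> z 0 y" using t(2) y by auto
  finally show ?thesis by (simp add: z_def numeral_2_eq_2)
qed

lemma left_br_sum_pos: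
  assumes "\<bar>w\<bar> \<le> L" "- L \<le> y" "y \<le> w"
  shows "left_br \<sigma> L w 0 y + left_br \<sigma> L w 2 y > 0"
  using right_br_sum_pos[of "- w" "- y"] right_br_reflect[of \<sigma> L w _ y] assms by simp

end

text \<open>The substitution y = m t reduces frequency m on (-l, l) to frequency 1 with L = m l. The
  prefactor normalises the jump of the third derivative to 1. The branch taken at t = w matters only
  for k \<ge> 3.\<close>

definition beam_green :: "real \<Rightarrow> real \<Rightarrow> real \<Rightarrow> real \<Rightarrow> nat \<Rightarrow> real \<Rightarrow> real" where
  "beam_green \<sigma> l m w k t =
     m ^ k / (4 * m ^ 3) * (if t \<le> w then left_br else right_br) \<sigma> (m * l) (m * w) k (m * t)"
definition beam_left :: "real \<Rightarrow> real \<Rightarrow> real \<Rightarrow> real \<Rightarrow> nat \<Rightarrow> real \<Rightarrow> real" where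
  "beam_left \<sigma> l m w k t = m ^ k / (4 * m ^ 3) * left_br \<sigma> (m * l) (m * w) k (m * t)"
definition beam_right :: "real \<Rightarrow> real \<Rightarrow> real \<Rightarrow> real \<Rightarrow> nat \<Rightarrow> real \<Rightarrow> real" where
  "beam_right \<sigma> l m w k t = m ^ k / (4 * m ^ 3) * right_br \<sigma> (m * l) (m * w) k (m * t)"

lemma beam_green_eq:
  "beam_green \<sigma> l m w k t = (if t \<le> w then beam_left \<sigma> l m w k t else beam_right \<sigma> l m w k t)"
  by (simp add: beam_green_def beam_left_def beam_right_def)

lemma beam_left_deriv: "(beam_left \<sigma> l m w k has_real_derivative beam_left \<sigma> l m w (Suc k) t) (at t)"
  and beam_right_deriv: "(beam_right \<sigma> l m w k has_real_derivative beam_right \<sigma> l m w (Suc k) t) (at t)"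
proof -
  have "((\<lambda>t. m * t) has_real_derivative m) (at t)" by (auto intro!: derivative_eq_intros)
  note d = DERIV_cmult[OF DERIV_chain2[OF left_br_deriv this]] DERIV_cmult[OF DERIV_chain2[OF right_br_deriv this]]
  show "(beam_left \<sigma> l m w k has_real_derivative beam_left \<sigma> l m w (Suc k) t) (at t)"
    "(beam_right \<sigma> l m w k has_real_derivative beam_right \<sigma> l m w (Suc k) t) (at t)"
    unfolding beam_left_def[abs_def] beam_right_def[abs_def]
    by (rule DERIV_cong[OF d(1)], simp) (rule DERIV_cong[OF d(2)], simp)
qed

lemma beam_agree: "k \<le> 2 \<Longrightarrow> beam_left \<sigma> l m w k w = beam_right \<sigma> l m w k w"
  using branches_agree by (simp add: beam_left_def beam_right_def)

lemma beam_green_right: "w \<le> t \<Longrightarrow> k \<le> 2 \<Longrightarrow> beam_green \<sigma> l m w k t = beam_right \<sigma> l m w k t"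
  using beam_agree by (auto simp: beam_green_eq order_le_less)
lemma beam_green_left: "t \<le> w \<Longrightarrow> beam_green \<sigma> l m w k t = beam_left \<sigma> l m w k t"
  by (auto simp: beam_green_eq)

lemma beam_jump: "m > 0 \<Longrightarrow> beam_right \<sigma> l m w 3 w - beam_left \<sigma> l m w 3 w = 1"
  using branches_jump[of \<sigma> "m * l" "m * w"] by (simp add: beam_left_def beam_right_def field_simps)

lemma beam_left_ode: "m > 0 \<Longrightarrow> beam_left \<sigma> l m w 4 t = 2 * m\<^sup>2 * beam_left \<sigma> l m w 2 t - m ^ 4 * beam_left \<sigma> l m w 0 t"
  and beam_right_ode: "m > 0 \<Longrightarrow> beam_right \<sigma> l m w 4 t = 2 * m\<^sup>2 * beam_right \<sigma> l m w 2 t - m ^ 4 * beam_right \<sigma> l m w 0 t"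
  unfolding beam_left_def beam_right_def left_br_ode right_br_ode
  by (simp_all add: field_simps power_numeral_reduce)

lemma DERIV_If_join:
  fixes p q :: "real \<Rightarrow> real"
  assumes "\<And>t. (p has_real_derivative p' t) (at t)" "\<And>t. (q has_real_derivative q' t) (at t)"
    and "p w = q w" "p' w = q' w"
  shows "((\<lambda>t. if t \<le> w then p t else q t) has_real_derivative (if t \<le> w then p' t else q' t)) (at t)"
proof -
  have "((\<lambda>t. if t \<in> {..w} then p t else q t) has_vector_derivative
        (if t \<in> {..w} then p' t else q' t)) (at t within UNIV)"
    by (rule has_vector_derivative_If_within_closures[where T = "{w..}"])
      (use assms in \<open>auto simp flip: has_real_derivative_iff_has_vector_derivative intro: has_field_derivative_at_within
        dest: order_antisym\<close>)
  then show ?thesis by (simp add: has_real_derivative_iff_has_vector_derivative)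
qed

lemma beam_green_deriv:
  assumes "k \<le> 1"
  shows "(beam_green \<sigma> l m w k has_real_derivative beam_green \<sigma> l m w (Suc k) t) (at t)"
proof -
  have "k \<le> 2" "Suc k \<le> 2" using assms by auto
  from DERIV_If_join[OF beam_left_deriv beam_right_deriv beam_agree[OF this(1)] beam_agree[OF this(2)]]
  show ?thesis unfolding beam_green_eq[abs_def] .
qed

lemma beam_green_cont: "k \<le> 2 \<Longrightarrow> continuous_on S (beam_green \<sigma> l m w k)"
proof -
  assume k: "k \<le> 2"
  have c: "continuous_on A (beam_left \<sigma> l m w k)" "continuous_on A (beam_right \<sigma> l m w k)" for A
    using beam_left_deriv beam_right_deriv by (meson DERIV_isCont continuous_at_imp_continuous_on)+
  have "continuous_on ({..w} \<union> {w..}) (\<lambda>t. if t \<le> w then beam_left \<sigma> l m w k t else beam_right \<sigma> l m w k t)"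
    by (intro continuous_on_If c) (use beam_agree[OF k] in \<open>auto simp: order_antisym\<close>)
  moreover have "{..w} \<union> {w..} = (UNIV :: real set)" by auto
  ultimately have "continuous_on UNIV (beam_green \<sigma> l m w k)" by (simp add: beam_green_eq[abs_def])
  then show ?thesis using continuous_on_subset by blast
qed

text \<open>The whole-line kernel depends on the distance and \<open>corr\<close> with k = 0 is
  symmetric term by term. This lets \<open>beam_decreasing\<close> compare two energy identities at
  the same pair of points.\<close>

lemma beam_green_sym: "beam_green \<sigma> l m w 0 t = beam_green \<sigma> l m t 0 w"
proof -
  have "corr \<sigma> (m * l) (m * w) 0 (m * t) = corr \<sigma> (m * l) (m * t) 0 (m * w)"
    by (simp add: corr_def algebra_simps)
  then show ?thesis
    by (auto simp: beam_green_def left_br_def right_br_def)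
qed

lemma beam_bounds:
  assumes "0 \<le> \<sigma>" "\<sigma> < 1" "l > 0" "m > 0" "w \<in> {-l..l}" "t \<in> {-l..l}"
  shows "beam_green \<sigma> l m w 0 t > 0" "\<bar>beam_green \<sigma> l m w 2 t\<bar> < m\<^sup>2 * beam_green \<sigma> l m w 0 t"
proof -
  have L: "m * l > 0" using assms by simp
  have w: "\<bar>m * w\<bar> \<le> m * l" and t: "\<bar>m * t\<bar> \<le> m * l"
    using assms by (auto simp: abs_mult)
  have t': "- (m * l) \<le> m * t" "m * t \<le> m * l" using t by auto
  have c: "m * t \<le> m * w \<longleftrightarrow> t \<le> w" using assms by simp
  define F where "F = (\<lambda>k. (if t \<le> w then left_br else right_br) \<sigma> (m * l) (m * w) k (m * t))"
  have "F 0 > 0" "F 0 - F 2 > 0" "F 0 + F 2 > 0"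
    using br_pos[OF assms(1,2) L w t] br_diff_pos[OF assms(1,2) L w, of "m * t"]
      right_br_sum_pos[OF assms(1,2) L w] left_br_sum_pos[OF assms(1,2) L w] t' c
    by (auto simp: F_def)
  then have F: "F 0 > 0" "\<bar>F 2\<bar> < F 0" by auto
  have b: "beam_green \<sigma> l m w 0 t = F 0 / (4 * m ^ 3)" "beam_green \<sigma> l m w 2 t = m\<^sup>2 * (F 2 / (4 * m ^ 3))"
    by (simp_all add: beam_green_def F_def)
  show "beam_green \<sigma> l m w 0 t > 0" using F assms by (simp add: b)
  have "\<bar>F 2\<bar> / (4 * m ^ 3) < F 0 / (4 * m ^ 3)" using F assms by (intro divide_strict_right_mono) auto
  then show "\<bar>beam_green \<sigma> l m w 2 t\<bar> < m\<^sup>2 * beam_green \<sigma> l m w 0 t"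
    using assms F by (simp add: b abs_mult divide_strict_right_mono)
qed

lemma beam_bc:
  assumes "0 \<le> \<sigma>" "\<sigma> < 1" "l > 0" "m > 0"
  shows "beam_right \<sigma> l m w 2 l = \<sigma> * m\<^sup>2 * beam_right \<sigma> l m w 0 l"
    "beam_right \<sigma> l m w 3 l = (2 - \<sigma>) * m\<^sup>2 * beam_right \<sigma> l m w 1 l"
    "beam_left \<sigma> l m w 2 (- l) = \<sigma> * m\<^sup>2 * beam_left \<sigma> l m w 0 (- l)"
    "beam_left \<sigma> l m w 3 (- l) = (2 - \<sigma>) * m\<^sup>2 * beam_left \<sigma> l m w 1 (- l)"
proof -
  have L: "m * l > 0" using assms by simp
  show "beam_right \<sigma> l m w 2 l = \<sigma> * m\<^sup>2 * beam_right \<sigma> l m w 0 l"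
    "beam_right \<sigma> l m w 3 l = (2 - \<sigma>) * m\<^sup>2 * beam_right \<sigma> l m w 1 l"
    "beam_left \<sigma> l m w 2 (- l) = \<sigma> * m\<^sup>2 * beam_left \<sigma> l m w 0 (- l)"
    "beam_left \<sigma> l m w 3 (- l) = (2 - \<sigma>) * m\<^sup>2 * beam_left \<sigma> l m w 1 (- l)"
    using right_bc[OF assms(1,2) L, of "m * w"] left_bc[OF assms(1,2) L, of "m * w"]
    by (simp_all add: beam_left_def beam_right_def power_numeral_reduce)
qed

section \<open>Energy identity of the beam problem and monotonicity in the frequency\<close>

lemma beam_energy:
  fixes f f1 f2 :: "real \<Rightarrow> real"
  assumes par: "0 \<le> \<sigma>" "\<sigma> < 1" "l > 0" "m > 0" and w: "w \<in> {-l..l}"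
    and f: "\<And>t. (f has_real_derivative f1 t) (at t)" "\<And>t. (f1 has_real_derivative f2 t) (at t)"
  defines "g \<equiv> beam_green \<sigma> l m w"
  shows "((\<lambda>t. f2 t * g 2 t + 2 * (1 - \<sigma>) * m\<^sup>2 * f1 t * g 1 t - \<sigma> * m\<^sup>2 * (f2 t * g 0 t + f t * g 2 t)
          + m ^ 4 * f t * g 0 t) has_integral f w) {-l..l}"
proof -
  define I where "I = (\<lambda>(h :: nat \<Rightarrow> real \<Rightarrow> real) t. f2 t * h 2 t + 2 * (1 - \<sigma>) * m\<^sup>2 * f1 t * h 1 t
      - \<sigma> * m\<^sup>2 * (f2 t * h 0 t + f t * h 2 t) + m ^ 4 * f t * h 0 t)"
  \<comment> \<open>\<open>C\<close> is a primitive of the energy integrand along solutions of the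
    fourth order equation. Both brackets vanish at the ends by \<open>beam_bc\<close>, and at w the
    unit jump of the third derivative releases f w.\<close>
  define C where "C = (\<lambda>(h :: nat \<Rightarrow> real \<Rightarrow> real) t. f1 t * (h 2 t - \<sigma> * m\<^sup>2 * h 0 t)
      + f t * ((2 - \<sigma>) * m\<^sup>2 * h 1 t - h 3 t))"
  have dC: "(C h has_real_derivative I h t) (at t)"
    if h: "\<And>k t. (h k has_real_derivative h (Suc k) t) (at t)"
      and o: "\<And>t. h 4 t = 2 * m\<^sup>2 * h 2 t - m ^ 4 * h 0 t" for h t
  proof -
    have h': "(h 0 has_real_derivative h 1 t) (at t)" "(h 1 has_real_derivative h 2 t) (at t)"
      "(h 2 has_real_derivative h 3 t) (at t)" "(h 3 has_real_derivative h 4 t) (at t)"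
      using h[of 0 t] h[of 1 t] h[of 2 t] h[of 3 t] by (simp_all add: eval_nat_numeral)
    show ?thesis unfolding C_def I_def
      by (rule derivative_eq_intros f h' refl)+ (simp add: o algebra_simps)
  qed
  note dl = dC[of "beam_left \<sigma> l m w", OF beam_left_deriv beam_left_ode[OF par(4)]]
  note dr = dC[of "beam_right \<sigma> l m w", OF beam_right_deriv beam_right_ode[OF par(4)]]
  have l: "(I (beam_left \<sigma> l m w) has_integral (C (beam_left \<sigma> l m w) w - C (beam_left \<sigma> l m w) (-l))) {-l..w}"
    using w dl by (intro fundamental_theorem_of_calculus)
      (auto simp flip: has_real_derivative_iff_has_vector_derivative intro: has_field_derivative_at_within)
  have r: "(I (beam_right \<sigma> l m w) has_integral (C (beam_right \<sigma> l m w) l - C (beam_right \<sigma> l m w) w)) {w..l}"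
    using w dr by (intro fundamental_theorem_of_calculus)
      (auto simp flip: has_real_derivative_iff_has_vector_derivative intro: has_field_derivative_at_within)
  have b0: "C (beam_left \<sigma> l m w) (-l) = 0" "C (beam_right \<sigma> l m w) l = 0"
    unfolding C_def beam_bc[OF par] by simp_all
  have j: "C (beam_left \<sigma> l m w) w - C (beam_right \<sigma> l m w) w = f w"
  proof -
    have "C (beam_left \<sigma> l m w) w - C (beam_right \<sigma> l m w) w
        = f w * (beam_right \<sigma> l m w 3 w - beam_left \<sigma> l m w 3 w)"
      using beam_agree[of 0 \<sigma> l m w] beam_agree[of 1 \<sigma> l m w] beam_agree[of 2 \<sigma> l m w]
      unfolding C_def by (simp add: algebra_simps)
    then show ?thesis using beam_jump[OF par(4)] by simp
  qed
  have "(I g has_integral (C (beam_left \<sigma> l m w) w - C (beam_left \<sigma> l m w) (-l))) {-l..w}"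
    by (rule has_integral_eq[OF _ l]) (simp add: I_def g_def beam_green_left)
  moreover have "(I g has_integral (C (beam_right \<sigma> l m w) l - C (beam_right \<sigma> l m w) w)) {w..l}"
    by (rule has_integral_eq[OF _ r]) (simp add: I_def g_def beam_green_right)
  ultimately have "(I g has_integral (C (beam_left \<sigma> l m w) w - C (beam_left \<sigma> l m w) (-l)
      + (C (beam_right \<sigma> l m w) l - C (beam_right \<sigma> l m w) w))) {-l..l}"
    using w by (intro has_integral_combine[of "-l" w l]) auto
  then show ?thesis using b0 j by (simp add: I_def)
qed

text \<open>The energy forms for the frequencies \<open>m < n\<close> are combined so that only
  \<open>\<integral>(m\<^sup>2 n\<^sup>2 f g - f'' g'')\<close> survives; this is positive by the bounds \<open>\<bar>f''\<bar> < m\<^sup>2 f\<close>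
  and \<open>\<bar>g''\<bar> < n\<^sup>2 g\<close>.\<close>
lemma beam_decreasing:
  assumes par: "0 \<le> \<sigma>" "\<sigma> < 1" "l > 0" "m > 0" and w: "w \<in> {-l..l}" and y: "y \<in> {-l..l}" and mn: "m < n"
  shows "n\<^sup>2 * beam_green \<sigma> l n w 0 y < m\<^sup>2 * beam_green \<sigma> l m w 0 y"
proof -
  have n: "n > 0" using par mn by simp
  define f where "f = beam_green \<sigma> l m y"
  define g where "g = beam_green \<sigma> l n w"
  have df: "(f 0 has_real_derivative f 1 t) (at t)" "(f 1 has_real_derivative f 2 t) (at t)"
       "(g 0 has_real_derivative g 1 t) (at t)" "(g 1 has_real_derivative g 2 t) (at t)" for t
    using beam_green_deriv[of 0] beam_green_deriv[of 1] by (simp_all add: f_def g_def numeral_2_eq_2)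
  have 1: "((\<lambda>t. f 2 t * g 2 t + 2 * (1 - \<sigma>) * n\<^sup>2 * f 1 t * g 1 t - \<sigma> * n\<^sup>2 * (f 2 t * g 0 t + f 0 t * g 2 t)
          + n ^ 4 * f 0 t * g 0 t) has_integral f 0 w) {-l..l}"
    unfolding g_def by (rule beam_energy[OF par(1-3) n w df(1,2)])
  have 2: "((\<lambda>t. g 2 t * f 2 t + 2 * (1 - \<sigma>) * m\<^sup>2 * g 1 t * f 1 t - \<sigma> * m\<^sup>2 * (g 2 t * f 0 t + g 0 t * f 2 t)
          + m ^ 4 * g 0 t * f 0 t) has_integral g 0 y) {-l..l}"
    unfolding f_def by (rule beam_energy[OF par(1-4) y df(3,4)])
  \<comment> \<open>m^2 times the first identity minus n^2 times the second: the terms with first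
    derivatives and those with \<sigma> carry the factor m^2 n^2 in both and cancel.\<close>
  define h where "h = (\<lambda>t. (n\<^sup>2 - m\<^sup>2) * (m\<^sup>2 * n\<^sup>2 * (f 0 t * g 0 t) - f 2 t * g 2 t))"
  have hI: "(h has_integral (m\<^sup>2 * f 0 w - n\<^sup>2 * g 0 y)) {-l..l}"
    by (rule has_integral_eq[OF _ has_integral_diff[OF has_integral_mult_right[OF 1, of "m\<^sup>2"] has_integral_mult_right[OF 2, of "n\<^sup>2"]]])
       (simp add: h_def power2_eq_square power4_eq_xxxx algebra_simps)
  have nm: "m\<^sup>2 < n\<^sup>2" using par(4) mn by (intro power_strict_mono) auto
  have hpos: "h t > 0" if t: "t \<in> {-l..l}" for t
  proof -
    have "\<bar>f 2 t * g 2 t\<bar> < (m\<^sup>2 * f 0 t) * (n\<^sup>2 * g 0 t)"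
      unfolding abs_mult using beam_bounds(2)[OF par y t] beam_bounds(2)[OF par(1-3) n w t]
      by (intro mult_strict_mono') (auto simp: f_def g_def)
    then show ?thesis unfolding h_def using nm by (intro mult_pos_pos) (auto simp: algebra_simps)
  qed
  have "continuous_on {-l..l} h"
    unfolding h_def f_def g_def by (intro continuous_intros beam_green_cont) auto
  then obtain s where s: "s \<in> {-l..l}" "\<And>t. t \<in> {-l..l} \<Longrightarrow> h s \<le> h t"
    using continuous_attains_inf[of "{-l..l}" h] par(3) by auto
  have "((\<lambda>t. h s) has_integral (h s * (2 * l))) {-l..l}"
    using has_integral_const_real[of "h s" "-l" l] par(3) by (simp add: mult.commute)
  from has_integral_le[OF this hI s(2)] have "h s * (2 * l) \<le> m\<^sup>2 * f 0 w - n\<^sup>2 * g 0 y" by simp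
  moreover have "h s * (2 * l) > 0" using hpos[OF s(1)] par(3) by simp
  ultimately show ?thesis unfolding f_def g_def beam_green_sym[of \<sigma> l m w y] by linarith
qed

section \<open>Smooth functions of one variable\<close>

text \<open>One-variable counterpart of \<open>Ck\<close>. Products of such functions are smooth in
  the plane by \<open>Ck_separated\<close>, and such products are the tests inserted into the weak
  derivatives of u.\<close>

primrec Dk :: "nat \<Rightarrow> (real \<Rightarrow> real) \<Rightarrow> bool" where
  "Dk 0 f \<longleftrightarrow> continuous_on UNIV f"
| "Dk (Suc n) f \<longleftrightarrow> f differentiable_on UNIV \<and> Dk n (deriv f)"

lemma Dk_SucI:
  assumes "\<And>x. (f has_real_derivative f' x) (at x)" "Dk n f'"
  shows "Dk (Suc n) f"
proof -
  have "deriv f = f'" using assms(1) DERIV_imp_deriv by blast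
  then show ?thesis
    using assms by (auto simp: differentiable_on_def real_differentiable_def)
qed

lemma Dk_SucD:
  assumes "Dk (Suc n) f"
  shows "(f has_real_derivative deriv f x) (at x)"
proof -
  have "f differentiable (at x)" using assms by (auto simp: differentiable_on_def)
  then show ?thesis using DERIV_deriv_iff_real_differentiable by blast
qed

lemma Dk_Suc_imp: "Dk (Suc n) f \<Longrightarrow> Dk n f"
proof (induction n arbitrary: f)
  case 0
  then show ?case by (auto intro: differentiable_imp_continuous_on)
next
  case (Suc n)
  then show ?case by (metis Dk.simps(2))
qed

lemma Dk_add: "Dk n f \<Longrightarrow> Dk n g \<Longrightarrow> Dk n (\<lambda>x. f x + g x)"
proof (induction n arbitrary: f g)
  case 0
  then show ?case by (auto intro: continuous_intros)
next
  case (Suc n)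
  show ?case
    by (rule Dk_SucI[where f' = "\<lambda>x. deriv f x + deriv g x"])
      (use Suc in \<open>auto intro!: DERIV_add Dk_SucD simp del: Dk.simps(2)\<close>, simp add: Suc)
qed

lemma Dk_const: "Dk n (\<lambda>x. c)"
proof (induction n arbitrary: c)
  case (Suc n)
  show ?case by (rule Dk_SucI[where f' = "\<lambda>x. 0"]) (auto simp: Suc)
qed simp

lemma Dk_mult: "Dk n f \<Longrightarrow> Dk n g \<Longrightarrow> Dk n (\<lambda>x. f x * g x)"
proof (induction n arbitrary: f g)
  case 0
  then show ?case by (auto intro: continuous_intros)
next
  case (Suc n)
  have "Dk n f" "Dk n g" using Suc.prems Dk_Suc_imp by blast+
  then have "Dk n (\<lambda>x. deriv f x * g x + deriv g x * f x)"
    using Suc by (intro Dk_add Suc.IH) auto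
  then show ?case
    using Suc.prems by (intro Dk_SucI[where f' = "\<lambda>x. deriv f x * g x + deriv g x * f x"])
      (auto intro!: DERIV_mult Dk_SucD simp del: Dk.simps(2))
qed

lemma Dk_cmult: "Dk n f \<Longrightarrow> Dk n (\<lambda>x. c * f x)"
  by (rule Dk_mult[OF Dk_const])

lemma Dk_affine: "Dk n f \<Longrightarrow> Dk n (\<lambda>x. f (c * x + d))"
proof (induction n arbitrary: f)
  case 0
  then show ?case by (auto intro!: continuous_intros elim: continuous_on_compose2)
next
  case (Suc n)
  have D: "((\<lambda>x. f (c * x + d)) has_real_derivative c * deriv f (c * x + d)) (at x)" for x
  proof -
    have "((\<lambda>x. c * x + d) has_real_derivative c) (at x)" by (auto intro!: derivative_eq_intros)
    from DERIV_chain2[OF Dk_SucD[OF Suc.prems] this] show ?thesis by (simp add: mult.commute)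
  qed
  show ?case
    by (rule Dk_SucI[OF D]) (use Suc in \<open>auto intro!: Dk_cmult\<close>)
qed

section \<open>A smooth bump and its primitives\<close>

definition flat_exp :: "nat \<Rightarrow> real \<Rightarrow> real" where
  "flat_exp k t = (if t \<le> 0 then 0 else (1 / t) ^ k * exp (- (1 / t)))"

lemma flat_exp_tendsto: "((\<lambda>t. (1 / t) ^ k * exp (- (1 / t))) \<longlongrightarrow> (0::real)) (at_right 0)"
proof -
  have "((\<lambda>s::real. s ^ k / exp s) \<longlongrightarrow> 0) at_top" by (rule tendsto_power_div_exp_0)
  from filterlim_compose[OF this filterlim_inverse_at_top_right]
  show ?thesis by (simp add: field_simps exp_minus)
qed

text \<open>The negative powers are carried along so that the family is closed under
  differentiation; smoothness is then one induction for all k. At t = 0 the difference quotient from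
  the right is again a member of the family, which tends to 0.\<close>

lemma flat_exp_deriv:
  "(flat_exp k has_real_derivative flat_exp (k + 2) t - real k * flat_exp (k + 1) t) (at t)"
proof (cases "t = 0")
  case True
  have "((\<lambda>h. (flat_exp k (0 + h) - flat_exp k 0) / h) \<longlongrightarrow> 0) (at 0)"
  proof (subst filterlim_split_at)
    have "eventually (\<lambda>h. (flat_exp k (0 + h) - flat_exp k 0) / h = 0) (at_left 0)"
      by (rule eventually_at_leftI[of "-1"]) (auto simp: flat_exp_def)
    then show "((\<lambda>h. (flat_exp k (0 + h) - flat_exp k 0) / h) \<longlongrightarrow> 0) (at_left 0)"
      by (rule tendsto_eventually)
    have "eventually (\<lambda>h. (1 / h) ^ Suc k * exp (- (1 / h)) = (flat_exp k (0 + h) - flat_exp k 0) / h) (at_right 0)"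
      by (rule eventually_at_rightI[of 0 1]) (auto simp: flat_exp_def)
    from Lim_transform_eventually[OF flat_exp_tendsto this]
    show "((\<lambda>h. (flat_exp k (0 + h) - flat_exp k 0) / h) \<longlongrightarrow> 0) (at_right 0)" .
  qed simp
  then show ?thesis using True by (simp add: DERIV_def flat_exp_def)
next
  case False
  show ?thesis
  proof (cases "t < 0")
    case True
    have "eventually (\<lambda>s. flat_exp k s = 0) (nhds t)"
      using True by (intro eventually_nhds_in_open[of "{..<0}", THEN eventually_mono]) (auto simp: flat_exp_def)
    then have "(flat_exp k has_real_derivative 0) (at t)"
      by (subst DERIV_cong_ev[OF refl _ refl]) auto
    then show ?thesis using True by (simp add: flat_exp_def)
  next
    case n: False
    then have t: "t > 0" using False by simp
    have "eventually (\<lambda>s. flat_exp k s = (1 / s) ^ k * exp (- (1 / s))) (nhds t)"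
      using t by (intro eventually_nhds_in_open[of "{0<..}", THEN eventually_mono]) (auto simp: flat_exp_def)
    moreover have "((\<lambda>s. (1 / s) ^ k * exp (- (1 / s))) has_real_derivative
        flat_exp (k + 2) t - real k * flat_exp (k + 1) t) (at t)"
    proof -
      have p: "((\<lambda>s. (1 / s) ^ k) has_real_derivative - real k * (1 / t) ^ (k + 1)) (at t)"
      proof (induction k)
        case (Suc k)
        have "((\<lambda>s. 1 / s) has_real_derivative - (1 / t)\<^sup>2) (at t)"
          using t by (auto intro!: derivative_eq_intros simp: power2_eq_square)
        from DERIV_mult[OF this Suc]
        have "((\<lambda>s. (1 / s) ^ Suc k) has_real_derivative
            - (1 / t)\<^sup>2 * (1 / t) ^ k + - real k * (1 / t) ^ (k + 1) * (1 / t)) (at t)" by simp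
        then show ?case by (rule DERIV_cong) (simp add: field_simps power2_eq_square add_divide_distrib diff_divide_distrib)
      qed simp
      have e: "((\<lambda>s. exp (- (1 / s))) has_real_derivative exp (- (1 / t)) * (1 / t)\<^sup>2) (at t)"
        using t by (auto intro!: derivative_eq_intros simp: power2_eq_square)
      show ?thesis using DERIV_mult[OF p e] t
        by (simp add: flat_exp_def algebra_simps power2_eq_square)
    qed
    ultimately show ?thesis by (subst DERIV_cong_ev[OF refl _ refl])
  qed
qed

lemma Dk_flat_exp: "Dk n (flat_exp k)"
proof (induction n arbitrary: k)
  case 0
  show ?case using flat_exp_deriv by (auto intro!: DERIV_isCont continuous_at_imp_continuous_on)
next
  case (Suc n)
  have "Dk n (\<lambda>t. flat_exp (k + 2) t + (- real k) * flat_exp (k + 1) t)"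
    by (intro Dk_add Dk_cmult Suc)
  then show ?case using flat_exp_deriv by (intro Dk_SucI[OF flat_exp_deriv]) simp
qed

definition bump :: "real \<Rightarrow> real" where
  "bump t = flat_exp 0 (t + 1) * flat_exp 0 (1 - t)"

lemma Dk_bump: "Dk n bump"
  using Dk_mult[OF Dk_affine[OF Dk_flat_exp, of n 0 1 1] Dk_affine[OF Dk_flat_exp, of n 0 "-1" 1]]
  by (simp add: bump_def[abs_def] algebra_simps)

lemma bump_nonneg: "bump t \<ge> 0" by (simp add: bump_def flat_exp_def)
lemma bump_outside: "\<bar>t\<bar> \<ge> 1 \<Longrightarrow> bump t = 0" by (auto simp: bump_def flat_exp_def)
lemma bump_cont: "continuous_on A bump" using Dk_bump[of 0] continuous_on_subset by auto

definition bump_mass :: real where "bump_mass = integral {-1..1} bump"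

lemma bump_mass_pos: "bump_mass > 0"
proof -
  have "integral {-1..1} bump \<noteq> 0"
  proof
    assume "integral {-1..1} bump = 0"
    then have "bump 0 = 0"
      by (subst (asm) integral_eq_0_iff) (auto simp: bump_nonneg bump_cont)
    then show False by (simp add: bump_def flat_exp_def)
  qed
  moreover have "integral {-1..1} bump \<ge> 0"
    by (rule integral_nonneg) (auto simp: bump_nonneg intro!: integrable_continuous_real bump_cont)
  ultimately show ?thesis by (simp add: bump_mass_def)
qed

definition mollifier :: "real \<Rightarrow> real" where "mollifier t = bump t / bump_mass"

lemma mollifier_props:
  "Dk n mollifier" "mollifier t \<ge> 0" "\<bar>t\<bar> \<ge> 1 \<Longrightarrow> mollifier t = 0" "continuous_on A mollifier"
  "integral {-1..1} mollifier = 1"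
proof -
  show "Dk n mollifier" using Dk_cmult[OF Dk_bump, of n "1 / bump_mass"] by (simp add: mollifier_def[abs_def])
  show "mollifier t \<ge> 0" "\<bar>t\<bar> \<ge> 1 \<Longrightarrow> mollifier t = 0"
    using bump_mass_pos by (auto simp: mollifier_def bump_nonneg bump_outside)
  show "continuous_on A mollifier" unfolding mollifier_def[abs_def]
    using bump_mass_pos by (intro continuous_intros bump_cont) auto
  show "integral {-1..1} mollifier = 1"
    using bump_mass_pos by (simp add: mollifier_def[abs_def] bump_mass_def)
qed

text \<open>An antiderivative that is defined on all of \<open>\<real>\<close>; the value to the left of \<open>-1\<close> is the
  junk value \<open>0\<close> of an integral over an empty interval, which is correct for integrands vanishing there.\<close>
lemma antideriv_from_left:
  fixes f :: "real \<Rightarrow> real"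
  assumes c: "continuous_on UNIV f" and z: "\<And>t. t \<le> -1 \<Longrightarrow> f t = 0"
  shows "((\<lambda>t. integral {-1..t} f) has_real_derivative f t) (at t)"
proof -
  define F where "F = (\<lambda>t. integral {-1..t} f)"
  obtain b where b: "t < b" "-1 < b" using gt_ex[of "max t (-1)"] by auto
  obtain a where a: "a < t" "a < -1" using lt_ex[of "min t (-1)"] by auto
  have "((\<lambda>u. integral {a..u} f) has_real_derivative f t) (at t within {a..b})"
    using a b by (intro integral_has_real_derivative continuous_on_subset[OF c]) auto
  then have 1: "((\<lambda>u. integral {a..u} f) has_real_derivative f t) (at t)"
    using a b at_within_Icc_at[of a t b] by simp
  have eq: "integral {a..u} f = F u" if "u \<in> {a<..<b}" for u
  proof -
    have i: "f integrable_on {p..q}" for p q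
      by (intro integrable_continuous_real continuous_on_subset[OF c]) auto
    show ?thesis
    proof (cases "u \<le> -1")
      case True
      have "integral {a..u} f = integral {a..u} (\<lambda>_. 0)" using True z by (intro integral_cong) auto
      moreover have "F u = 0" using True z[of "-1"] by (cases "u = -1") (auto simp: F_def)
      ultimately show ?thesis by simp
    next
      case False
      have "integral {a..-1} f = integral {a..-1} (\<lambda>_. 0)" using z by (intro integral_cong) auto
      then show ?thesis
        using Henstock_Kurzweil_Integration.integral_combine[of a "-1" u f] False a i by (simp add: F_def)
    qed
  qed
  have "eventually (\<lambda>u. F u = integral {a..u} f) (nhds t)"
    using a b eq by (intro eventually_nhds_in_open[of "{a<..<b}", THEN eventually_mono]) auto
  then show ?thesis unfolding F_def[symmetric] using 1 by (subst DERIV_cong_ev[OF refl _ refl]) auto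
qed

text \<open>Smoothed Heaviside and ramp functions with transition in [-1, 1]. Under t -> n (t - q)
  the steps tend to indicators and the ramps divided by n to max 0 (t - q), while their first and
  second derivatives respectively are approximate identities.\<close>

definition sstep :: "real \<Rightarrow> real" where "sstep t = integral {-1..t} mollifier"
definition sramp :: "real \<Rightarrow> real" where "sramp t = integral {-1..t} sstep"

lemma sstep_left: "t \<le> -1 \<Longrightarrow> sstep t = 0"
  by (cases "t = -1") (auto simp: sstep_def)
lemma sramp_left: "t \<le> -1 \<Longrightarrow> sramp t = 0"
  by (cases "t = -1") (auto simp: sramp_def)

lemma sstep_deriv: "(sstep has_real_derivative mollifier t) (at t)"
  unfolding sstep_def[abs_def]
  by (rule antideriv_from_left) (auto simp: mollifier_props)

lemma sstep_cont: "continuous_on A sstep"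
  using sstep_deriv by (meson DERIV_isCont continuous_at_imp_continuous_on)

lemma sramp_deriv: "(sramp has_real_derivative sstep t) (at t)"
  unfolding sramp_def[abs_def]
  by (rule antideriv_from_left) (auto simp: sstep_cont sstep_left)

lemma Dk_sstep: "Dk n sstep"
proof (cases n)
  case 0
  then show ?thesis by (simp add: sstep_cont)
next
  case (Suc k)
  show ?thesis unfolding Suc by (rule Dk_SucI[OF sstep_deriv mollifier_props(1)])
qed

lemma Dk_sramp: "Dk n sramp"
  by (rule Dk_Suc_imp, rule Dk_SucI[OF sramp_deriv Dk_sstep])

lemma sstep_right: "t \<ge> 1 \<Longrightarrow> sstep t = 1"
proof -
  assume t: "t \<ge> 1"
  have i: "mollifier integrable_on {p..q}" for p q
    by (intro integrable_continuous_real mollifier_props)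
  have "integral {1..t} mollifier = integral {1..t} (\<lambda>_. 0)"
    by (intro integral_cong) (auto simp: mollifier_props)
  then show ?thesis
    using Henstock_Kurzweil_Integration.integral_combine[of "-1" 1 t mollifier] t i mollifier_props(5)
    by (simp add: sstep_def)
qed

lemma sstep_mono: "s \<le> t \<Longrightarrow> sstep s \<le> sstep t"
  by (rule DERIV_nonneg_imp_nondecreasing) (auto intro: sstep_deriv mollifier_props)

lemma sstep_bounds: "0 \<le> sstep t" "sstep t \<le> 1"
proof -
  show "0 \<le> sstep t" using sstep_mono[of "min t (-1)" t] sstep_left[of "min t (-1)"] by simp
  show "sstep t \<le> 1" using sstep_mono[of t "max t 1"] sstep_right[of "max t 1"] by simp
qed

text \<open>To the right of 1 the smoothed ramp is parallel to t. The gap cancels in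
  \<open>weak_second_deriv_affine\<close>, where the weights of the three ramps add up to 0.\<close>

definition ramp_offset :: real where "ramp_offset = 1 - sramp 1"

lemma sramp_right: "t \<ge> 1 \<Longrightarrow> sramp t = t - ramp_offset"
proof -
  assume t: "t \<ge> 1"
  have "\<exists>c. \<forall>x\<in>{1..t}. sramp x - x = c"
    by (rule has_field_derivative_zero_constant)
       (auto intro!: derivative_eq_intros sramp_deriv[THEN has_field_derivative_at_within] simp: sstep_right)
  then obtain c where "\<And>x. x \<in> {1..t} \<Longrightarrow> sramp x - x = c" by blast
  from this[of 1] this[of t] show ?thesis using t by (simp add: ramp_offset_def)
qed

text \<open>A crude uniform error is enough, because rescaling divides it by n.\<close>

lemma sramp_near: "\<bar>sramp t - max 0 t\<bar> \<le> 2"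
proof -
  have mono: "sramp s \<le> sramp t" if "s \<le> t" for s t
    using that by (rule DERIV_nonneg_imp_nondecreasing) (auto intro: sramp_deriv sstep_bounds)
  have lip: "sramp t \<le> sramp s + (t - s)" if "s \<le> t" for s t
  proof -
    have "(\<lambda>u. u - sramp u) s \<le> (\<lambda>u. u - sramp u) t"
      using that by (rule DERIV_nonneg_imp_nondecreasing)
        (auto intro!: derivative_eq_intros sramp_deriv exI simp: sstep_bounds)
    then show ?thesis by simp
  qed
  have 1: "sramp (-1) = 0" by (simp add: sramp_left)
  consider "t \<le> -1" | "-1 \<le> t" "t \<le> 1" | "t \<ge> 1" by linarith
  then show ?thesis
  proof cases
    case 2
    then show ?thesis using mono[of "-1" t] lip[of "-1" t] 1 by (auto simp: max_def)
  next
    case 3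
    then show ?thesis using sramp_right[of t] mono[of "-1" 1] lip[of "-1" 1] 1
      by (auto simp: ramp_offset_def max_def)
  qed (auto simp: sramp_left)
qed

section \<open>Compactly supported tests and approximate identities\<close>

definition cc_smooth :: "real \<Rightarrow> real \<Rightarrow> (real \<Rightarrow> real) \<Rightarrow> bool" where
  "cc_smooth a b \<alpha> \<longleftrightarrow> (\<forall>n. Dk n \<alpha>) \<and> (\<exists>c d. a < c \<and> d < b \<and> (\<forall>x. x \<notin> {c..d} \<longrightarrow> \<alpha> x = 0))"

lemma Dk_diff: "Dk n f \<Longrightarrow> Dk n g \<Longrightarrow> Dk n (\<lambda>x. f x - g x)"
  using Dk_add[of n f "\<lambda>x. (-1) * g x"] Dk_cmult[of n g "-1"] by simp

text \<open>The kernel has radius 1 / n around a moving centre q n, and \<open>inside\<close> keeps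
  it within [a, b]. Hence the limit point p may be an endpoint although U is controlled on [a, b]
  only.\<close>

lemma mollify:
  fixes U :: "real \<Rightarrow> real" and q :: "nat \<Rightarrow> real"
  assumes U: "continuous_on {a..b} U" and q: "q \<longlonglongrightarrow> p" and p: "p \<in> {a..b}"
    and inside: "eventually (\<lambda>n. a + 1 / real n \<le> q n \<and> q n \<le> b - 1 / real n) sequentially"
  shows "(\<lambda>n. integral {a..b} (\<lambda>t. U t * (real n * mollifier (real n * (t - q n))))) \<longlonglongrightarrow> U p"
proof (rule tendstoI)
  fix e :: real assume e: "e > 0"
  have "uniformly_continuous_on {a..b} U" using U by (simp add: compact_uniformly_continuous)
  then obtain d where d: "d > 0" "\<And>s t. \<lbrakk>s \<in> {a..b}; t \<in> {a..b}; dist t s < d\<rbrakk> \<Longrightarrow> dist (U t) (U s) < e / 2"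
    using e half_gt_zero[OF e] unfolding uniformly_continuous_on_def by metis
  have "eventually (\<lambda>n. dist (q n) p < d / 2) sequentially" using tendstoD[OF q, of "d / 2"] d by simp
  moreover have "eventually (\<lambda>n. 1 / real n < d / 2) sequentially"
    using d lim_1_over_n[where 'a = real] by (auto simp: tendsto_iff dist_real_def elim!: allE[of _ "d / 2"])
  moreover have "eventually (\<lambda>n. n > 0) sequentially" by (rule eventually_gt_at_top)
  ultimately show "eventually (\<lambda>n. dist (integral {a..b} (\<lambda>t. U t * (real n * mollifier (real n * (t - q n))))) (U p) < e) sequentially"
    using inside
  proof eventually_elim
    case (elim n)
    define k where "k = (\<lambda>t. real n * mollifier (real n * (t - q n)))"
    have n: "real n > 0" using elim by simp
    have ck: "continuous_on {a..b} k" unfolding k_def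
      by (intro continuous_intros continuous_on_compose2[OF mollifier_props(4)[of UNIV]]) auto
    have knn: "k t \<ge> 0" for t by (simp add: k_def mollifier_props)
    have ab: "a \<le> b" using p by simp
    have "(k has_integral (sstep (real n * (b - q n)) - sstep (real n * (a - q n)))) {a..b}"
    proof (rule fundamental_theorem_of_calculus[OF ab])
      fix t
      have "((\<lambda>t. real n * (t - q n)) has_real_derivative real n) (at t)"
        by (auto intro!: derivative_eq_intros)
      from DERIV_chain2[OF sstep_deriv this]
      show "((\<lambda>t. sstep (real n * (t - q n))) has_vector_derivative k t) (at t within {a..b})"
        by (simp add: k_def mult.commute has_field_derivative_at_within flip: has_real_derivative_iff_has_vector_derivative)
    qed
    moreover have "real n * (b - q n) \<ge> 1" "real n * (a - q n) \<le> -1"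
      using elim n by (simp_all add: field_simps)
    ultimately have k1: "(k has_integral 1) {a..b}" by (simp add: sstep_right sstep_left)
    have iU: "(\<lambda>t. U t * k t) integrable_on {a..b}"
      by (intro integrable_continuous_real continuous_intros U ck)
    have "integral {a..b} (\<lambda>t. U t * k t) - U p = integral {a..b} (\<lambda>t. U t * k t) - integral {a..b} (\<lambda>t. U p * k t)"
      using k1 by (simp add: integral_unique)
    also have "\<dots> = integral {a..b} (\<lambda>t. (U t - U p) * k t)"
      using iU integrable_on_cmult_left[OF has_integral_integrable[OF k1], of "U p"]
      by (subst integral_diff[symmetric]) (auto simp: left_diff_distrib)
    also have "norm \<dots> \<le> integral {a..b} (\<lambda>t. e / 2 * k t)"
    proof (rule integral_norm_bound_integral)
      show "(\<lambda>t. (U t - U p) * k t) integrable_on {a..b}"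
        by (intro integrable_continuous_real continuous_intros U ck)
      show "(\<lambda>t. e / 2 * k t) integrable_on {a..b}"
        by (intro integrable_continuous_real continuous_intros ck)
      fix t assume t: "t \<in> {a..b}"
      show "norm ((U t - U p) * k t) \<le> e / 2 * k t"
      proof (cases "\<bar>real n * (t - q n)\<bar> \<ge> 1")
        case True
        then show ?thesis by (simp add: k_def mollifier_props)
      next
        case False
        then have "real n * \<bar>t - q n\<bar> < 1" unfolding abs_mult by simp
        then have "\<bar>t - q n\<bar> < 1 / real n" using n by (simp add: pos_less_divide_eq mult.commute)
        moreover have "\<bar>q n - p\<bar> < d / 2" using elim by (simp add: dist_real_def)
        ultimately have "\<bar>t - p\<bar> < d" using elim(2) by linarith
        then have "dist t p < d" by (simp add: dist_real_def)
        from d(2)[OF p t this] have "\<bar>U t - U p\<bar> \<le> e / 2" by (simp add: dist_real_def)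
        from mult_right_mono[OF this knn[of t]] show ?thesis using knn[of t] by (simp add: abs_mult)
      qed
    qed
    also have "\<dots> = e / 2" using k1 by (simp add: integral_unique)
    finally show ?case using e by (simp add: k_def dist_real_def)
  qed
qed

lemma scaled_deriv:
  assumes "\<And>t. (f has_real_derivative f' t) (at t)"
  shows "((\<lambda>t. f (c * (t - q))) has_real_derivative c * f' (c * (t - q))) (at t)"
proof -
  have "((\<lambda>t. c * (t - q)) has_real_derivative c) (at t)" by (auto intro!: derivative_eq_intros)
  from DERIV_chain2[OF assms this] show ?thesis by (simp add: mult.commute)
qed

lemma Dk_scaled: "Dk n f \<Longrightarrow> Dk n (\<lambda>t. f (c * (t - q)))"
  using Dk_affine[of n f c "- c * q"] by (simp add: algebra_simps)

lemma eventually_inverse_small: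
  fixes d :: real
  assumes "d > 0"
  shows "eventually (\<lambda>n. 0 < n \<and> c < real n * d) sequentially"
proof -
  have "eventually (\<lambda>n. c / d < real n) sequentially"
    using filterlim_real_sequentially unfolding filterlim_at_top_dense by blast
  then show ?thesis using eventually_gt_at_top[of 0] by eventually_elim (use assms in \<open>auto simp: field_simps\<close>)
qed

lemma scaled_shift:
  assumes "n > 0"
  shows "real n * (q + c / real n) = real n * q + c" "real n * (q - c / real n) = real n * q - c"
  "t < q + c / real n \<longleftrightarrow> real n * t < real n * q + c"
  "q - c / real n < t \<longleftrightarrow> real n * q < real n * t + c"
  "q + c / real n < t \<longleftrightarrow> real n * q + c < real n * t"
  "t < q - c / real n \<longleftrightarrow> real n * t + c < real n * q"
  "q + c / real n \<le> r - d / real n \<longleftrightarrow> real n * q + c + d \<le> real n * r"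
  "q + c / real n \<le> r + d / real n \<longleftrightarrow> real n * q + c \<le> real n * r + d"
  "q - c / real n \<le> r - d / real n \<longleftrightarrow> real n * q + d \<le> real n * r + c"
  "q + c / real n \<le> t \<longleftrightarrow> real n * q + c \<le> real n * t"
  "t \<le> q - c / real n \<longleftrightarrow> real n * t + c \<le> real n * q"
proof -
  have n: "real n > 0" using assms by simp
  show 1: "real n * (q + c / real n) = real n * q + c" "real n * (q - c / real n) = real n * q - c" for q c
    using assms by (simp_all add: distrib_left right_diff_distrib)
  show "t < q + c / real n \<longleftrightarrow> real n * t < real n * q + c"
    "q - c / real n < t \<longleftrightarrow> real n * q < real n * t + c"
    "q + c / real n < t \<longleftrightarrow> real n * q + c < real n * t"
    "t < q - c / real n \<longleftrightarrow> real n * t + c < real n * q"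
    by (subst mult_less_cancel_left_pos[OF n, symmetric]; simp only: 1; linarith)+
  show "q + c / real n \<le> r - d / real n \<longleftrightarrow> real n * q + c + d \<le> real n * r"
    "q + c / real n \<le> r + d / real n \<longleftrightarrow> real n * q + c \<le> real n * r + d"
    "q - c / real n \<le> r - d / real n \<longleftrightarrow> real n * q + d \<le> real n * r + c"
    "q + c / real n \<le> t \<longleftrightarrow> real n * q + c \<le> real n * t"
    "t \<le> q - c / real n \<longleftrightarrow> real n * t + c \<le> real n * q"
    by (subst mult_le_cancel_left_pos[OF n, symmetric]; simp only: 1; linarith)+
qed

lemma integrable_mult_bounded:
  fixes v f :: "'a \<Rightarrow> real"
  assumes "integrable M v" "f \<in> borel_measurable M" "\<And>x. x \<in> space M \<Longrightarrow> v x \<noteq> 0 \<Longrightarrow> \<bar>f x\<bar> \<le> B"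
  shows "integrable M (\<lambda>x. v x * f x)"
proof (rule Bochner_Integration.integrable_bound[of M "\<lambda>x. B * v x"])
  show "AE x in M. norm (v x * f x) \<le> norm (B * v x)"
  proof (rule AE_I2)
    fix x assume x: "x \<in> space M"
    show "norm (v x * f x) \<le> norm (B * v x)"
      using assms(3)[OF x] by (cases "v x = 0") (auto simp: abs_mult mult.commute intro!: mult_left_mono order.trans[OF _ abs_ge_self])
  qed
qed (use assms in auto)

section \<open>Weak derivatives in one variable\<close>

text \<open>One-dimensional distributions are represented by a density \<open>v\<close> on some measure space together with a
  coordinate function \<open>Y\<close>, standing for the image of \<open>v dM\<close> under \<open>Y\<close>. This makes slices of functions on the
  plane accessible without disintegrating them.\<close>
lemma weak_deriv_increment:
  fixes v Y :: "'a \<Rightarrow> real" and U :: "real \<Rightarrow> real"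
  assumes v: "integrable M v" and Y: "Y \<in> borel_measurable M" and ab: "a < b"
    and supp: "\<And>x. x \<in> space M \<Longrightarrow> v x \<noteq> 0 \<Longrightarrow> a < Y x \<and> Y x < b"
    and U: "continuous_on {a..b} U"
    and weak: "\<And>\<alpha>. cc_smooth a b \<alpha> \<Longrightarrow> (\<integral>x. v x * \<alpha> (Y x) \<partial>M) = - integral {a..b} (\<lambda>t. U t * deriv \<alpha> t)"
    and p: "p \<in> {a..b}"
  shows "(\<integral>x. v x * indicator {..<p} (Y x) \<partial>M) = U p - U a"
proof (cases "p = a")
  case True
  have "(\<integral>x. v x * indicator {..<p} (Y x) \<partial>M) = (\<integral>x. 0 \<partial>M)"
    by (rule Bochner_Integration.integral_cong) (use supp True in \<open>force simp: indicator_def\<close>)+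
  then show ?thesis using True by simp
next
  case False
  then have p: "a < p" "p \<le> b" using p by auto
  \<comment> \<open>Each transition has radius 1 / n; the shifts by 2 / n and the threshold 4 below
    keep both within [a + 1 / n, p - 1 / n]. The second transition ends left of p, so the limit at Y
    x = p is 0 and the indicator is strict.\<close>
  define c1 where "c1 = (\<lambda>n. a + 2 / real n)"
  define c2 where "c2 = (\<lambda>n. p - 2 / real n)"
  define \<alpha> where "\<alpha> = (\<lambda>n t. sstep (real n * (t - c1 n)) - sstep (real n * (t - c2 n)))"
  define \<beta> where "\<beta> = (\<lambda>n t. real n * mollifier (real n * (t - c1 n)) - real n * mollifier (real n * (t - c2 n)))"
  have d\<alpha>: "deriv (\<alpha> n) t = \<beta> n t" for n t
    unfolding \<alpha>_def \<beta>_def by (rule DERIV_imp_deriv) (intro derivative_intros scaled_deriv sstep_deriv)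
  have lim0: "(\<lambda>n. c / real n) \<longlonglongrightarrow> 0" for c :: real
    using tendsto_mult[OF tendsto_const[of c] lim_1_over_n[where 'a = real]] by simp
  have ev: "eventually (\<lambda>n. 0 < n \<and> 4 < real n * (p - a)) sequentially"
    using p by (intro eventually_inverse_small) auto
  have cc: "eventually (\<lambda>n. cc_smooth a b (\<alpha> n)) sequentially"
    using ev
  proof eventually_elim
    case (elim n)
    then have n: "real n > 0" by simp
    have "\<alpha> n t = 0" if t: "t \<notin> {a + 1 / real n .. p - 1 / real n}" for t
    proof (cases "t < a + 1 / real n")
      case True
      then have "real n * (t - c1 n) \<le> -1" "real n * (t - c2 n) \<le> -1"
        using n elim by (simp_all add: c1_def c2_def scaled_shift right_diff_distrib)
      then show ?thesis by (simp add: \<alpha>_def sstep_left)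
    next
      case False
      then have "t > p - 1 / real n" using t by auto
      then have "real n * (t - c1 n) \<ge> 1" "real n * (t - c2 n) \<ge> 1"
        using n elim by (simp_all add: c1_def c2_def scaled_shift right_diff_distrib)
      then show ?thesis by (simp add: \<alpha>_def sstep_right)
    qed
    moreover have "a < a + 1 / real n" "p - 1 / real n < b" using n p by (auto intro: order.strict_trans2[of _ p])
    ultimately show ?case unfolding cc_smooth_def
      by (intro conjI allI exI[of _ "a + 1 / real n"] exI[of _ "p - 1 / real n"])
        (auto simp: \<alpha>_def intro!: Dk_diff Dk_scaled Dk_sstep)
  qed
  have lim1: "(\<lambda>n. \<integral>x. v x * \<alpha> n (Y x) \<partial>M) \<longlonglongrightarrow> (\<integral>x. v x * indicator {..<p} (Y x) \<partial>M)"
  proof (rule integral_dominated_convergence[where w = "\<lambda>x. \<bar>v x\<bar>"])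
    have m: "\<alpha> n \<in> borel_measurable borel" for n
      unfolding \<alpha>_def by (intro borel_measurable_continuous_onI continuous_intros continuous_on_compose2[OF sstep_cont[of UNIV]]) auto
    show "(\<lambda>x. v x * \<alpha> n (Y x)) \<in> borel_measurable M" for n
      using m[of n] Y v by measurable
    show "(\<lambda>x. v x * indicator {..<p} (Y x)) \<in> borel_measurable M" using Y v by measurable
    show "integrable M (\<lambda>x. \<bar>v x\<bar>)" using v by simp
    show "AE x in M. norm (v x * \<alpha> n (Y x)) \<le> \<bar>v x\<bar>" for n
    proof (rule AE_I2)
      fix x
      have "\<bar>\<alpha> n (Y x)\<bar> \<le> 1" unfolding \<alpha>_def
        using sstep_bounds[of "real n * (Y x - c1 n)"] sstep_bounds[of "real n * (Y x - c2 n)"] by linarith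
      then show "norm (v x * \<alpha> n (Y x)) \<le> \<bar>v x\<bar>" by (simp add: abs_mult mult_left_le)
    qed
    show "AE x in M. (\<lambda>n. v x * \<alpha> n (Y x)) \<longlonglongrightarrow> v x * indicator {..<p} (Y x)"
    proof (rule AE_I2)
      fix x assume x: "x \<in> space M"
      show "(\<lambda>n. v x * \<alpha> n (Y x)) \<longlonglongrightarrow> v x * indicator {..<p} (Y x)"
      proof (cases "v x = 0")
        case False
        then have a: "a < Y x" using supp x by auto
        have "eventually (\<lambda>n. 0 < n \<and> 3 < real n * (Y x - a)) sequentially"
          using a by (intro eventually_inverse_small) auto
        then have 1: "eventually (\<lambda>n. sstep (real n * (Y x - c1 n)) = 1) sequentially"
        proof eventually_elim
          case (elim n)
          then have "real n * (Y x - c1 n) \<ge> 1" by (simp add: c1_def scaled_shift right_diff_distrib)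
          then show ?case by (rule sstep_right)
        qed
        have 2: "eventually (\<lambda>n. sstep (real n * (Y x - c2 n)) = (if Y x < p then 0 else 1)) sequentially"
        proof (cases "Y x < p")
          case True
          then have "eventually (\<lambda>n. 0 < n \<and> 3 < real n * (p - Y x)) sequentially"
            by (intro eventually_inverse_small) auto
          then show ?thesis
          proof eventually_elim
            case (elim n)
            then have "real n * (Y x - c2 n) \<le> -1" by (simp add: c2_def scaled_shift right_diff_distrib)
            then show ?case using True by (simp add: sstep_left)
          qed
        next
          case False
          show ?thesis using eventually_gt_at_top[of 0]
          proof eventually_elim
            case (elim n)
            have "real n * (Y x - p) \<ge> 0" using False by simp
            then have "real n * (Y x - c2 n) \<ge> 1"
              using elim by (simp add: c2_def scaled_shift right_diff_distrib)
            then show ?case using False by (simp add: sstep_right)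
          qed
        qed
        have "eventually (\<lambda>n. v x * \<alpha> n (Y x) = v x * indicator {..<p} (Y x)) sequentially"
          using 1 2 by eventually_elim (auto simp: \<alpha>_def)
        then show ?thesis by (rule tendsto_eventually)
      qed simp
    qed
  qed
  have lim2: "(\<lambda>n. \<integral>x. v x * \<alpha> n (Y x) \<partial>M) \<longlonglongrightarrow> - (U a - U p)"
  proof -
    have 1: "(\<lambda>n. integral {a..b} (\<lambda>t. U t * (real n * mollifier (real n * (t - c1 n))))) \<longlonglongrightarrow> U a"
    proof (rule mollify[OF U])
      show "c1 \<longlonglongrightarrow> a" using tendsto_add[OF tendsto_const[of a] lim0[of 2]] by (simp add: c1_def)
      show "eventually (\<lambda>n. a + 1 / real n \<le> c1 n \<and> c1 n \<le> b - 1 / real n) sequentially"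
        using ev
      proof eventually_elim
        case (elim n)
        then have "real n * p \<le> real n * b" using p by simp
        then have "real n * a + 3 \<le> real n * b" using elim unfolding right_diff_distrib by linarith
        then show ?case using elim divide_right_mono[of 1 2 "real n"]
          by (simp add: c1_def scaled_shift)
      qed
    qed (use ab in auto)
    have 2: "(\<lambda>n. integral {a..b} (\<lambda>t. U t * (real n * mollifier (real n * (t - c2 n))))) \<longlonglongrightarrow> U p"
    proof (rule mollify[OF U])
      show "c2 \<longlonglongrightarrow> p" using tendsto_diff[OF tendsto_const[of p] lim0[of 2]] by (simp add: c2_def)
      show "eventually (\<lambda>n. a + 1 / real n \<le> c2 n \<and> c2 n \<le> b - 1 / real n) sequentially"
        using ev
      proof eventually_elim
        case (elim n)
        then have "real n * p \<le> real n * b" using p by simp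
        then have "real n * a + 3 \<le> real n * p" "real n * p - 1 \<le> real n * b"
          using elim unfolding right_diff_distrib by linarith+
        then show ?case using elim by (simp add: c2_def scaled_shift)
      qed
    qed (use p in auto)
    have i: "(\<lambda>t. U t * (real n * mollifier (real n * (t - q)))) integrable_on {a..b}" for n q
      by (intro integrable_continuous_real continuous_intros U continuous_on_compose2[OF mollifier_props(4)[of UNIV]]) auto
    have "integral {a..b} (\<lambda>t. U t * \<beta> n t) = integral {a..b} (\<lambda>t. U t * (real n * mollifier (real n * (t - c1 n))))
        - integral {a..b} (\<lambda>t. U t * (real n * mollifier (real n * (t - c2 n))))" for n
      unfolding \<beta>_def right_diff_distrib[of "U t" for t]
      by (rule integral_unique) (intro has_integral_diff integrable_integral i)
    then have "(\<lambda>n. - integral {a..b} (\<lambda>t. U t * \<beta> n t)) \<longlonglongrightarrow> - (U a - U p)"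
      using tendsto_minus[OF tendsto_diff[OF 1 2]] by simp
    moreover have "eventually (\<lambda>n. - integral {a..b} (\<lambda>t. U t * \<beta> n t) = (\<integral>x. v x * \<alpha> n (Y x) \<partial>M)) sequentially"
      using cc by eventually_elim (simp add: weak d\<alpha>)
    ultimately show ?thesis by (rule Lim_transform_eventually)
  qed
  show ?thesis using LIMSEQ_unique[OF lim1 lim2] by simp
qed

text \<open>Tested with mollified tent functions: the second difference of \<open>U\<close> equals the integral of \<open>v\<close>
  against a tent, and so does that of \<open>S\<close>.\<close>
lemma weak_second_deriv_affine:
  fixes v Y :: "'a \<Rightarrow> real" and U :: "real \<Rightarrow> real"
  assumes v: "integrable M v" and Y: "Y \<in> borel_measurable M" and ab: "a < b"
    and supp: "\<And>x. x \<in> space M \<Longrightarrow> v x \<noteq> 0 \<Longrightarrow> a < Y x \<and> Y x < b"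
    and U: "continuous_on {a..b} U"
    and weak: "\<And>\<alpha>. cc_smooth a b \<alpha> \<Longrightarrow> (\<integral>x. v x * \<alpha> (Y x) \<partial>M) = integral {a..b} (\<lambda>t. U t * deriv (deriv \<alpha>) t)"
  defines "S \<equiv> \<lambda>s. \<integral>x. v x * max 0 (Y x - s) \<partial>M"
  obtains A B where "\<And>s. s \<in> {a..b} \<Longrightarrow> U s = A + B * s + S s"
proof -
  have lim0: "(\<lambda>n. c / real n) \<longlonglongrightarrow> 0" for c :: real
    using tendsto_mult[OF tendsto_const[of c] lim_1_over_n[where 'a = real]] by simp
  have iS: "integrable M (\<lambda>x. v x * max 0 (Y x - s))" for s
    by (rule integrable_mult_bounded[OF v, of _ "\<bar>a\<bar> + \<bar>b\<bar> + \<bar>s\<bar>"]) (use Y supp in \<open>force simp: max_def\<close>)+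
  \<comment> \<open>That this three-point combination of U - S vanishes for every p in (a, b) says
    that U - S is affine.\<close>
  have key: "(b - p) * (U a - S a) + (a - b) * (U p - S p) + (p - a) * (U b - S b) = 0" if p: "a < p" "p < b" for p
  proof -
    define q1 where "q1 = (\<lambda>n. a + 2 / real n)"
    define q3 where "q3 = (\<lambda>n. b - 2 / real n)"
    define R where "R = (\<lambda>n q t. sramp (real n * (t - q)) / real n)"
    \<comment> \<open>The weights add up to 0, and so do their products with the positions q1 n, p,
      q3 n; hence the combination vanishes to the right of all transitions and is a smoothed
      tent.\<close>
    define \<alpha> where "\<alpha> = (\<lambda>n t. (q3 n - p) * R n (q1 n) t + (q1 n - q3 n) * R n p t + (p - q1 n) * R n (q3 n) t)"
    define K where "K = (\<lambda>n q t. real n * mollifier (real n * (t - q)))"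
    define \<beta> where "\<beta> = (\<lambda>n t. (q3 n - p) * K n (q1 n) t + (q1 n - q3 n) * K n p t + (p - q1 n) * K n (q3 n) t)"
    have q1: "q1 \<longlonglongrightarrow> a" using tendsto_add[OF tendsto_const[of a] lim0[of 2]] by (simp add: q1_def)
    have q3: "q3 \<longlonglongrightarrow> b" using tendsto_diff[OF tendsto_const[of b] lim0[of 2]] by (simp add: q3_def)
    have ev: "eventually (\<lambda>n. 0 < n \<and> 4 < real n * (p - a) \<and> 4 < real n * (b - p)) sequentially"
      using p eventually_inverse_small[of "p - a" 4] eventually_inverse_small[of "b - p" 4]
      by (auto elim: eventually_elim2)
    have dd: "deriv (deriv (\<alpha> n)) t = \<beta> n t" if n: "n > 0" for n t
    proof -
      define T where "T = (\<lambda>q t. sstep (real n * (t - q)))"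
      have 1: "(R n q has_real_derivative T q t) (at t)" for q t
        using DERIV_cdivide[OF scaled_deriv[OF sramp_deriv, of "real n" q t], of "real n"] n by (simp add: R_def T_def)
      have 2: "(T q has_real_derivative K n q t) (at t)" for q t
        using scaled_deriv[OF sstep_deriv, of "real n" q t] by (simp add: T_def K_def)
      have "deriv (\<alpha> n) = (\<lambda>t. (q3 n - p) * T (q1 n) t + (q1 n - q3 n) * T p t + (p - q1 n) * T (q3 n) t)"
        unfolding \<alpha>_def by (rule ext, rule DERIV_imp_deriv) (intro DERIV_add DERIV_cmult 1)
      then show ?thesis unfolding \<beta>_def
        by (simp only:) (rule DERIV_imp_deriv, intro DERIV_add DERIV_cmult 2)
    qed
    have DR: "Dk k (R n q)" for k n q
      using Dk_cmult[OF Dk_scaled[OF Dk_sramp, of k "real n" q], of "1 / real n"] by (simp add: R_def[abs_def])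
    have cc: "eventually (\<lambda>n. cc_smooth a b (\<alpha> n)) sequentially"
      using ev
    proof eventually_elim
      case (elim n)
      then have n: "real n > 0" by simp
      have "\<alpha> n t = 0" if t: "t \<notin> {a + 1 / real n .. b - 1 / real n}" for t
      proof (cases "t < a + 1 / real n")
        case True
        then have "real n * (t - q1 n) \<le> -1" "real n * (t - p) \<le> -1" "real n * (t - q3 n) \<le> -1"
          using n elim by (simp_all add: q1_def q3_def scaled_shift right_diff_distrib)
        then show ?thesis by (simp add: \<alpha>_def R_def sramp_left)
      next
        case False
        then have "t > b - 1 / real n" using t by auto
        then have "real n * (t - q1 n) \<ge> 1" "real n * (t - p) \<ge> 1" "real n * (t - q3 n) \<ge> 1"
          using n elim by (simp_all add: q1_def q3_def scaled_shift right_diff_distrib)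
        then have "R n q t = (t - q) - ramp_offset / real n" if "q \<in> {q1 n, p, q3 n}" for q
          using n that by (auto simp: R_def sramp_right diff_divide_distrib)
        then have "\<alpha> n t = (q3 n - p) * ((t - q1 n) - ramp_offset / real n)
           + (q1 n - q3 n) * ((t - p) - ramp_offset / real n) + (p - q1 n) * ((t - q3 n) - ramp_offset / real n)"
          by (simp add: \<alpha>_def)
        also have "\<dots> = 0" by algebra
        finally show ?thesis .
      qed
      moreover have "a < a + 1 / real n" "b - 1 / real n < b" using n by auto
      ultimately show ?case unfolding cc_smooth_def
        by (intro conjI allI exI[of _ "a + 1 / real n"] exI[of _ "b - 1 / real n"])
          (auto simp: \<alpha>_def intro!: Dk_add Dk_cmult DR)
    qed
    define L where "L = (\<lambda>t. (b - p) * max 0 (t - a) + (a - b) * max 0 (t - p) + (p - a) * max 0 (t - b))"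
    have Rn: "\<bar>R n q t - max 0 (t - q)\<bar> \<le> 2 / real n" if n: "n > 0" for n q t
    proof -
      have "max 0 (real n * (t - q)) = real n * max 0 (t - q)" using n by (simp add: max_def mult_le_0_iff zero_le_mult_iff)
      then have "R n q t - max 0 (t - q) = (sramp (real n * (t - q)) - max 0 (real n * (t - q))) / real n"
        using n by (simp add: R_def field_simps)
      then show ?thesis using sramp_near[of "real n * (t - q)"] n by (simp add: divide_right_mono)
    qed
    have Rlim: "(\<lambda>n. R n (q n) t) \<longlonglongrightarrow> max 0 (t - c)" if "q \<longlonglongrightarrow> c" for q c t
    proof -
      have "(\<lambda>n. R n (q n) t - max 0 (t - q n)) \<longlonglongrightarrow> 0"
        by (rule Lim_null_comparison[OF _ lim0[of 2]])
          (use eventually_gt_at_top[of 0] in \<open>eventually_elim, simp add: Rn\<close>)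
      moreover have "(\<lambda>n. max 0 (t - q n)) \<longlonglongrightarrow> max 0 (t - c)" by (intro tendsto_intros that)
      ultimately have "(\<lambda>n. R n (q n) t - max 0 (t - q n) + max 0 (t - q n)) \<longlonglongrightarrow> 0 + max 0 (t - c)" by (rule tendsto_add)
      then show ?thesis by simp
    qed
    have \<alpha>lim: "(\<lambda>n. \<alpha> n t) \<longlonglongrightarrow> L t" for t
      unfolding \<alpha>_def L_def by (intro tendsto_intros Rlim q1 q3)
    \<comment> \<open>Dominated convergence asks for a bound at every index, but the bound holds
      from n0 on; the sequence is shifted accordingly.\<close>
    define n0 where "n0 = (SOME n0. \<forall>n\<ge>n0. 0 < n \<and> 4 < real n * (p - a) \<and> 4 < real n * (b - p))"
    have n0: "0 < n" "4 < real n * (p - a)" "4 < real n * (b - p)" if "n \<ge> n0" for n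
      using someI_ex[OF ev[unfolded eventually_sequentially]] that unfolding n0_def by blast+
    have bound: "\<bar>\<alpha> n t\<bar> \<le> 3 * ((b - a) * ((b - a) + (b - a)))" if n: "n \<ge> n0" and t: "a < t" "t < b" for n t
    proof -
      have q: "q1 n > a" "q1 n < p" "q3 n > p" "q3 n < b" and d: "2 / real n \<le> b - a"
        using n0[OF n] ab by (simp_all add: q1_def q3_def scaled_shift right_diff_distrib field_simps)
      have R: "\<bar>R n q t\<bar> \<le> (b - a) + (b - a)" if "q > a" for q
        using Rn[OF n0(1)[OF n], of q t] t that d by (auto simp: max_def split: if_splits)
      have "\<bar>(q3 n - p) * R n (q1 n) t\<bar> \<le> (b - a) * ((b - a) + (b - a))"
        "\<bar>(q1 n - q3 n) * R n p t\<bar> \<le> (b - a) * ((b - a) + (b - a))"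
        "\<bar>(p - q1 n) * R n (q3 n) t\<bar> \<le> (b - a) * ((b - a) + (b - a))"
        unfolding abs_mult using q p R[of "q1 n"] R[of p] R[of "q3 n"] by (auto intro!: mult_mono)
      then show ?thesis unfolding \<alpha>_def by linarith
    qed
    have lim1: "(\<lambda>n. \<integral>x. v x * \<alpha> (n + n0) (Y x) \<partial>M) \<longlonglongrightarrow> (\<integral>x. v x * L (Y x) \<partial>M)"
    proof (rule integral_dominated_convergence[where w = "\<lambda>x. 3 * ((b - a) * ((b - a) + (b - a))) * \<bar>v x\<bar>"])
      have m: "\<alpha> n \<in> borel_measurable borel" for n
      proof -
        have "Dk 0 (\<alpha> n)" unfolding \<alpha>_def by (intro Dk_add Dk_cmult DR)
        then show ?thesis by (simp add: borel_measurable_continuous_onI)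
      qed
      show "(\<lambda>x. v x * \<alpha> (n + n0) (Y x)) \<in> borel_measurable M" for n
        using m[of "n + n0"] Y v by measurable
      show "(\<lambda>x. v x * L (Y x)) \<in> borel_measurable M" unfolding L_def using Y v by measurable
      show "integrable M (\<lambda>x. 3 * ((b - a) * ((b - a) + (b - a))) * \<bar>v x\<bar>)" using v by simp
      show "AE x in M. norm (v x * \<alpha> (n + n0) (Y x)) \<le> 3 * ((b - a) * ((b - a) + (b - a))) * \<bar>v x\<bar>" for n
      proof (rule AE_I2)
        fix x assume x: "x \<in> space M"
        show "norm (v x * \<alpha> (n + n0) (Y x)) \<le> 3 * ((b - a) * ((b - a) + (b - a))) * \<bar>v x\<bar>"
        proof (cases "v x = 0")
          case False
          have "\<bar>v x\<bar> * \<bar>\<alpha> (n + n0) (Y x)\<bar> \<le> \<bar>v x\<bar> * (3 * ((b - a) * ((b - a) + (b - a))))"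
            using bound[of "n + n0" "Y x"] supp[OF x False] by (intro mult_left_mono) auto
          then show ?thesis by (simp add: abs_mult mult.commute)
        qed simp
      qed
      show "AE x in M. (\<lambda>n. v x * \<alpha> (n + n0) (Y x)) \<longlonglongrightarrow> v x * L (Y x)"
        by (intro AE_I2 tendsto_intros LIMSEQ_ignore_initial_segment \<alpha>lim)
    qed
    have L: "(\<integral>x. v x * L (Y x) \<partial>M) = (b - p) * S a + (a - b) * S p + (p - a) * S b"
    proof -
      have "(\<integral>x. v x * L (Y x) \<partial>M) = (\<integral>x. (b - p) * (v x * max 0 (Y x - a)) + (a - b) * (v x * max 0 (Y x - p))
          + (p - a) * (v x * max 0 (Y x - b)) \<partial>M)"
        by (simp add: L_def algebra_simps)
      then show ?thesis unfolding S_def using iS by simp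
    qed
    have lim2: "(\<lambda>n. \<integral>x. v x * \<alpha> (n + n0) (Y x) \<partial>M) \<longlonglongrightarrow> (b - p) * U a + (a - b) * U p + (p - a) * U b"
    proof -
      have i: "(\<lambda>t. U t * K n q t) integrable_on {a..b}" for n q unfolding K_def
        by (intro integrable_continuous_real continuous_intros U continuous_on_compose2[OF mollifier_props(4)[of UNIV]]) auto
      have e: "integral {a..b} (\<lambda>t. U t * \<beta> n t) = (q3 n - p) * integral {a..b} (\<lambda>t. U t * K n (q1 n) t)
          + (q1 n - q3 n) * integral {a..b} (\<lambda>t. U t * K n p t) + (p - q1 n) * integral {a..b} (\<lambda>t. U t * K n (q3 n) t)" for n
      proof -
        have "integral {a..b} (\<lambda>t. U t * \<beta> n t) = integral {a..b} (\<lambda>t. (q3 n - p) * (U t * K n (q1 n) t)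
          + (q1 n - q3 n) * (U t * K n p t) + (p - q1 n) * (U t * K n (q3 n) t))"
          by (simp add: \<beta>_def algebra_simps)
        also have "\<dots> = (q3 n - p) * integral {a..b} (\<lambda>t. U t * K n (q1 n) t)
          + (q1 n - q3 n) * integral {a..b} (\<lambda>t. U t * K n p t) + (p - q1 n) * integral {a..b} (\<lambda>t. U t * K n (q3 n) t)"
          by (rule integral_unique) (intro has_integral_add has_integral_mult_right integrable_integral i)
        finally show ?thesis .
      qed
      have ins: "eventually (\<lambda>n. (a + 1 / real n \<le> q1 n \<and> q1 n \<le> b - 1 / real n)
          \<and> (a + 1 / real n \<le> p \<and> p \<le> b - 1 / real n) \<and> (a + 1 / real n \<le> q3 n \<and> q3 n \<le> b - 1 / real n)) sequentially"
        using ev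
      proof eventually_elim
        case (elim n)
        then have n: "n > 0" and "real n * a + 4 < real n * p" "real n * p + 4 < real n * b"
          unfolding right_diff_distrib by linarith+
        then have "real n * a + 3 \<le> real n * b" "real n * a + 1 \<le> real n * p" "real n * p + 1 \<le> real n * b" by linarith+
        moreover have "1 / real n \<le> 2 / real n" using n by (intro divide_right_mono) auto
        ultimately show ?case
          unfolding q1_def q3_def using scaled_shift(7)[OF n, of a 2 b 1] scaled_shift(7)[OF n, of a 1 b 2]
            scaled_shift(10)[OF n, of a 1 p] scaled_shift(11)[OF n, of p b 1]
          by (auto simp only: add_le_cancel_left diff_left_mono simp_thms)
      qed
      have 1: "(\<lambda>n. integral {a..b} (\<lambda>t. U t * K n (q1 n) t)) \<longlonglongrightarrow> U a"
        unfolding K_def by (rule mollify[OF U q1 _ eventually_mono[OF ins]]) (use ab in auto)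
      have 2: "(\<lambda>n. integral {a..b} (\<lambda>t. U t * K n p t)) \<longlonglongrightarrow> U p"
        unfolding K_def by (rule mollify[OF U tendsto_const _ eventually_mono[OF ins]]) (use p in auto)
      have 3: "(\<lambda>n. integral {a..b} (\<lambda>t. U t * K n (q3 n) t)) \<longlonglongrightarrow> U b"
        unfolding K_def by (rule mollify[OF U q3 _ eventually_mono[OF ins]]) (use ab in auto)
      have "(\<lambda>n. integral {a..b} (\<lambda>t. U t * \<beta> n t)) \<longlonglongrightarrow> (b - p) * U a + (a - b) * U p + (p - a) * U b"
        unfolding e by (intro tendsto_intros 1 2 3 q1 q3)
      moreover have "eventually (\<lambda>n. integral {a..b} (\<lambda>t. U t * \<beta> n t) = (\<integral>x. v x * \<alpha> n (Y x) \<partial>M)) sequentially"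
        using cc ev by eventually_elim (simp add: weak dd)
      ultimately have "(\<lambda>n. \<integral>x. v x * \<alpha> n (Y x) \<partial>M) \<longlonglongrightarrow> (b - p) * U a + (a - b) * U p + (p - a) * U b"
        by (rule Lim_transform_eventually)
      then show ?thesis by (rule LIMSEQ_ignore_initial_segment)
    qed
    have "(b - p) * S a + (a - b) * S p + (p - a) * S b = (b - p) * U a + (a - b) * U p + (p - a) * U b"
      using LIMSEQ_unique[OF lim1 lim2] unfolding L .
    then show ?thesis by (simp add: algebra_simps)
  qed
  define Z where "Z = (\<lambda>s. U s - S s)"
  define B where "B = (Z b - Z a) / (b - a)"
  have "Z s = (Z a - B * a) + B * s" if s: "s \<in> {a..b}" for s
  proof -
    have "(b - s) * Z a + (a - b) * Z s + (s - a) * Z b = 0"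
      using key[of s] s by (cases "s = a \<or> s = b") (auto simp: Z_def algebra_simps)
    moreover have "B * (b - a) = Z b - Z a" using ab by (simp add: B_def)
    ultimately have "(b - a) * Z s = (b - a) * ((Z a - B * a) + B * s)" by algebra
    then show ?thesis using ab by simp
  qed
  then show ?thesis using that[of "Z a - B * a" B] by (simp add: Z_def algebra_simps)
qed

section \<open>Integration by parts with multipliers that are not compactly supported\<close>

lemma fubini_kernel:
  fixes v Y :: "'a \<Rightarrow> real" and \<theta> :: "real \<Rightarrow> real" and K :: "real \<Rightarrow> real \<Rightarrow> real"
  assumes M: "sigma_finite_measure M"
    and v: "integrable M v" and Y: "Y \<in> borel_measurable M" 
    and supp: "\<And>x. x \<in> space M \<Longrightarrow> v x \<noteq> 0 \<Longrightarrow> a < Y x \<and> Y x < b"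
    and \<theta>: "\<theta> \<in> borel_measurable borel" "\<And>s. s \<in> {a..b} \<Longrightarrow> \<bar>\<theta> s\<bar> \<le> C"
    and K: "(\<lambda>(t, s). K t s) \<in> borel_measurable (borel \<Otimes>\<^sub>M borel)"
      "\<And>t s. t \<in> {a..b} \<Longrightarrow> s \<in> {a..b} \<Longrightarrow> \<bar>K t s\<bar> \<le> D"
  shows "(\<integral>x. v x * (LINT s:{a..b}|lborel. K (Y x) s * \<theta> s) \<partial>M)
    = (LINT s:{a..b}|lborel. \<theta> s * (\<integral>x. v x * K (Y x) s \<partial>M))"
proof -
  interpret pair_sigma_finite M lborel
    using M sigma_finite_lborel by (simp add: pair_sigma_finite_def)
  define f where "f = (\<lambda>x s. v x * (indicator {a..b} s * (K (Y x) s * \<theta> s)))"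
  define w where "w = (\<lambda>(x, s). \<bar>v x\<bar> * (\<bar>C\<bar> * \<bar>D\<bar> * indicator {a..b} s :: real))"
  have fm: "case_prod f \<in> borel_measurable (M \<Otimes>\<^sub>M lborel)"
  proof -
    have "(\<lambda>p. (Y (fst p), snd p)) \<in> (M \<Otimes>\<^sub>M lborel) \<rightarrow>\<^sub>M (borel \<Otimes>\<^sub>M borel)"
      using Y by measurable
    from measurable_compose[OF this K(1)]
    have [measurable]: "(\<lambda>p. K (Y (fst p)) (snd p)) \<in> borel_measurable (M \<Otimes>\<^sub>M lborel)" by simp
    have [measurable]: "v \<in> borel_measurable M" "\<theta> \<in> borel_measurable borel" using v \<theta> by auto
    show ?thesis unfolding f_def case_prod_beta by measurable
  qed
  have ind: "integrable lborel (\<lambda>s. c * indicator {a..b} s :: real)" for c :: real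
    by (intro integrable_mult_right) (auto simp: lmeasurable_iff_integrable[symmetric] intro!: integrable_real_indicator simp: emeasure_lborel_Icc_eq)
  have wi: "integrable (M \<Otimes>\<^sub>M lborel) w"
  proof (rule Fubini_integrable)
    have [measurable]: "v \<in> borel_measurable M" using v by auto
    show "w \<in> borel_measurable (M \<Otimes>\<^sub>M lborel)" unfolding w_def by measurable
    have "(\<lambda>x. \<integral>s. norm (w (x, s)) \<partial>lborel) = (\<lambda>x. \<bar>v x\<bar> * (\<integral>s. \<bar>C\<bar> * \<bar>D\<bar> * indicator {a..b} s \<partial>lborel))"
      by (simp add: w_def abs_mult)
    then show "integrable M (\<lambda>x. \<integral>s. norm (w (x, s)) \<partial>lborel)" using v by simp
    show "AE x in M. integrable lborel (\<lambda>s. w (x, s))"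
      using ind[of "\<bar>v x\<bar> * (\<bar>C\<bar> * \<bar>D\<bar>)" for x] by (simp add: w_def mult.assoc)
  qed
  have "integrable (M \<Otimes>\<^sub>M lborel) (case_prod f)"
  proof (rule Bochner_Integration.integrable_bound[OF wi fm], rule AE_I2)
    fix p :: "'a \<times> real" assume "p \<in> space (M \<Otimes>\<^sub>M lborel)"
    then obtain x s where p: "p = (x, s)" "x \<in> space M" by (auto simp: space_pair_measure)
    show "norm (case_prod f p) \<le> norm (w p)"
    proof (cases "v x = 0 \<or> s \<notin> {a..b}")
      case True
      then show ?thesis by (auto simp: p f_def w_def)
    next
      case False
      then have "Y x \<in> {a..b}" "s \<in> {a..b}" using supp[OF p(2)] by auto
      then have "\<bar>K (Y x) s\<bar> * \<bar>\<theta> s\<bar> \<le> \<bar>D\<bar> * \<bar>C\<bar>" using \<theta>(2)[of s] K(2)[of "Y x" s] by (intro mult_mono) auto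
      then show ?thesis using False by (auto simp: p f_def w_def abs_mult mult_ac intro!: mult_left_mono)
    qed
  qed
  from Fubini_integral[OF this]
  have "(\<integral>x. \<integral>s. f x s \<partial>lborel \<partial>M) = (\<integral>s. \<integral>x. f x s \<partial>M \<partial>lborel)" by simp
  moreover have "(\<integral>s. f x s \<partial>lborel) = v x * (LINT s:{a..b}|lborel. K (Y x) s * \<theta> s)" for x
    by (simp add: f_def set_lebesgue_integral_def)
  moreover have "(\<integral>x. f x s \<partial>M) = indicator {a..b} s * (\<theta> s * (\<integral>x. v x * K (Y x) s \<partial>M))" for s
  proof -
    have "f x s = (indicator {a..b} s * \<theta> s) * (v x * K (Y x) s)" for x by (simp add: f_def mult_ac)
    then show ?thesis by (simp add: mult.assoc)
  qed
  ultimately show ?thesis by (simp add: set_lebesgue_integral_def)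
qed

lemma bounded_measurable_set_integrable:
  fixes f :: "real \<Rightarrow> real"
  assumes "f \<in> borel_measurable borel" "\<And>s. s \<in> {a..b} \<Longrightarrow> \<bar>f s\<bar> \<le> C"
  shows "set_integrable lborel {a..b} f"
proof -
  have "integrable lborel (\<lambda>s. \<bar>C\<bar> * indicator {a..b} s :: real)"
    by (intro integrable_mult_right integrable_real_indicator) (auto simp: emeasure_lborel_Icc_eq)
  then show ?thesis unfolding set_integrable_def
    by (rule Bochner_Integration.integrable_bound) (use assms in \<open>auto simp: indicator_def intro: order.trans[OF _ abs_ge_self]\<close>)
qed

text \<open>The value k (Y x) is k b minus the integral of \<theta> over s > Y x. Fubini turns this
  into an integral of the increments U s - U a supplied by \<open>weak_deriv_increment\<close>. A
  merely bounded measurable \<theta> covers multipliers whose derivative jumps at w.\<close>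

lemma weak_deriv_by_parts:
  fixes v Y :: "'a \<Rightarrow> real" and U \<theta> k :: "real \<Rightarrow> real"
  assumes M: "sigma_finite_measure M"
    and v: "integrable M v" and Y: "Y \<in> borel_measurable M" and ab: "a < b"
    and supp: "\<And>x. x \<in> space M \<Longrightarrow> v x \<noteq> 0 \<Longrightarrow> a < Y x \<and> Y x < b"
    and U: "continuous_on {a..b} U"
    and weak: "\<And>\<alpha>. cc_smooth a b \<alpha> \<Longrightarrow> (\<integral>x. v x * \<alpha> (Y x) \<partial>M) = - integral {a..b} (\<lambda>t. U t * deriv \<alpha> t)"
    and \<theta>: "\<theta> \<in> borel_measurable borel" "\<And>s. s \<in> {a..b} \<Longrightarrow> \<bar>\<theta> s\<bar> \<le> C"
    and k: "\<And>t. t \<in> {a..b} \<Longrightarrow> (\<theta> has_integral (k b - k t)) {t..b}"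
  shows "(\<integral>x. v x * k (Y x) \<partial>M) = k b * U b - k a * U a - integral {a..b} (\<lambda>s. \<theta> s * U s)"
proof -
  define I where "I = (\<lambda>p. \<integral>x. v x * indicator {..<p} (Y x) \<partial>M)"
  have I: "I p = U p - U a" if "p \<in> {a..b}" for p
    unfolding I_def by (rule weak_deriv_increment[OF v Y ab supp U weak that])
  define K where "K = (\<lambda>t s::real. indicator {..<s} t :: real)"
  have tail: "(LINT s:{a..b}|lborel. K t s * \<theta> s) = k b - k t" if t: "t \<in> {a..b}" for t
  proof -
    have si: "set_integrable lborel {t..b} \<theta>"
      by (rule bounded_measurable_set_integrable[OF \<theta>(1), of _ _ C]) (use \<theta>(2) t in auto)
    have "(LINT s:{a..b}|lborel. K t s * \<theta> s) = (LINT s:{t..b}|lborel. \<theta> s)"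
      unfolding set_lebesgue_integral_def
    proof (rule integral_cong_AE)
      show "AE s in lborel. indicator {a..b} s *\<^sub>R (K t s * \<theta> s) = indicator {t..b} s *\<^sub>R \<theta> s"
        using AE_lborel_singleton[of t] by eventually_elim (use t in \<open>auto simp: K_def indicator_def\<close>)
    qed (use \<theta>(1) in \<open>auto simp: K_def indicator_def[abs_def]\<close>)
    also have "\<dots> = integral {t..b} \<theta>" using set_borel_integral_eq_integral(2)[OF si] .
    finally show ?thesis using k[OF t] by (simp add: integral_unique)
  qed
  have sU: "set_integrable lborel {a..b} U"
    using U unfolding set_integrable_def by (intro borel_integrable_compact) auto
  have s\<theta>: "set_integrable lborel {a..b} \<theta>" by (rule bounded_measurable_set_integrable[OF \<theta>])
  have s\<theta>U: "set_integrable lborel {a..b} (\<lambda>s. \<theta> s * U s)"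
  proof -
    have "integrable lborel (\<lambda>s. (indicator {a..b} s *\<^sub>R U s) * \<theta> s)"
      by (rule integrable_mult_bounded[OF sU[unfolded set_integrable_def]])
         (use \<theta> in \<open>auto simp: indicator_def split: if_splits\<close>)
    then show ?thesis by (simp add: set_integrable_def mult_ac)
  qed
  have Iv: "(\<integral>x. v x \<partial>M) = U b - U a"
  proof -
    have "(\<integral>x. v x \<partial>M) = I b" unfolding I_def
      by (rule Bochner_Integration.integral_cong) (use supp in \<open>force simp: indicator_def\<close>)+
    then show ?thesis using I ab by simp
  qed
  have "(\<integral>x. v x * k (Y x) \<partial>M) = (\<integral>x. k b * v x - v x * (LINT s:{a..b}|lborel. K (Y x) s * \<theta> s) \<partial>M)"
  proof (rule Bochner_Integration.integral_cong[OF refl])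
    fix x assume x: "x \<in> space M"
    show "v x * k (Y x) = k b * v x - v x * (LINT s:{a..b}|lborel. K (Y x) s * \<theta> s)"
    proof (cases "v x = 0")
      case False
      then have "Y x \<in> {a..b}" using supp[OF x] by auto
      then show ?thesis unfolding tail[OF \<open>Y x \<in> {a..b}\<close>] by (simp add: algebra_simps)
    qed simp
  qed
  also have "\<dots> = k b * (\<integral>x. v x \<partial>M) - (\<integral>x. v x * (LINT s:{a..b}|lborel. K (Y x) s * \<theta> s) \<partial>M)"
  proof -
    have "integrable M (\<lambda>x. v x * (LINT s:{a..b}|lborel. K (Y x) s * \<theta> s))"
    proof (rule integrable_mult_bounded[OF v])
      have Kc: "(LINT s:{a..b}|lborel. K t s * \<theta> s) = (\<integral>s. (if t < s then 1 else 0) * (indicator {a..b} s * \<theta> s) \<partial>lborel)" for t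
        unfolding set_lebesgue_integral_def
        by (rule Bochner_Integration.integral_cong[OF refl]) (simp add: K_def indicator_def)
      have [measurable]: "\<theta> \<in> borel_measurable borel" by (rule \<theta>)
      have "(\<lambda>t. \<integral>s. (if t < s then 1 else 0) * (indicator {a..b} s * \<theta> s) \<partial>lborel) \<in> borel_measurable borel"
        by measurable
      then show "(\<lambda>x. LINT s:{a..b}|lborel. K (Y x) s * \<theta> s) \<in> borel_measurable M"
        unfolding Kc using Y by measurable
      fix x assume "x \<in> space M" "v x \<noteq> 0"
      then have t: "Y x \<in> {a..b}" using supp by force
      have "\<bar>k b - k (Y x)\<bar> = norm (integral {Y x..b} \<theta>)"
        unfolding integral_unique[OF k[OF t]] by simp
      also have "\<dots> \<le> integral {Y x..b} (\<lambda>_. \<bar>C\<bar>)"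
      proof (rule integral_norm_bound_integral)
        show "\<theta> integrable_on {Y x..b}" using k[OF t] by blast
        show "norm (\<theta> s) \<le> \<bar>C\<bar>" if "s \<in> {Y x..b}" for s
          using \<theta>(2)[of s] that t by auto
      qed auto
      also have "\<dots> \<le> (b - a) * \<bar>C\<bar>" using t by (auto intro!: mult_right_mono)
      finally show "\<bar>LINT s:{a..b}|lborel. K (Y x) s * \<theta> s\<bar> \<le> (b - a) * \<bar>C\<bar>" by (simp add: tail[OF t])
    qed
    then show ?thesis using v by simp
  qed
  also have "(\<integral>x. v x * (LINT s:{a..b}|lborel. K (Y x) s * \<theta> s) \<partial>M) = (LINT s:{a..b}|lborel. \<theta> s * I s)"
    unfolding I_def K_def
    by (rule fubini_kernel[OF M v Y supp \<theta>, where D = 1]) (auto simp: indicator_def)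
  also have "\<dots> = (LINT s:{a..b}|lborel. \<theta> s * U s - U a * \<theta> s)"
    by (rule set_lebesgue_integral_cong) (auto simp: I algebra_simps)
  also have "\<dots> = (LINT s:{a..b}|lborel. \<theta> s * U s) - U a * (LINT s:{a..b}|lborel. \<theta> s)"
    using s\<theta>U s\<theta> by simp
  also have "(LINT s:{a..b}|lborel. \<theta> s) = k b - k a"
    using set_borel_integral_eq_integral(2)[OF s\<theta>] k[of a] ab by (simp add: integral_unique)
  also have "(LINT s:{a..b}|lborel. \<theta> s * U s) = integral {a..b} (\<lambda>s. \<theta> s * U s)"
    using set_borel_integral_eq_integral(2)[OF s\<theta>U] .
  finally show ?thesis unfolding Iv by (simp add: algebra_simps)
qed

text \<open>The hypotheses describe a function with h a = h b = 0, slopes c and d at the ends, and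
  h'' equal to \<theta> plus J times the point mass at y0. As h vanishes at the ends, no boundary
  value of a derivative of U occurs. Taylor's formula and Fubini express the left side through the
  potential S, which equals U up to an affine function.\<close>

lemma weak_second_deriv_by_parts:
  fixes v Y :: "'a \<Rightarrow> real" and U \<theta> h :: "real \<Rightarrow> real"
  assumes M: "sigma_finite_measure M"
    and v: "integrable M v" and Y: "Y \<in> borel_measurable M" and ab: "a < b"
    and supp: "\<And>x. x \<in> space M \<Longrightarrow> v x \<noteq> 0 \<Longrightarrow> a < Y x \<and> Y x < b"
    and U: "continuous_on {a..b} U"
    and weak: "\<And>\<alpha>. cc_smooth a b \<alpha> \<Longrightarrow> (\<integral>x. v x * \<alpha> (Y x) \<partial>M) = integral {a..b} (\<lambda>t. U t * deriv (deriv \<alpha>) t)"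
    and \<theta>: "\<theta> \<in> borel_measurable borel" "\<And>s. s \<in> {a..b} \<Longrightarrow> \<bar>\<theta> s\<bar> \<le> C"
    and h: "\<And>t. t \<in> {a..b} \<Longrightarrow> ((\<lambda>s. max 0 (t - s) * \<theta> s) has_integral (h t - c * (t - a) - J * max 0 (t - y0))) {a..b}"
    and hb: "h b = 0" and y0: "y0 \<in> {a..b}"
    and d: "(\<theta> has_integral (d - c - J)) {a..b}"
  shows "(\<integral>x. v x * h (Y x) \<partial>M) = c * U a - d * U b + J * U y0 + integral {a..b} (\<lambda>s. \<theta> s * U s)"
proof -
  define S where "S = (\<lambda>s. \<integral>x. v x * max 0 (Y x - s) \<partial>M)"
  obtain A B where AB: "\<And>s. s \<in> {a..b} \<Longrightarrow> U s = A + B * s + S s"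
    using weak_second_deriv_affine[OF v Y ab supp U weak] unfolding S_def by blast
  define K where "K = (\<lambda>t s::real. max 0 (t - s))"
  have sU: "set_integrable lborel {a..b} U"
    using U unfolding set_integrable_def by (intro borel_integrable_compact) auto
  have s\<theta>: "set_integrable lborel {a..b} \<theta>" by (rule bounded_measurable_set_integrable[OF \<theta>])
  have s\<theta>f: "set_integrable lborel {a..b} (\<lambda>s. \<theta> s * f s)" if f: "continuous_on {a..b} f" for f
  proof -
    have "integrable lborel (\<lambda>s. (indicator {a..b} s *\<^sub>R f s) * \<theta> s)"
    proof (rule integrable_mult_bounded)
      show "integrable lborel (\<lambda>s. indicator {a..b} s *\<^sub>R f s)"
        using f by (intro borel_integrable_compact) auto
    qed (use \<theta> in \<open>auto simp: indicator_def split: if_splits\<close>)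
    then show ?thesis by (simp add: set_integrable_def mult_ac)
  qed
  have s\<theta>K: "set_integrable lborel {a..b} (\<lambda>s. K t s * \<theta> s)" for t
    using s\<theta>f[of "K t"] by (simp add: K_def mult.commute continuous_intros)
  have tail: "(LINT s:{a..b}|lborel. K t s * \<theta> s) = h t - c * (t - a) - J * max 0 (t - y0)" if t: "t \<in> {a..b}" for t
    using set_borel_integral_eq_integral(2)[OF s\<theta>K] h[OF t] by (simp add: K_def integral_unique)
  have iS: "integrable M (\<lambda>x. v x * max 0 (Y x - s))" for s
    by (rule integrable_mult_bounded[OF v, of _ "\<bar>a\<bar> + \<bar>b\<bar> + \<bar>s\<bar>"]) (use Y supp in \<open>force simp: max_def\<close>)+
  have Sa: "(\<integral>x. v x * (Y x - a) \<partial>M) = S a" and Sai: "integrable M (\<lambda>x. v x * (Y x - a))"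
  proof -
    have e: "v x * max 0 (Y x - a) = v x * (Y x - a)" if "x \<in> space M" for x
      using supp[OF that] by (cases "v x = 0") auto
    show "(\<integral>x. v x * (Y x - a) \<partial>M) = S a"
      unfolding S_def by (rule Bochner_Integration.integral_cong) (auto simp: e)
    show "integrable M (\<lambda>x. v x * (Y x - a))"
      using iS[of a] e by (simp cong: Bochner_Integration.integrable_cong)
  qed
  have Sb: "S b = 0"
  proof -
    have "S b = (\<integral>x. 0 \<partial>M)" unfolding S_def
      by (rule Bochner_Integration.integral_cong) (use supp in \<open>force simp: max_def\<close>)+
    then show ?thesis by simp
  qed
  have KY: "(\<integral>x. v x * (LINT s:{a..b}|lborel. K (Y x) s * \<theta> s) \<partial>M) = (LINT s:{a..b}|lborel. \<theta> s * S s)"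
    unfolding S_def K_def
    by (rule fubini_kernel[OF M v Y supp \<theta>, where D = "b - a"]) (auto simp: max_def)
  have iK: "integrable M (\<lambda>x. v x * (LINT s:{a..b}|lborel. K (Y x) s * \<theta> s))"
  proof (rule integrable_mult_bounded[OF v])
    have Kc: "(LINT s:{a..b}|lborel. K t s * \<theta> s) = (\<integral>s. max 0 (t - s) * (indicator {a..b} s * \<theta> s) \<partial>lborel)" for t
      by (simp add: set_lebesgue_integral_def K_def mult_ac)
    have [measurable]: "\<theta> \<in> borel_measurable borel" by (rule \<theta>)
    have "(\<lambda>t. \<integral>s. max 0 (t - s) * (indicator {a..b} s * \<theta> s) \<partial>lborel) \<in> borel_measurable borel"
      by measurable
    then show "(\<lambda>x. LINT s:{a..b}|lborel. K (Y x) s * \<theta> s) \<in> borel_measurable M"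
      unfolding Kc using Y by measurable
    fix x assume "x \<in> space M" "v x \<noteq> 0"
    then have t: "Y x \<in> {a..b}" using supp by force
    have "(LINT s:{a..b}|lborel. K (Y x) s * \<theta> s) = integral {a..b} (\<lambda>s. K (Y x) s * \<theta> s)"
      using set_borel_integral_eq_integral(2)[OF s\<theta>K] .
    also have "norm \<dots> \<le> integral {a..b} (\<lambda>_. (b - a) * \<bar>C\<bar>)"
    proof (rule integral_norm_bound_integral)
      show "(\<lambda>s. K (Y x) s * \<theta> s) integrable_on {a..b}"
        using set_borel_integral_eq_integral(1)[OF s\<theta>K] .
      show "norm (K (Y x) s * \<theta> s) \<le> (b - a) * \<bar>C\<bar>" if "s \<in> {a..b}" for s
        unfolding norm_mult using \<theta>(2)[OF that] t that by (intro mult_mono) (auto simp: K_def)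
    qed auto
    finally show "\<bar>LINT s:{a..b}|lborel. K (Y x) s * \<theta> s\<bar> \<le> integral {a..b} (\<lambda>_. (b - a) * \<bar>C\<bar>)" by simp
  qed
  have "(\<integral>x. v x * h (Y x) \<partial>M) = (\<integral>x. v x * (LINT s:{a..b}|lborel. K (Y x) s * \<theta> s) + c * (v x * (Y x - a)) + J * (v x * max 0 (Y x - y0)) \<partial>M)"
  proof (rule Bochner_Integration.integral_cong[OF refl])
    fix x assume x: "x \<in> space M"
    show "v x * h (Y x) = v x * (LINT s:{a..b}|lborel. K (Y x) s * \<theta> s) + c * (v x * (Y x - a)) + J * (v x * max 0 (Y x - y0))"
    proof (cases "v x = 0")
      case False
      then have "Y x \<in> {a..b}" using supp[OF x] by auto
      then show ?thesis unfolding tail[OF \<open>Y x \<in> {a..b}\<close>] by (simp add: algebra_simps)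
    qed simp
  qed
  also have "\<dots> = (LINT s:{a..b}|lborel. \<theta> s * S s) + c * S a + J * S y0"
    using iK Sai iS[of y0] by (simp add: KY Sa S_def)
  also have "(LINT s:{a..b}|lborel. \<theta> s * S s) = (LINT s:{a..b}|lborel. \<theta> s * U s - A * (\<theta> s * 1) - B * (\<theta> s * s))"
    by (rule set_lebesgue_integral_cong) (auto simp: AB algebra_simps)
  also have "\<dots> = (LINT s:{a..b}|lborel. \<theta> s * U s) - A * (LINT s:{a..b}|lborel. \<theta> s * 1) - B * (LINT s:{a..b}|lborel. \<theta> s * s)"
    using s\<theta>f[OF U] s\<theta>f[of "\<lambda>_. 1"] s\<theta>f[of "\<lambda>s. s"]
    by (simp add: continuous_intros del: mult_1_right)
  also have "\<dots> = integral {a..b} (\<lambda>s. \<theta> s * U s) - A * integral {a..b} \<theta> - B * integral {a..b} (\<lambda>s. \<theta> s * s)"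
    using set_borel_integral_eq_integral(2)[OF s\<theta>f[OF U]] set_borel_integral_eq_integral(2)[OF s\<theta>]
      set_borel_integral_eq_integral(2)[OF s\<theta>f[of "\<lambda>s. s"]] by (simp add: continuous_intros)
  finally have 1: "(\<integral>x. v x * h (Y x) \<partial>M) = integral {a..b} (\<lambda>s. \<theta> s * U s) - A * integral {a..b} \<theta>
      - B * integral {a..b} (\<lambda>s. \<theta> s * s) + c * S a + J * S y0" .
  have t1: "integral {a..b} \<theta> = d - c - J" using d by (rule integral_unique)
  \<comment> \<open>The first moment of \<theta> is read off the Taylor formula at t = b, where max
    0 (b - s) = b - s and h b = 0. With t1 it turns the affine part into the boundary terms of
    U.\<close>
  have t2: "integral {a..b} (\<lambda>s. \<theta> s * s) = b * (d - c - J) + c * (b - a) + J * (b - y0)"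
  proof -
    have "((\<lambda>s. b * \<theta> s - max 0 (b - s) * \<theta> s) has_integral
        (b * (d - c - J) - (h b - c * (b - a) - J * max 0 (b - y0)))) {a..b}"
      using h[of b] d ab by (intro has_integral_diff has_integral_mult_right) auto
    moreover have "b * \<theta> s - max 0 (b - s) * \<theta> s = \<theta> s * s" if "s \<in> {a..b}" for s
      using that by (simp add: algebra_simps)
    ultimately have "((\<lambda>s. \<theta> s * s) has_integral (b * (d - c - J) - (h b - c * (b - a) - J * max 0 (b - y0)))) {a..b}"
      by (rule has_integral_eq[rotated])
    then show ?thesis using hb y0 by (simp add: integral_unique)
  qed
  have U': "U a = A + B * a + S a" "U y0 = A + B * y0 + S y0" "U b = A + B * b"
    using AB[of a] AB[of y0] AB[of b] y0 ab Sb by auto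
  show ?thesis unfolding 1 t1 t2 U' by (simp add: algebra_simps)
qed

section \<open>Densities annihilated by all separated tests\<close>

lemma fst_snd_measurable:
  "fst \<in> borel_measurable (lborel :: (real \<times> real) measure)"
  "snd \<in> borel_measurable (lborel :: (real \<times> real) measure)"
  by (auto intro!: borel_measurable_continuous_onI continuous_intros simp: borel_prod[symmetric])

text \<open>\<open>weak_deriv_increment\<close> is applied with
  \<open>U = 0\<close>, first in \<open>x\<close> and then in \<open>y\<close>, so that all integrals over quadrants vanish.\<close>
lemma AE_zero_if_annihilates_tests:
  fixes v :: "real \<times> real \<Rightarrow> real"
  assumes v: "integrable lborel v" and ab: "a < b" "c < d"
    and supp: "\<And>p. v p \<noteq> 0 \<Longrightarrow> a < fst p \<and> fst p < b \<and> c < snd p \<and> snd p < d"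
    and test: "\<And>\<alpha> \<beta>. cc_smooth a b \<alpha> \<Longrightarrow> cc_smooth c d \<beta> \<Longrightarrow> (\<integral>p. v p * (\<alpha> (fst p) * \<beta> (snd p)) \<partial>lborel) = 0"
  shows "AE p in lborel. v p = 0"
proof -
  note m = fst_snd_measurable
  have cc: "\<beta> \<in> borel_measurable borel" "\<exists>B. \<forall>t. \<bar>\<beta> t\<bar> \<le> B" if b: "cc_smooth c d \<beta>" for c d \<beta>
  proof -
    have c: "continuous_on UNIV \<beta>" using b by (metis cc_smooth_def Dk.simps(1))
    then show "\<beta> \<in> borel_measurable borel" by (rule borel_measurable_continuous_onI)
    obtain c' d' where z: "\<And>x. x \<notin> {c'..d'} \<Longrightarrow> \<beta> x = 0" using b unfolding cc_smooth_def by blast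
    have "bounded (\<beta> ` {c'..d'})" by (intro compact_imp_bounded compact_continuous_image continuous_on_subset[OF c]) auto
    then obtain B where "B > 0" "\<And>x. x \<in> {c'..d'} \<Longrightarrow> \<bar>\<beta> x\<bar> \<le> B" unfolding bounded_pos by (metis imageI real_norm_def)
    then show "\<exists>B. \<forall>t. \<bar>\<beta> t\<bar> \<le> B" using z by (metis abs_zero less_imp_le)
  qed
  \<comment> \<open>\<open>weak_deriv_increment\<close> covers thresholds in the interval; beyond it
    the indicator is constant on the support, so clamping q changes nothing.\<close>
  have clamp: "(\<integral>p. w p * indicator {..<q} (Y p) \<partial>lborel) = 0"
    if w: "\<And>q. q \<in> {s..t} \<Longrightarrow> (\<integral>p. w p * indicator {..<q} (Y p) \<partial>lborel) = 0"
      and sw: "\<And>p. w p \<noteq> 0 \<Longrightarrow> s < Y p \<and> Y p < t" and st: "s < t"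
    for w Y :: "real \<times> real \<Rightarrow> real" and q s t
  proof -
    define q' where "q' = max s (min q t)"
    have "(\<integral>p. w p * indicator {..<q} (Y p) \<partial>lborel) = (\<integral>p. w p * indicator {..<q'} (Y p) \<partial>lborel)"
      by (rule Bochner_Integration.integral_cong[OF refl]) (use sw in \<open>force simp: q'_def indicator_def\<close>)
    then show ?thesis using w[of q'] st by (simp add: q'_def)
  qed
  have 1: "(\<integral>p. v p * indicator {..<q} (fst p) * \<beta> (snd p) \<partial>lborel) = 0" if \<beta>: "cc_smooth c d \<beta>" for q \<beta>
  proof -
    obtain B where B: "\<And>t. \<bar>\<beta> t\<bar> \<le> B" using cc(2)[OF \<beta>] by auto
    have iv: "integrable lborel (\<lambda>p. v p * \<beta> (snd p))"
      by (rule integrable_mult_bounded[OF v]) (use cc(1)[OF \<beta>] m B in auto)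
    have "(\<integral>p. (v p * \<beta> (snd p)) * indicator {..<q} (fst p) \<partial>lborel) = 0"
    proof (rule clamp[where s = a and t = b])
      fix q assume q: "q \<in> {a..b}"
      have "(\<integral>p. (v p * \<beta> (snd p)) * indicator {..<q} (fst p) \<partial>lborel) = (\<lambda>_. 0) q - (\<lambda>_. 0) a"
        by (rule weak_deriv_increment[OF iv m(1) ab(1) _ _ _ q]) (use supp test \<beta> in \<open>auto simp: mult_ac\<close>)
      then show "(\<integral>p. (v p * \<beta> (snd p)) * indicator {..<q} (fst p) \<partial>lborel) = 0" by simp
    qed (use supp ab in auto)
    then show ?thesis by (simp add: mult_ac)
  qed
  have iq: "integrable lborel (\<lambda>p. v p * indicator {..<q} (fst p))" for q
    by (rule integrable_mult_bounded[OF v, of _ 1]) (use m in \<open>auto simp: indicator_def\<close>)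
  have 2: "(\<integral>p. v p * indicator {..<q} (fst p) * indicator {..<r} (snd p) \<partial>lborel) = 0" for q r
  proof (rule clamp[where s = c and t = d])
    fix r assume r: "r \<in> {c..d}"
    have "(\<integral>p. (v p * indicator {..<q} (fst p)) * indicator {..<r} (snd p) \<partial>lborel) = (\<lambda>_. 0) r - (\<lambda>_. 0) c"
      by (rule weak_deriv_increment[OF iq m(2) ab(2) _ _ _ r]) (use supp 1 in auto)
    then show "(\<integral>p. (v p * indicator {..<q} (fst p)) * indicator {..<r} (snd p) \<partial>lborel) = 0" by simp
  qed (use supp ab in auto)
  have tot: "(\<integral>p. v p \<partial>lborel) = 0"
  proof -
    have "(\<integral>p. v p \<partial>lborel) = (\<integral>p. v p * indicator {..<b} (fst p) * indicator {..<d} (snd p) \<partial>lborel)"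
      by (rule Bochner_Integration.integral_cong[OF refl]) (use supp in \<open>force simp: indicator_def\<close>)
    then show ?thesis using 2 by simp
  qed
  \<comment> \<open>Open lower left quadrants are stable under intersection and generate the Borel
    sets, so vanishing on them and on the whole plane spreads to all Borel sets by a Dynkin
    argument.\<close>
  define G where "G = range (\<lambda>z::real \<times> real. {x. eucl_less x z})"
  have Gq: "{x. eucl_less x z} = {x. fst x < fst z \<and> snd x < snd z}" for z :: "real \<times> real"
    by (cases z) (auto simp: eucl_less_def Basis_prod_def)
  have si: "set_integrable lborel A v" if "A \<in> sets lborel" for A
    using v that unfolding set_integrable_def by (intro integrable_mult_indicator) auto
  have bs: "sets borel = sigma_sets UNIV G" 
    by (subst borel_eq_lessThan) (auto simp: G_def)
  show ?thesis
  proof (rule sigma_finite_measure.density_zero[OF sigma_finite_lborel v])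
    fix A :: "(real \<times> real) set" assume "A \<in> sets lborel"
    then have A: "A \<in> sigma_sets UNIV G" using bs by simp
    have "Int_stable G"
    proof (rule Int_stableI)
      fix A B assume "A \<in> G" "B \<in> G"
      then obtain y z where "A = {x. eucl_less x y}" "B = {x. eucl_less x z}" by (auto simp: G_def)
      then have "A \<inter> B = {x. eucl_less x (min (fst y) (fst z), min (snd y) (snd z))}" by (auto simp: Gq)
      then show "A \<inter> B \<in> G" by (auto simp: G_def)
    qed
    moreover have "G \<subseteq> Pow UNIV" by simp
    ultimately show "set_lebesgue_integral lborel A v = 0" using A
    proof (induction rule: sigma_sets_induct_disjoint)
      case (basic A)
      then obtain z where A: "A = {x. fst x < fst z \<and> snd x < snd z}" by (auto simp: G_def Gq)
      have "set_lebesgue_integral lborel A v = (\<integral>p. v p * indicator {..<fst z} (fst p) * indicator {..<snd z} (snd p) \<partial>lborel)"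
        unfolding set_lebesgue_integral_def by (rule Bochner_Integration.integral_cong[OF refl]) (auto simp: A indicator_def)
      then show ?case using 2 by simp
    next
      case empty
      then show ?case by (simp add: set_lebesgue_integral_def)
    next
      case (compl A)
      then have A: "A \<in> sets lborel" using bs by simp
      have "set_lebesgue_integral lborel (UNIV - A) v = (\<integral>p. v p - indicator A p *\<^sub>R v p \<partial>lborel)"
        unfolding set_lebesgue_integral_def by (rule Bochner_Integration.integral_cong[OF refl]) (auto simp: indicator_def)
      also have "\<dots> = (\<integral>p. v p \<partial>lborel) - set_lebesgue_integral lborel A v"
        using v si[OF A] unfolding set_lebesgue_integral_def set_integrable_def by (rule Bochner_Integration.integral_diff)
      finally show ?case using tot compl by simp
    next
      case (union A)
      then have A: "A i \<in> sets lborel" for i using bs by auto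
      have "set_lebesgue_integral lborel (\<Union>i. A i) v = (\<Sum>i. set_lebesgue_integral lborel (A i) v)"
        by (rule lebesgue_integral_countable_add)
           (use A union(1) si[OF sets.countable_UN[of A UNIV lborel]] in \<open>auto simp: disjoint_family_on_def\<close>)
      then show ?case using union by simp
    qed
  qed
qed

section \<open>Separated test functions\<close>

lemma Omega_box: "Omega l = box (0, - l) (pi, l)"
  by (auto simp: Omega_def box_def Basis_prod_def)

lemma closure_Omega: "l > 0 \<Longrightarrow> closure (Omega l) = {0..pi} \<times> {-l..l}"
  by (simp add: Omega_def closure_Times)

lemma cbox_Omega: "cbox (0, - l) (pi, l) = {0..pi} \<times> {-l..l :: real}"
  by (simp add: cbox_Pair_eq)

lemma Omega_sets [measurable]: "Omega l \<in> sets borel"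
  unfolding Omega_box by simp

lemma cont_set_integrable:
  fixes F :: "real \<times> real \<Rightarrow> real"
  assumes "continuous_on ({0..pi} \<times> {-l..l}) F"
  shows "set_integrable lborel (Omega l) F"
proof -
  have "set_integrable lborel (cbox (0, - l) (pi, l)) F"
    using assms unfolding set_integrable_def cbox_Omega[symmetric] by (intro borel_integrable_compact) auto
  then show ?thesis
    by (rule set_integrable_subset) (use Omega_sets in \<open>auto simp: Omega_def cbox_Omega\<close>)
qed

lemma LINT_Omega_iterated:
  fixes F :: "real \<times> real \<Rightarrow> real"
  assumes F: "continuous_on ({0..pi} \<times> {-l..l}) F"
  shows "(LINT p:Omega l|lborel. F p) = integral {0..pi} (\<lambda>x. integral {-l..l} (\<lambda>y. F (x, y)))"
    "(LINT p:Omega l|lborel. F p) = integral {-l..l} (\<lambda>y. integral {0..pi} (\<lambda>x. F (x, y)))"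
proof -
  have c: "continuous_on (cbox (0, - l) (pi, l)) F" using F by (simp add: cbox_Omega)
  have "(LINT p:Omega l|lborel. F p) = integral (Omega l) F"
    using set_borel_integral_eq_integral(2)[OF cont_set_integrable[OF F]] .
  also have "\<dots> = integral (cbox (0, - l) (pi, l)) F" unfolding Omega_box by (rule integral_open_interval)
  also have "\<dots> = integral {0..pi} (\<lambda>x. integral {-l..l} (\<lambda>y. F (x, y)))"
    using integral_prod_continuous[OF c] by simp
  finally show 1: "(LINT p:Omega l|lborel. F p) = integral {0..pi} (\<lambda>x. integral {-l..l} (\<lambda>y. F (x, y)))" .
  show "(LINT p:Omega l|lborel. F p) = integral {-l..l} (\<lambda>y. integral {0..pi} (\<lambda>x. F (x, y)))"
    unfolding 1 using integral_swap_continuous[of 0 "-l" pi l "\<lambda>x y. F (x, y)"] c by simp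
qed

lemma cont_in_L2:
  assumes "continuous_on ({0..pi} \<times> {-l..l}) F"
  shows "F \<in> L2 (Omega l)"
  using cont_set_integrable[OF assms] cont_set_integrable[of l "\<lambda>p. (F p)\<^sup>2"] assms
  by (auto simp: L2_def set_borel_measurable_def set_integrable_def intro!: continuous_intros)

lemma L2_integrable:
  assumes "g \<in> L2 (Omega l)"
  shows "integrable lborel (\<lambda>p. indicator (Omega l) p * g p)"
proof (rule Bochner_Integration.integrable_bound)
  have "set_integrable lborel (Omega l) (\<lambda>_. 1 :: real)" by (rule cont_set_integrable) (rule continuous_on_const)
  moreover have "set_integrable lborel (Omega l) (\<lambda>p. (g p)\<^sup>2)" using assms by (simp add: L2_def)
  ultimately show "integrable lborel (\<lambda>p. indicator (Omega l) p *\<^sub>R (1 :: real) + indicator (Omega l) p *\<^sub>R (g p)\<^sup>2)"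
    unfolding set_integrable_def by (rule Bochner_Integration.integrable_add)
  show "(\<lambda>p. indicator (Omega l) p * g p) \<in> borel_measurable lborel"
    using assms by (simp add: L2_def set_borel_measurable_def)
  have "\<bar>t\<bar> \<le> 1 + t\<^sup>2" for t :: real
    using zero_le_power2[of "\<bar>t\<bar> - 1"] by (simp add: power2_eq_square algebra_simps)
  then show "AE p in lborel. norm (indicator (Omega l) p * g p)
      \<le> norm (indicator (Omega l) p *\<^sub>R (1::real) + indicator (Omega l) p *\<^sub>R (g p)\<^sup>2)"
    by (auto simp: indicator_def)
qed

section \<open>Products of one-variable functions as test functions\<close>

lemma separated_diff:
  assumes "\<And>x. (\<alpha> has_real_derivative \<alpha>' x) (at x)" "\<And>y. (\<beta> has_real_derivative \<beta>' y) (at y)"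
  shows "(\<lambda>(x, y). \<alpha> x * \<beta> y) differentiable_on UNIV"
    "pdx (\<lambda>(x, y). \<alpha> x * \<beta> y) = (\<lambda>(x, y). \<alpha>' x * \<beta> y)"
    "pdy (\<lambda>(x, y). \<alpha> x * \<beta> y) = (\<lambda>(x, y). \<alpha> x * \<beta>' y)"
proof -
  have d: "(\<lambda>p. \<alpha> (fst p)) differentiable (at p)" "(\<lambda>p. \<beta> (snd p)) differentiable (at p)" for p :: "real \<times> real"
    using differentiable_chain_at[of fst p \<alpha>] differentiable_chain_at[of snd p \<beta>] assms
    by (auto simp: o_def real_differentiable_def bounded_linear_imp_differentiable bounded_linear_fst bounded_linear_snd)
  then show "(\<lambda>(x, y). \<alpha> x * \<beta> y) differentiable_on UNIV"
    unfolding differentiable_on_def case_prod_beta by (auto intro!: differentiable_mult)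
  show "pdx (\<lambda>(x, y). \<alpha> x * \<beta> y) = (\<lambda>(x, y). \<alpha>' x * \<beta> y)"
    using assms by (auto simp: pdx_def fun_eq_iff intro!: DERIV_imp_deriv DERIV_cmult_right)
  show "pdy (\<lambda>(x, y). \<alpha> x * \<beta> y) = (\<lambda>(x, y). \<alpha> x * \<beta>' y)"
    using assms by (auto simp: pdy_def fun_eq_iff intro!: DERIV_imp_deriv DERIV_cmult)
qed

lemma smooth_deriv: "(\<forall>n. Dk n \<alpha>) \<Longrightarrow> (\<forall>n. Dk n (deriv \<alpha>))"
  using Dk.simps(2) by blast

lemma smooth_iter: "(\<forall>n. Dk n \<alpha>) \<Longrightarrow> (\<forall>n. Dk n ((deriv ^^ i) \<alpha>))"
  by (induction i) (auto dest: smooth_deriv)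

lemma smooth_DERIV: "(\<forall>n. Dk n \<alpha>) \<Longrightarrow> (\<alpha> has_real_derivative deriv \<alpha> x) (at x)"
  using Dk_SucD[of 0 \<alpha>] by blast

lemma Ck_separated:
  assumes "\<forall>n. Dk n \<alpha>" "\<forall>n. Dk n \<beta>"
  shows "Ck k (\<lambda>(x, y). \<alpha> x * \<beta> y)"
  using assms
proof (induction k arbitrary: \<alpha> \<beta>)
  case 0
  then have c: "continuous_on UNIV \<alpha>" "continuous_on UNIV \<beta>" by (metis Dk.simps(1))+
  have "continuous_on UNIV (\<lambda>p. \<alpha> (fst p))" "continuous_on UNIV (\<lambda>p. \<beta> (snd p))"
    by (rule continuous_on_compose2[OF c(1)] continuous_on_compose2[OF c(2)], auto intro: continuous_intros)+
  then show ?case unfolding Ck.simps case_prod_beta by (rule continuous_on_mult)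
next
  case (Suc k)
  have d: "(\<alpha> has_real_derivative deriv \<alpha> x) (at x)" "(\<beta> has_real_derivative deriv \<beta> x) (at x)" for x
    using Suc.prems by (auto intro: smooth_DERIV)
  show ?case unfolding Ck.simps separated_diff(2,3)[OF d]
    using Suc.prems smooth_deriv separated_diff(1)[OF d] by (auto intro!: Suc.IH)
qed

lemma cc_smoothD: "cc_smooth a b \<alpha> \<Longrightarrow> \<forall>n. Dk n \<alpha>"
  by (simp add: cc_smooth_def)

lemma compact_closed_subset:
  fixes K A :: "'a::topological_space set"
  shows "compact K \<Longrightarrow> closed A \<Longrightarrow> A \<subseteq> K \<Longrightarrow> compact A"
  using compact_Int_closed[of K A] by (simp add: Int_absorb1)

lemma cc_smooth_test_function:
  assumes "cc_smooth 0 pi \<alpha>" "cc_smooth (-l) l \<beta>"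
  shows "test_function (Omega l) (\<lambda>(x, y). \<alpha> x * \<beta> y)"
proof -
  obtain c d where cd: "0 < c" "d < pi" "\<And>x. x \<notin> {c..d} \<Longrightarrow> \<alpha> x = 0" using assms(1) unfolding cc_smooth_def by blast
  obtain c' d' where cd': "-l < c'" "d' < l" "\<And>x. x \<notin> {c'..d'} \<Longrightarrow> \<beta> x = 0" using assms(2) unfolding cc_smooth_def by blast
  have "{p. (\<lambda>(x, y). \<alpha> x * \<beta> y) p \<noteq> 0} \<subseteq> {c..d} \<times> {c'..d'}"
    using cd(3) cd'(3) by (fastforce simp del: atLeastAtMost_iff)
  then have s: "closure {p. (\<lambda>(x, y). \<alpha> x * \<beta> y) p \<noteq> 0} \<subseteq> {c..d} \<times> {c'..d'}"
    by (rule closure_minimal) (intro closed_Times closed_atLeastAtMost)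
  have "compact ({c..d} \<times> {c'..d'})" by (intro compact_Times compact_Icc)
  then have "compact (closure {p. (\<lambda>(x, y). \<alpha> x * \<beta> y) p \<noteq> 0})"
    by (rule compact_closed_subset[OF _ closed_closure s])
  moreover have "{c..d} \<times> {c'..d'} \<subseteq> Omega l" using cd cd' by (auto simp: Omega_def)
  ultimately show ?thesis using s cc_smoothD[OF assms(1)] cc_smoothD[OF assms(2)]
    by (auto simp: test_function_def intro: Ck_separated)
qed

lemma iterated_pd_separated:
  assumes "\<forall>n. Dk n \<alpha>" "\<forall>n. Dk n \<beta>"
  shows "(pdx ^^ i) ((pdy ^^ j) (\<lambda>(x, y). \<alpha> x * \<beta> y)) = (\<lambda>(x, y). (deriv ^^ i) \<alpha> x * (deriv ^^ j) \<beta> y)"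
proof -
  have 1: "(pdy ^^ j) (\<lambda>(x, y). \<alpha> x * \<beta> y) = (\<lambda>(x, y). \<alpha> x * (deriv ^^ j) \<beta> y)"
  proof (induction j)
    case (Suc j)
    show ?case unfolding funpow.simps o_apply Suc
      by (rule separated_diff(3)[OF smooth_DERIV smooth_DERIV]) (use assms smooth_iter in blast)+
  qed simp
  show ?thesis
  proof (induction i)
    case 0
    then show ?case using 1 by simp
  next
    case (Suc i)
    show ?case unfolding funpow.simps o_apply Suc
      by (rule separated_diff(2)[OF smooth_DERIV smooth_DERIV]) (use assms smooth_iter in blast)+
  qed
qed

lemma weak_deriv_test_separated:
  assumes g: "has_weak_deriv (Omega l) i j u g" and "cc_smooth 0 pi \<alpha>" "cc_smooth (-l) l \<beta>"
  shows "(LINT p:Omega l|lborel. g p * (\<alpha> (fst p) * \<beta> (snd p)))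
    = (-1) ^ (i + j) * (LINT p:Omega l|lborel. u p * ((deriv ^^ i) \<alpha> (fst p) * (deriv ^^ j) \<beta> (snd p)))"
proof -
  have "(LINT p:Omega l|lborel. u p * (pdx ^^ i) ((pdy ^^ j) (\<lambda>(x, y). \<alpha> x * \<beta> y)) p)
      = (-1) ^ (i + j) * (LINT p:Omega l|lborel. g p * (\<lambda>(x, y). \<alpha> x * \<beta> y) p)"
    using g cc_smooth_test_function[OF assms(2,3)] unfolding has_weak_deriv_def by blast
  then show ?thesis
    unfolding iterated_pd_separated[OF cc_smoothD[OF assms(2)] cc_smoothD[OF assms(3)]] case_prod_beta by simp
qed

lemma Omega_mult_integrable:
  fixes g T :: "real \<times> real \<Rightarrow> real"
  assumes g: "integrable lborel (\<lambda>p. indicator (Omega l) p * g p)" and T: "continuous_on UNIV T"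
  shows "integrable lborel (\<lambda>p. indicator (Omega l) p * (g p * T p))"
proof -
  have "compact ({0..pi} \<times> {-l..l})" by (intro compact_Times compact_Icc)
  then have "bounded (T ` ({0..pi} \<times> {-l..l}))"
    by (intro compact_imp_bounded compact_continuous_image continuous_on_subset[OF T]) auto
  then obtain B where B: "\<And>p. p \<in> {0..pi} \<times> {-l..l} \<Longrightarrow> \<bar>T p\<bar> \<le> B" unfolding bounded_iff by (metis imageI real_norm_def)
  have "integrable lborel (\<lambda>p. (indicator (Omega l) p * g p) * T p)"
  proof (rule integrable_mult_bounded[OF g, where B = B])
    show "T \<in> borel_measurable lborel" using T by (simp add: borel_measurable_continuous_onI)
    show "\<bar>T p\<bar> \<le> B" if "indicator (Omega l) p * g p \<noteq> 0" for p
      by (rule B) (use that in \<open>auto simp: Omega_def indicator_def split: if_splits\<close>)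
  qed
  then show ?thesis by (simp add: mult.assoc)
qed

text \<open>\<open>weak_deriv\<close> is an arbitrary choice, and this is what allows explicit
  derivatives to replace it in \<open>H2star_inner\<close>. Separated tests already determine a
  density by \<open>AE_zero_if_annihilates_tests\<close>.\<close>

lemma weak_deriv_unique_AE:
  assumes l: "l > 0" and g: "g \<in> L2 (Omega l)" "has_weak_deriv (Omega l) i j u g"
    and g': "g' \<in> L2 (Omega l)" "has_weak_deriv (Omega l) i j u g'"
  shows "AE p in lborel. p \<in> Omega l \<longrightarrow> g p = g' p"
proof -
  define v where "v = (\<lambda>p. indicator (Omega l) p * g p - indicator (Omega l) p * g' p)"
  have i: "integrable lborel (\<lambda>p. indicator (Omega l) p * g p)" "integrable lborel (\<lambda>p. indicator (Omega l) p * g' p)"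
    using L2_integrable g(1) g'(1) by auto
  have "AE p in lborel. v p = 0"
  proof (rule AE_zero_if_annihilates_tests)
    show "integrable lborel v" unfolding v_def using i by (rule Bochner_Integration.integrable_diff)
    show "0 < pi" "-l < l" using l by auto
    show "0 < fst p \<and> fst p < pi \<and> -l < snd p \<and> snd p < l" if "v p \<noteq> 0" for p
      using that by (cases "p \<in> Omega l") (auto simp: v_def Omega_def)
    fix \<alpha> \<beta> assume \<alpha>: "cc_smooth 0 pi \<alpha>" and \<beta>: "cc_smooth (-l) l \<beta>"
    define T where "T = (\<lambda>p::real \<times> real. \<alpha> (fst p) * \<beta> (snd p))"
    have Tc: "continuous_on UNIV T"
      using Ck_separated[OF cc_smoothD[OF \<alpha>] cc_smoothD[OF \<beta>], of 0] by (simp add: T_def case_prod_beta)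
    have iT: "integrable lborel (\<lambda>p. (indicator (Omega l) p * h p) * T p)"
      if "integrable lborel (\<lambda>p. indicator (Omega l) p * h p)" for h
      using Omega_mult_integrable[OF that Tc] by (simp add: mult.assoc)
    have "(\<integral>p. v p * T p \<partial>lborel) = (\<integral>p. (indicator (Omega l) p * g p) * T p \<partial>lborel) - (\<integral>p. (indicator (Omega l) p * g' p) * T p \<partial>lborel)"
      unfolding v_def left_diff_distrib by (rule Bochner_Integration.integral_diff) (intro iT i)+
    also have "\<dots> = 0"
      using weak_deriv_test_separated[OF g(2) \<alpha> \<beta>] weak_deriv_test_separated[OF g'(2) \<alpha> \<beta>]
      by (simp add: set_lebesgue_integral_def T_def mult.assoc)
    finally show "(\<integral>p. v p * (\<alpha> (fst p) * \<beta> (snd p)) \<partial>lborel) = 0" by (simp add: T_def)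
  qed
  then show ?thesis by eventually_elim (auto simp: v_def)
qed

section \<open>Weak derivatives of products of classical functions\<close>

lemma test_function_pd:
  assumes "test_function S \<psi>"
  shows "test_function S (pdx \<psi>)" "test_function S (pdy \<psi>)"
proof -
  let ?K = "closure {p. \<psi> p \<noteq> 0}"
  have z: "pdx \<psi> p = 0 \<and> pdy \<psi> p = 0" if "p \<notin> ?K" for p
  proof -
    obtain x y where p: "p = (x, y)" by (cases p)
    have o: "open (- ?K)" by auto
    have ev: "eventually (\<lambda>p. \<psi> p = 0) (nhds p)"
    proof (rule eventually_mono[OF eventually_nhds_in_open[OF o]])
      show "p \<in> - ?K" using that by simp
      show "\<psi> q = 0" if "q \<in> - ?K" for q using that closure_subset[of "{p. \<psi> p \<noteq> 0}"] by auto
    qed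
    have "((\<lambda>s. (s, y)) \<longlongrightarrow> p) (nhds x)" "((\<lambda>s. (x, s)) \<longlongrightarrow> p) (nhds y)" unfolding p
      by (intro tendsto_intros filterlim_ident)+
    then have "eventually (\<lambda>s. \<psi> (s, y) = 0) (nhds x)" "eventually (\<lambda>s. \<psi> (x, s) = 0) (nhds y)"
      using ev by (auto simp: filterlim_iff)
    then have "deriv (\<lambda>s. \<psi> (s, y)) x = deriv (\<lambda>_. 0) x" "deriv (\<lambda>s. \<psi> (x, s)) y = deriv (\<lambda>_. 0) y"
      by (auto intro: deriv_cong_ev simp del: deriv_const)
    then show ?thesis by (simp add: p pdx_def pdy_def)
  qed
  have s: "closure {p. pdx \<psi> p \<noteq> 0} \<subseteq> ?K" "closure {p. pdy \<psi> p \<noteq> 0} \<subseteq> ?K"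
    by (rule closure_minimal; use z in auto)+
  have "Ck k (pdx \<psi>) \<and> Ck k (pdy \<psi>)" for k
  proof -
    have "Ck (Suc k) \<psi>" using assms unfolding test_function_def by blast
    then show ?thesis by simp
  qed
  moreover have "compact (closure {p. pdx \<psi> p \<noteq> 0})" "compact (closure {p. pdy \<psi> p \<noteq> 0})"
    using assms unfolding test_function_def by (metis compact_closed_subset[OF _ closed_closure] s)+
  ultimately show "test_function S (pdx \<psi>)" "test_function S (pdy \<psi>)"
    using s assms unfolding test_function_def by (auto dest: subset_trans[OF s(1)] subset_trans[OF s(2)])
qed

lemma test_function_iter:
  assumes "test_function S \<psi>"
  shows "test_function S ((pdx ^^ i) \<psi>)" "test_function S ((pdy ^^ i) \<psi>)"
  using assms by (induction i) (auto intro: test_function_pd)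

lemma test_function_DERIV:
  assumes "test_function S \<psi>"
  shows "((\<lambda>s. \<psi> (s, y)) has_real_derivative pdx \<psi> (x, y)) (at x)"
    "((\<lambda>s. \<psi> (x, s)) has_real_derivative pdy \<psi> (x, y)) (at y)"
proof -
  have d: "\<psi> differentiable (at p)" for p
  proof -
    have "Ck (Suc 0) \<psi>" using assms unfolding test_function_def by blast
    then show ?thesis by (cases p) (simp add: differentiable_on_def)
  qed
  have "(\<lambda>s. (s, y)) differentiable (at x)" "(\<lambda>s. (x, s)) differentiable (at y)"
    unfolding differentiable_def
    by (rule exI, rule has_derivative_Pair[OF has_derivative_ident has_derivative_const])
      (rule exI, rule has_derivative_Pair[OF has_derivative_const has_derivative_ident])
  from differentiable_chain_at[OF this(1) d] differentiable_chain_at[OF this(2) d]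
  show "((\<lambda>s. \<psi> (s, y)) has_real_derivative pdx \<psi> (x, y)) (at x)"
    "((\<lambda>s. \<psi> (x, s)) has_real_derivative pdy \<psi> (x, y)) (at y)"
    by (simp_all add: pdx_def pdy_def o_def DERIV_deriv_iff_real_differentiable)
qed

lemma test_function_cont: "test_function S \<psi> \<Longrightarrow> continuous_on A \<psi>"
proof -
  assume "test_function S \<psi>"
  then have "Ck 0 \<psi>" unfolding test_function_def by blast
  then show ?thesis using continuous_on_subset by fastforce
qed

lemma test_function_zero: "test_function S \<psi> \<Longrightarrow> p \<notin> S \<Longrightarrow> \<psi> p = 0"
  using closure_subset[of "{p. \<psi> p \<noteq> 0}"] unfolding test_function_def by blast

lemma classical_by_parts:
  fixes f f' g g' :: "real \<Rightarrow> real"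
  assumes "a \<le> b" "\<And>t. (f has_real_derivative f' t) (at t)" "\<And>t. (g has_real_derivative g' t) (at t)"
    and "continuous_on {a..b} f'" "continuous_on {a..b} g'"
  shows "integral {a..b} (\<lambda>t. f t * g' t) = f b * g b - f a * g a - integral {a..b} (\<lambda>t. f' t * g t)"
proof -
  have c: "continuous_on {a..b} f" "continuous_on {a..b} g"
    using assms(2,3) by (meson DERIV_isCont continuous_at_imp_continuous_on)+
  have 1: "((\<lambda>t. f' t * g t + g' t * f t) has_integral (f b * g b - f a * g a)) {a..b}"
    by (rule fundamental_theorem_of_calculus[OF assms(1)])
      (unfold has_real_derivative_iff_has_vector_derivative[symmetric],
        rule has_field_derivative_at_within, rule DERIV_mult[OF assms(2,3)])
  have 2: "((\<lambda>t. f' t * g t) has_integral integral {a..b} (\<lambda>t. f' t * g t)) {a..b}"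
    by (intro integrable_integral integrable_continuous_real continuous_on_mult c assms(4))
  have e: "(\<lambda>t. (f' t * g t + g' t * f t) - f' t * g t) = (\<lambda>t. f t * g' t)" by auto
  show ?thesis by (rule integral_unique[OF has_integral_diff[OF 1 2, unfolded e]])
qed

lemma separated_test_by_parts:
  assumes l: "l > 0" and \<psi>: "test_function (Omega l) \<psi>"
    and A: "\<And>x. (\<alpha> has_real_derivative \<alpha>' x) (at x)" "continuous_on UNIV \<alpha>'" and B: "continuous_on UNIV \<beta>"
  shows "(LINT p:Omega l|lborel. (\<alpha> (fst p) * \<beta> (snd p)) * pdx \<psi> p)
      = - (LINT p:Omega l|lborel. (\<alpha>' (fst p) * \<beta> (snd p)) * \<psi> p)"
    "(LINT p:Omega l|lborel. (\<beta> (fst p) * \<alpha> (snd p)) * pdy \<psi> p)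
      = - (LINT p:Omega l|lborel. (\<beta> (fst p) * \<alpha>' (snd p)) * \<psi> p)"
proof -
  have Ac: "continuous_on UNIV \<alpha>" using A(1) by (meson DERIV_isCont continuous_at_imp_continuous_on)
  have c: "continuous_on X (\<lambda>p. \<alpha> (f p))" "continuous_on X (\<lambda>p. \<beta> (f p))" "continuous_on X (\<lambda>p. \<alpha>' (f p))"
    if "continuous_on X f" for X and f :: "real \<times> real \<Rightarrow> real"
    using that by (auto intro: continuous_on_compose2[OF Ac] continuous_on_compose2[OF B] continuous_on_compose2[OF A(2)])
  note [continuous_intros] = c test_function_cont[OF \<psi>] test_function_cont[OF test_function_pd(1)[OF \<psi>]]
    test_function_cont[OF test_function_pd(2)[OF \<psi>]]
  have z: "\<psi> (0, y) = 0" "\<psi> (pi, y) = 0" "\<psi> (x, -l) = 0" "\<psi> (x, l) = 0" for x y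
    using test_function_zero[OF \<psi>] by (auto simp: Omega_def)
  have cx: "continuous_on X (\<lambda>t. pdx \<psi> (t, y))" "continuous_on X (\<lambda>t. pdy \<psi> (x, t))" for X x y
    by (auto intro!: continuous_on_compose2[OF test_function_cont[OF test_function_pd(1)[OF \<psi>], of UNIV]]
      continuous_on_compose2[OF test_function_cont[OF test_function_pd(2)[OF \<psi>], of UNIV]] continuous_intros)
  have 1: "integral {0..pi} (\<lambda>x. \<alpha> x * \<beta> y * pdx \<psi> (x, y)) = - integral {0..pi} (\<lambda>x. \<alpha>' x * \<beta> y * \<psi> (x, y))" for y
  proof -
    have "integral {0..pi} (\<lambda>x. \<alpha> x * pdx \<psi> (x, y)) = - integral {0..pi} (\<lambda>x. \<alpha>' x * \<psi> (x, y))"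
      using classical_by_parts[OF _ A(1) test_function_DERIV(1)[OF \<psi>] continuous_on_subset[OF A(2)] cx(1), of 0 pi y] z
      by simp
    then have "\<beta> y * integral {0..pi} (\<lambda>x. \<alpha> x * pdx \<psi> (x, y)) = - (\<beta> y * integral {0..pi} (\<lambda>x. \<alpha>' x * \<psi> (x, y)))" by simp
    then show ?thesis unfolding integral_mult_right[symmetric] by (simp add: mult_ac)
  qed
  have 2: "integral {-l..l} (\<lambda>y. \<beta> x * \<alpha> y * pdy \<psi> (x, y)) = - integral {-l..l} (\<lambda>y. \<beta> x * \<alpha>' y * \<psi> (x, y))" for x
  proof -
    have "integral {-l..l} (\<lambda>y. \<alpha> y * pdy \<psi> (x, y)) = - integral {-l..l} (\<lambda>y. \<alpha>' y * \<psi> (x, y))"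
      using classical_by_parts[OF _ A(1) test_function_DERIV(2)[OF \<psi>] continuous_on_subset[OF A(2)] cx(2), of "-l" l x] z l
      by simp
    then have "\<beta> x * integral {-l..l} (\<lambda>y. \<alpha> y * pdy \<psi> (x, y)) = - (\<beta> x * integral {-l..l} (\<lambda>y. \<alpha>' y * \<psi> (x, y)))" by simp
    then show ?thesis unfolding integral_mult_right[symmetric] by (simp add: mult_ac)
  qed
  show "(LINT p:Omega l|lborel. (\<alpha> (fst p) * \<beta> (snd p)) * pdx \<psi> p)
      = - (LINT p:Omega l|lborel. (\<alpha>' (fst p) * \<beta> (snd p)) * \<psi> p)"
    by (subst (1 2) LINT_Omega_iterated(2); (intro continuous_intros)?) (simp add: 1)
  show "(LINT p:Omega l|lborel. (\<beta> (fst p) * \<alpha> (snd p)) * pdy \<psi> p)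
      = - (LINT p:Omega l|lborel. (\<beta> (fst p) * \<alpha>' (snd p)) * \<psi> p)"
    by (subst (1 2) LINT_Omega_iterated(1); (intro continuous_intros)?) (simp add: 2)
qed

text \<open>Here the tests are arbitrary, not products; they vanish on the boundary of the
  rectangle, so A and B may be nonzero there. The index counts derivatives. Of A 2 and B 2 only
  continuity is asked, as the third derivative of the beam Green function jumps.\<close>

lemma separated_has_weak_deriv:
  fixes A B :: "nat \<Rightarrow> real \<Rightarrow> real"
  assumes l: "l > 0"
    and A: "\<And>k x. k < 2 \<Longrightarrow> (A k has_real_derivative A (Suc k) x) (at x)" "\<And>k. k \<le> 2 \<Longrightarrow> continuous_on UNIV (A k)"
    and B: "\<And>k x. k < 2 \<Longrightarrow> (B k has_real_derivative B (Suc k) x) (at x)" "\<And>k. k \<le> 2 \<Longrightarrow> continuous_on UNIV (B k)"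
    and ij: "i + j \<le> 2"
  shows "has_weak_deriv (Omega l) i j (\<lambda>(x, y). A 0 x * B 0 y) (\<lambda>(x, y). A i x * B j y)"
proof -
  have y: "(LINT p:Omega l|lborel. (A a (fst p) * B b (snd p)) * (pdy ^^ j) \<psi> p)
      = (-1) ^ j * (LINT p:Omega l|lborel. (A a (fst p) * B (b + j) (snd p)) * \<psi> p)"
    if "a \<le> 2" "b + j \<le> 2" "test_function (Omega l) \<psi>" for a b j \<psi>
    using that
  proof (induction j arbitrary: b)
    case (Suc j)
    have "(LINT p:Omega l|lborel. (A a (fst p) * B b (snd p)) * (pdy ^^ Suc j) \<psi> p)
       = - (LINT p:Omega l|lborel. (A a (fst p) * B (Suc b) (snd p)) * (pdy ^^ j) \<psi> p)"
      using separated_test_by_parts(2)[OF l test_function_iter(2)[OF Suc.prems(3)] B A(2), of b a] Suc.prems by simp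
    also have "\<dots> = - ((-1) ^ j * (LINT p:Omega l|lborel. (A a (fst p) * B (Suc b + j) (snd p)) * \<psi> p))"
      using Suc.IH[of "Suc b"] Suc.prems by simp
    finally show ?case by simp
  qed simp
  have x: "(LINT p:Omega l|lborel. (A a (fst p) * B b (snd p)) * (pdx ^^ i) \<psi> p)
      = (-1) ^ i * (LINT p:Omega l|lborel. (A (a + i) (fst p) * B b (snd p)) * \<psi> p)"
    if "b \<le> 2" "a + i \<le> 2" "test_function (Omega l) \<psi>" for a b i \<psi>
    using that
  proof (induction i arbitrary: a)
    case (Suc i)
    have "(LINT p:Omega l|lborel. (A a (fst p) * B b (snd p)) * (pdx ^^ Suc i) \<psi> p)
       = - (LINT p:Omega l|lborel. (A (Suc a) (fst p) * B b (snd p)) * (pdx ^^ i) \<psi> p)"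
      using separated_test_by_parts(1)[OF l test_function_iter(1)[OF Suc.prems(3)] A B(2), of a b] Suc.prems by simp
    also have "\<dots> = - ((-1) ^ i * (LINT p:Omega l|lborel. (A (Suc a + i) (fst p) * B b (snd p)) * \<psi> p))"
      using Suc.IH[of "Suc a"] Suc.prems by simp
    finally show ?case by simp
  qed simp
  show ?thesis unfolding has_weak_deriv_def case_prod_beta
  proof (intro allI impI)
    fix \<psi> assume \<psi>: "test_function (Omega l) \<psi>"
    show "(LINT p:Omega l|lborel. A 0 (fst p) * B 0 (snd p) * (pdx ^^ i) ((pdy ^^ j) \<psi>) p)
        = (-1) ^ (i + j) * (LINT p:Omega l|lborel. A i (fst p) * B j (snd p) * \<psi> p)"
      using x[of 0 0 i "(pdy ^^ j) \<psi>"] y[of i 0 j \<psi>] \<psi> ij test_function_iter(2)[OF \<psi>]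
      by (simp add: power_add)
  qed
qed

section \<open>Sine coefficients of the Green function\<close>

text \<open>Continuity at w lets the fundamental theorem skip that point; w may also lie outside
  [a, b].\<close>

lemma kink_has_integral:
  fixes hl hr hl' hr' :: "real \<Rightarrow> real"
  assumes "a \<le> b" and d: "\<And>t. (hl has_real_derivative hl' t) (at t)" "\<And>t. (hr has_real_derivative hr' t) (at t)"
    and w: "hl w = hr w"
  shows "((\<lambda>s. if s \<le> w then hl' s else hr' s) has_integral
    ((if b \<le> w then hl b else hr b) - (if a \<le> w then hl a else hr a))) {a..b}"
proof (rule fundamental_theorem_of_calculus_interior_strong[of "{w}" a b "\<lambda>s. if s \<le> w then hl s else hr s"])
  fix x assume x: "x \<in> {a<..<b} - {w}"
  show "((\<lambda>s. if s \<le> w then hl s else hr s) has_vector_derivative (if x \<le> w then hl' x else hr' x)) (at x)"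
  proof (cases "x < w")
    case True
    have "eventually (\<lambda>s. (if s \<le> w then hl s else hr s) = hl s) (nhds x)"
      by (rule eventually_mono[OF eventually_nhds_in_open[of "{..<w}" x]]) (use True in auto)
    then have "((\<lambda>s. if s \<le> w then hl s else hr s) has_real_derivative hl' x) (at x)"
      using d(1)[of x] by (subst DERIV_cong_ev[OF refl _ refl]) auto
    then show ?thesis using True by (simp add: has_real_derivative_iff_has_vector_derivative)
  next
    case False
    then have xw: "w < x" using x by auto
    have "eventually (\<lambda>s. (if s \<le> w then hl s else hr s) = hr s) (nhds x)"
      by (rule eventually_mono[OF eventually_nhds_in_open[of "{w<..}" x]]) (use xw in auto)
    then have "((\<lambda>s. if s \<le> w then hl s else hr s) has_real_derivative hr' x) (at x)"
      using d(2)[of x] by (subst DERIV_cong_ev[OF refl _ refl]) auto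
    then show ?thesis using xw by (simp add: has_real_derivative_iff_has_vector_derivative)
  qed
next
  have c: "continuous_on S hl" "continuous_on S hr" for S
    using d by (meson DERIV_isCont continuous_at_imp_continuous_on)+
  have "continuous_on ({..w} \<union> {w..}) (\<lambda>s. if s \<le> w then hl s else hr s)"
    by (intro continuous_on_If c) (use w in \<open>auto simp: order_antisym\<close>)
  moreover have "{..w} \<union> {w..} = (UNIV :: real set)" by auto
  ultimately show "continuous_on {a..b} (\<lambda>s. if s \<le> w then hl s else hr s)"
    using continuous_on_subset by (metis subset_UNIV)
qed (use assms in auto)

text \<open>Taylor's formula at a with integral remainder; a corner at w enters as the slope jump
  times max 0 (t - w), which becomes the J term of
  \<open>weak_second_deriv_by_parts\<close>.\<close>

lemma kink_taylor:
  fixes hl hr hl' hr' hl'' hr'' :: "real \<Rightarrow> real"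
  assumes d: "\<And>t. (hl has_real_derivative hl' t) (at t)" "\<And>t. (hr has_real_derivative hr' t) (at t)"
    and dd: "\<And>t. (hl' has_real_derivative hl'' t) (at t)" "\<And>t. (hr' has_real_derivative hr'' t) (at t)"
    and w: "hl w = hr w" "w \<in> {a..b}" and t: "t \<in> {a..b}"
  shows "((\<lambda>s. max 0 (t - s) * (if s \<le> w then hl'' s else hr'' s)) has_integral
    ((if t \<le> w then hl t else hr t) - hl a - hl' a * (t - a) - (hr' w - hl' w) * max 0 (t - w))) {a..b}"
proof -
  define gl where "gl = (\<lambda>s. (t - s) * hl' s + hl s)"
  define gr where "gr = (\<lambda>s. (t - s) * hr' s + hr s)"
  have gd: "(gl has_real_derivative (t - s) * hl'' s) (at s)" "(gr has_real_derivative (t - s) * hr'' s) (at s)" for s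
    unfolding gl_def gr_def by (auto intro!: derivative_eq_intros d dd)
  \<comment> \<open>\<open>gl\<close> and \<open>gr\<close> are primitives of (t - s) times the
    second derivatives. They differ by k at w, so shifting \<open>gr\<close> by k produces a
    continuous primitive.\<close>
  define k where "k = gr w - gl w"
  have k: "k = (t - w) * (hr' w - hl' w)" using w by (simp add: k_def gl_def gr_def algebra_simps)
  have "((\<lambda>s. if s \<le> w then (t - s) * hl'' s else (t - s) * hr'' s) has_integral
    ((if t \<le> w then gl t else gr t - k) - (if a \<le> w then gl a else gr a - k))) {a..t}"
    by (rule kink_has_integral[where hl = gl and hr = "\<lambda>s. gr s - k"])
      (use t gd in \<open>auto simp: k_def intro!: derivative_eq_intros\<close>)
  moreover have "((if t \<le> w then gl t else gr t - k) - (if a \<le> w then gl a else gr a - k))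
     = (if t \<le> w then hl t else hr t) - hl a - hl' a * (t - a) - (hr' w - hl' w) * max 0 (t - w)"
    using w by (auto simp: gl_def gr_def k algebra_simps max_def)
  ultimately have "((\<lambda>s. if s \<le> w then (t - s) * hl'' s else (t - s) * hr'' s) has_integral
     ((if t \<le> w then hl t else hr t) - hl a - hl' a * (t - a) - (hr' w - hl' w) * max 0 (t - w))) {a..t}" by simp
  then have 1: "((\<lambda>s. max 0 (t - s) * (if s \<le> w then hl'' s else hr'' s)) has_integral
     ((if t \<le> w then hl t else hr t) - hl a - hl' a * (t - a) - (hr' w - hl' w) * max 0 (t - w))) {a..t}"
    by (rule has_integral_eq[rotated]) auto
  have 2: "((\<lambda>s. max 0 (t - s) * (if s \<le> w then hl'' s else hr'' s)) has_integral 0) {t..b}"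
    by (rule has_integral_is_0) auto
  show ?thesis using has_integral_combine[OF _ _ 1 2] t by simp
qed

lemma beam_has_integral:
  assumes "k \<le> 2" "t \<le> l"
  shows "(beam_green \<sigma> l m w (Suc k) has_integral (beam_green \<sigma> l m w k l - beam_green \<sigma> l m w k t)) {t..l}"
  using kink_has_integral[OF assms(2) beam_left_deriv beam_right_deriv beam_agree[OF assms(1)]]
  by (simp only: beam_green_eq[abs_def])

lemma beam_measurable: "beam_green \<sigma> l m w k \<in> borel_measurable borel"
proof -
  have c: "continuous_on UNIV (beam_left \<sigma> l m w k)" "continuous_on UNIV (beam_right \<sigma> l m w k)"
    using beam_left_deriv beam_right_deriv by (meson DERIV_isCont continuous_at_imp_continuous_on)+
  show ?thesis unfolding beam_green_eq[abs_def]
    by (intro measurable_If borel_measurable_continuous_onI c) auto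
qed

lemma cont_bounded_Icc:
  fixes f :: "real \<Rightarrow> real"
  assumes "continuous_on {a..b} f"
  obtains C where "\<And>s. s \<in> {a..b} \<Longrightarrow> \<bar>f s\<bar> \<le> C"
proof -
  have "bounded (f ` {a..b})" by (intro compact_imp_bounded compact_continuous_image assms compact_Icc)
  then show ?thesis using that unfolding bounded_iff by (metis imageI real_norm_def)
qed

lemma beam_bounded:
  obtains C where "\<And>s. s \<in> {a..b} \<Longrightarrow> \<bar>beam_green \<sigma> l m w k s\<bar> \<le> C"
proof -
  have c: "continuous_on {a..b} (beam_left \<sigma> l m w k)" "continuous_on {a..b} (beam_right \<sigma> l m w k)"
    using beam_left_deriv beam_right_deriv by (meson DERIV_isCont continuous_at_imp_continuous_on)+
  obtain C1 where C1: "\<And>s. s \<in> {a..b} \<Longrightarrow> \<bar>beam_left \<sigma> l m w k s\<bar> \<le> C1" using cont_bounded_Icc[OF c(1)] by blast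
  obtain C2 where C2: "\<And>s. s \<in> {a..b} \<Longrightarrow> \<bar>beam_right \<sigma> l m w k s\<bar> \<le> C2" using cont_bounded_Icc[OF c(2)] by blast
  have "\<bar>beam_green \<sigma> l m w k s\<bar> \<le> max C1 C2" if "s \<in> {a..b}" for s
    using C1[OF that] C2[OF that] by (auto simp: beam_green_eq)
  then show ?thesis using that by blast
qed

lemma weak_deriv_props:
  assumes "u \<in> H2 S" "i + j \<le> 2"
  shows "weak_deriv S i j u \<in> L2 S" "has_weak_deriv S i j u (weak_deriv S i j u)"
proof -
  have "\<exists>g. g \<in> L2 S \<and> has_weak_deriv S i j u g" using assms by (auto simp: H2_def)
  from someI_ex[OF this] show "weak_deriv S i j u \<in> L2 S" "has_weak_deriv S i j u (weak_deriv S i j u)"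
    by (simp_all add: weak_deriv_def)
qed

lemma cont_on_fst_snd:
  assumes "continuous_on UNIV (f :: real \<Rightarrow> real)"
  shows "continuous_on X (\<lambda>p::real \<times> real. f (fst p))" "continuous_on X (\<lambda>p::real \<times> real. f (snd p))"
  by (rule continuous_on_compose2[OF assms], auto intro: continuous_intros)+

lemma smooth_cont: "\<forall>n. Dk n \<alpha> \<Longrightarrow> continuous_on UNIV ((deriv ^^ i) \<alpha>)"
  using smooth_iter[of \<alpha> i] by (metis Dk.simps(1))

text \<open>The case U = 0 of integration by parts: an identity known for compactly supported smooth
  tests in one coordinate extends to multipliers that are nonzero at the ends.\<close>

lemma annihilates_absolutely_continuous:
  fixes v Y :: "real \<times> real \<Rightarrow> real"
  assumes v: "integrable lborel v" and Y: "Y \<in> borel_measurable lborel" and ab: "a < b"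
    and supp: "\<And>p. v p \<noteq> 0 \<Longrightarrow> a < Y p \<and> Y p < b"
    and z: "\<And>\<alpha>. cc_smooth a b \<alpha> \<Longrightarrow> (\<integral>p. v p * \<alpha> (Y p) \<partial>lborel) = 0"
    and \<theta>: "\<theta> \<in> borel_measurable borel" "\<And>s. s \<in> {a..b} \<Longrightarrow> \<bar>\<theta> s\<bar> \<le> C"
    and k: "\<And>t. t \<in> {a..b} \<Longrightarrow> (\<theta> has_integral (k b - k t)) {t..b}"
  shows "(\<integral>p. v p * k (Y p) \<partial>lborel) = 0"
  using weak_deriv_by_parts[OF sigma_finite_lborel v Y ab _ _ _ \<theta> k, where U = "\<lambda>_. 0"] supp z
  by simp

section \<open>Second weak derivatives of u tested against modes\<close>

context
  fixes l :: real and u :: "real \<times> real \<Rightarrow> real" and m :: nat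
  assumes l: "l > 0" and u: "u \<in> H2star l" and m: "m \<ge> 1"
begin

definition uxx where "uxx = weak_deriv (Omega l) 2 0 u"
definition uxy where "uxy = weak_deriv (Omega l) 1 1 u"
definition uyy where "uyy = weak_deriv (Omega l) 0 2 u"
definition sine_coef where "sine_coef y = integral {0..pi} (\<lambda>x. u (x, y) * sin (real m * x))"

lemma u_weak:
  "uxx \<in> L2 (Omega l)" "has_weak_deriv (Omega l) 2 0 u uxx"
  "uxy \<in> L2 (Omega l)" "has_weak_deriv (Omega l) 1 1 u uxy"
  "uyy \<in> L2 (Omega l)" "has_weak_deriv (Omega l) 0 2 u uyy"
  using weak_deriv_props[of u "Omega l"] u by (auto simp: uxx_def uxy_def uyy_def H2star_def)

lemma u_int:
  "integrable lborel (\<lambda>p. indicator (Omega l) p * uxx p)"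
  "integrable lborel (\<lambda>p. indicator (Omega l) p * uxy p)"
  "integrable lborel (\<lambda>p. indicator (Omega l) p * uyy p)"
  "integrable lborel (\<lambda>p. indicator (Omega l) p * u p)"
  using u_weak u by (auto intro!: L2_integrable simp: H2star_def H2_def)

lemma u_cont: "continuous_on ({0..pi} \<times> {-l..l}) u"
  using u closure_Omega[OF l] by (simp add: H2star_def)

lemma u_zero: assumes "y \<in> {-l..l}" shows "u (0, y) = 0" "u (pi, y) = 0"
proof -
  have z: "u (x, y) = 0" if x: "x \<in> {0, pi}" for x
  proof (rule continuous_constant_on_closure[of "{-l<..<l}" "\<lambda>y. u (x, y)"])
    show "continuous_on (closure {-l<..<l}) (\<lambda>y. u (x, y))"
      by (rule continuous_on_compose2[OF u_cont]) (use l x in \<open>auto intro!: continuous_intros\<close>)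
    show "u (x, y) = 0" if "y \<in> {-l<..<l}" for y using u x that by (auto simp: H2star_def)
    show "y \<in> closure {-l<..<l}" using assms l by simp
  qed
  show "u (0, y) = 0" "u (pi, y) = 0" using z by auto
qed

lemma test_int:
  assumes f: "continuous_on UNIV f" and k: "continuous_on UNIV k"
  shows "(LINT p:Omega l|lborel. u p * (f (fst p) * k (snd p))) = integral {0..pi} (\<lambda>x. integral {-l..l} (\<lambda>y. u (x, y) * k y) * f x)"
    "(LINT p:Omega l|lborel. u p * (f (fst p) * k (snd p))) = integral {-l..l} (\<lambda>y. integral {0..pi} (\<lambda>x. u (x, y) * f x) * k y)"
proof -
  have c: "continuous_on ({0..pi} \<times> {-l..l}) (\<lambda>p. u p * (f (fst p) * k (snd p)))"
    by (intro continuous_on_mult u_cont cont_on_fst_snd f k)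
  show "(LINT p:Omega l|lborel. u p * (f (fst p) * k (snd p))) = integral {0..pi} (\<lambda>x. integral {-l..l} (\<lambda>y. u (x, y) * k y) * f x)"
    unfolding LINT_Omega_iterated(1)[OF c]
    by (simp add: mult_ac flip: integral_mult_right integral_mult_left)
  show "(LINT p:Omega l|lborel. u p * (f (fst p) * k (snd p))) = integral {-l..l} (\<lambda>y. integral {0..pi} (\<lambda>x. u (x, y) * f x) * k y)"
    unfolding LINT_Omega_iterated(2)[OF c]
    by (simp add: mult_ac flip: integral_mult_right integral_mult_left)
qed

lemma test_int_sine:
  assumes k: "continuous_on UNIV k"
  shows "(LINT p:Omega l|lborel. u p * (sin (real m * fst p) * k (snd p))) = integral {-l..l} (\<lambda>y. sine_coef y * k y)"
  unfolding sine_coef_def by (rule test_int(2)) (intro continuous_intros k)+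

lemma slice_cont:
  assumes "continuous_on UNIV k"
  shows "continuous_on {0..pi} (\<lambda>x. integral {-l..l} (\<lambda>y. u (x, y) * k y))"
    "continuous_on {-l..l} (\<lambda>y. integral {0..pi} (\<lambda>x. u (x, y) * k x))"
proof -
  have "continuous_on ({0..pi} \<times> cbox (-l) l) (\<lambda>(x, y). u (x, y) * k y)"
    using continuous_on_mult[OF u_cont cont_on_fst_snd(2)[OF assms]] by (simp add: case_prod_beta)
  from integral_continuous_on_param[OF this]
  show "continuous_on {0..pi} (\<lambda>x. integral {-l..l} (\<lambda>y. u (x, y) * k y))" by simp
  have "continuous_on ({-l..l} \<times> cbox 0 pi) (\<lambda>(y, x). u (x, y) * k x)"
    unfolding case_prod_beta
    by (intro continuous_on_mult cont_on_fst_snd assms continuous_on_compose2[OF u_cont])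
      (auto intro!: continuous_intros)
  from integral_continuous_on_param[OF this]
  show "continuous_on {-l..l} (\<lambda>y. integral {0..pi} (\<lambda>x. u (x, y) * k x))" by simp
qed

lemma sine_coef_cont: "continuous_on {-l..l} sine_coef"
  unfolding sine_coef_def by (rule slice_cont(2)) (intro continuous_intros)

lemma slice_zero: "integral {-l..l} (\<lambda>y. u (0, y) * k y) = 0" "integral {-l..l} (\<lambda>y. u (pi, y) * k y) = 0"
proof -
  have "integral {-l..l} (\<lambda>y. u (0, y) * k y) = integral {-l..l} (\<lambda>_. 0)"
    "integral {-l..l} (\<lambda>y. u (pi, y) * k y) = integral {-l..l} (\<lambda>_. 0)"
    by (rule integral_cong, simp add: u_zero)+
  then show "integral {-l..l} (\<lambda>y. u (0, y) * k y) = 0" "integral {-l..l} (\<lambda>y. u (pi, y) * k y) = 0" by simp_all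
qed

lemma Omega_supp: "indicator (Omega l) p * (r :: real) \<noteq> 0 \<Longrightarrow> 0 < fst p \<and> fst p < pi \<and> -l < snd p \<and> snd p < l"
  by (auto simp: Omega_def indicator_def split: if_splits)

lemma trig_derivs:
  "((\<lambda>x. sin (real m * x)) has_real_derivative real m * cos (real m * t)) (at t)"
  "((\<lambda>x. cos (real m * x)) has_real_derivative - real m * sin (real m * t)) (at t)"
  "((\<lambda>x. real m * cos (real m * x)) has_real_derivative - (real m)\<^sup>2 * sin (real m * t)) (at t)"
  by (auto intro!: derivative_eq_intros simp: power2_eq_square)

lemma trig_bounds: "\<bar>real m * cos x\<bar> \<le> real m" "\<bar>- real m * sin x\<bar> \<le> real m" "\<bar>- (real m)\<^sup>2 * sin x\<bar> \<le> (real m)\<^sup>2"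
  using m by (simp_all add: abs_mult)

lemma LINT_fst: "(LINT p:Omega l|lborel. F p :: real) = (\<integral>p. indicator (Omega l) p * F p \<partial>lborel)"
  by (simp add: set_lebesgue_integral_def)

text \<open>The x variable comes first, with a compactly supported \<beta> in y: the slice integrals
  V vanish at 0 and pi because u does, so no boundary term survives. The result says that a single
  density in the plane annihilates every \<beta>, hence also k.\<close>

lemma uxx_test:
  assumes k: "continuous_on UNIV k" and \<theta>: "\<theta> \<in> borel_measurable borel" "\<And>s. s \<in> {-l..l} \<Longrightarrow> \<bar>\<theta> s\<bar> \<le> C"
    and FTC: "\<And>t. t \<in> {-l..l} \<Longrightarrow> (\<theta> has_integral (k l - k t)) {t..l}"
  shows "(LINT p:Omega l|lborel. uxx p * (sin (real m * fst p) * k (snd p))) = - (real m)\<^sup>2 * integral {-l..l} (\<lambda>y. sine_coef y * k y)"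
proof -
  have sc: "continuous_on UNIV (\<lambda>x. sin (real m * x))" by (intro continuous_intros)
  have 1: "(LINT p:Omega l|lborel. uxx p * (sin (real m * fst p) * \<beta> (snd p)))
      = - (real m)\<^sup>2 * (LINT p:Omega l|lborel. u p * (sin (real m * fst p) * \<beta> (snd p)))" if \<beta>: "cc_smooth (-l) l \<beta>" for \<beta>
  proof -
    define v where "v = (\<lambda>p. indicator (Omega l) p * (uxx p * \<beta> (snd p)))"
    define V where "V = (\<lambda>x. integral {-l..l} (\<lambda>y. u (x, y) * \<beta> y))"
    have \<beta>c: "continuous_on UNIV \<beta>" using smooth_cont[OF cc_smoothD[OF \<beta>], of 0] by simp
    have "(\<integral>p. v p * sin (real m * fst p) \<partial>lborel)
       = real m * V 0 - (real m * cos (real m * pi)) * V pi + 0 * V 0 + integral {0..pi} (\<lambda>s. - (real m)\<^sup>2 * sin (real m * s) * V s)"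
    proof (rule weak_second_deriv_by_parts[OF sigma_finite_lborel, where a = 0 and b = pi and v = v and Y = fst
        and h = "\<lambda>x. sin (real m * x)" and U = V and \<theta> = "\<lambda>s. - (real m)\<^sup>2 * sin (real m * s)"
        and c = "real m" and d = "real m * cos (real m * pi)" and J = 0 and ?y0.0 = 0])
      show "integrable lborel v" unfolding v_def by (intro Omega_mult_integrable u_int cont_on_fst_snd \<beta>c)
      show "fst \<in> borel_measurable (lborel :: (real \<times> real) measure)" by (rule fst_snd_measurable)
      show "0 < fst p \<and> fst p < pi" if "v p \<noteq> 0" for p using Omega_supp that unfolding v_def by blast
      show "continuous_on {0..pi} V" unfolding V_def by (rule slice_cont(1)[OF \<beta>c])
      show "(\<integral>p. v p * \<alpha> (fst p) \<partial>lborel) = integral {0..pi} (\<lambda>t. V t * deriv (deriv \<alpha>) t)" if \<alpha>: "cc_smooth 0 pi \<alpha>" for \<alpha>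
      proof -
        have "(\<integral>p. v p * \<alpha> (fst p) \<partial>lborel) = (LINT p:Omega l|lborel. uxx p * (\<alpha> (fst p) * \<beta> (snd p)))"
          by (simp add: LINT_fst v_def mult_ac)
        also have "\<dots> = (LINT p:Omega l|lborel. u p * (deriv (deriv \<alpha>) (fst p) * \<beta> (snd p)))"
          using weak_deriv_test_separated[OF u_weak(2) \<alpha> \<beta>] by (simp add: numeral_2_eq_2)
        also have "\<dots> = integral {0..pi} (\<lambda>t. V t * deriv (deriv \<alpha>) t)"
          unfolding V_def using smooth_cont[OF cc_smoothD[OF \<alpha>], of 2] by (intro test_int(1) \<beta>c) (simp add: numeral_2_eq_2)
        finally show ?thesis .
      qed
      show "(\<lambda>s. - (real m)\<^sup>2 * sin (real m * s)) \<in> borel_measurable borel" by measurable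
      show "\<bar>- (real m)\<^sup>2 * sin (real m * s)\<bar> \<le> (real m)\<^sup>2" for s by (rule trig_bounds)
      show "((\<lambda>s. max 0 (t - s) * (- (real m)\<^sup>2 * sin (real m * s))) has_integral
          sin (real m * t) - real m * (t - 0) - 0 * max 0 (t - 0)) {0..pi}" if "t \<in> {0..pi}" for t
        using kink_taylor[OF trig_derivs(1) trig_derivs(1) trig_derivs(3) trig_derivs(3), of 0 0 pi t] that by simp
      show "((\<lambda>s. - (real m)\<^sup>2 * sin (real m * s)) has_integral real m * cos (real m * pi) - real m - 0) {0..pi}"
        using kink_has_integral[OF _ trig_derivs(3) trig_derivs(3), of 0 pi 0] by simp
    qed auto
    also have "\<dots> = - (real m)\<^sup>2 * integral {0..pi} (\<lambda>s. V s * sin (real m * s))"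
    proof -
      have "(\<lambda>s. - (real m)\<^sup>2 * sin (real m * s) * V s) = (\<lambda>s. - (real m)\<^sup>2 * (V s * sin (real m * s)))"
        by (simp add: fun_eq_iff)
      moreover have "V 0 = 0" "V pi = 0" by (simp_all only: V_def slice_zero)
      ultimately show ?thesis by (simp only: integral_mult_right mult_zero_right mult_zero_left diff_zero add_0_left add_0_right)
    qed
    also have "integral {0..pi} (\<lambda>s. V s * sin (real m * s)) = (LINT p:Omega l|lborel. u p * (sin (real m * fst p) * \<beta> (snd p)))"
      unfolding V_def by (rule test_int(1)[OF sc \<beta>c, symmetric])
    finally show ?thesis by (simp add: LINT_fst v_def mult_ac)
  qed
  define w where "w = (\<lambda>p. indicator (Omega l) p * (uxx p * sin (real m * fst p)) + (real m)\<^sup>2 * (indicator (Omega l) p * (u p * sin (real m * fst p))))"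
  have i: "integrable lborel (\<lambda>p. indicator (Omega l) p * (uxx p * (sin (real m * fst p) * k (snd p))))"
     "integrable lborel (\<lambda>p. indicator (Omega l) p * (u p * (sin (real m * fst p) * k (snd p))))" if "continuous_on UNIV k" for k
    by (intro Omega_mult_integrable u_int continuous_on_mult cont_on_fst_snd[OF sc] cont_on_fst_snd[OF that])+
  have wk: "(\<integral>p. w p * k (snd p) \<partial>lborel) = (LINT p:Omega l|lborel. uxx p * (sin (real m * fst p) * k (snd p)))
      + (real m)\<^sup>2 * (LINT p:Omega l|lborel. u p * (sin (real m * fst p) * k (snd p)))" if "continuous_on UNIV k" for k
  proof -
    have "(\<integral>p. w p * k (snd p) \<partial>lborel) = (\<integral>p. indicator (Omega l) p * (uxx p * (sin (real m * fst p) * k (snd p)))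
       + (real m)\<^sup>2 * (indicator (Omega l) p * (u p * (sin (real m * fst p) * k (snd p)))) \<partial>lborel)"
      by (simp add: w_def algebra_simps)
    also have "\<dots> = (LINT p:Omega l|lborel. uxx p * (sin (real m * fst p) * k (snd p)))
      + (real m)\<^sup>2 * (LINT p:Omega l|lborel. u p * (sin (real m * fst p) * k (snd p)))"
      unfolding LINT_fst using i[OF that] by (subst Bochner_Integration.integral_add) auto
    finally show ?thesis .
  qed
  have "(\<integral>p. w p * k (snd p) \<partial>lborel) = 0"
  proof (rule annihilates_absolutely_continuous[where a = "-l" and b = l and v = w and Y = snd, OF _ fst_snd_measurable(2) _ _ _ \<theta> FTC])
    show "integrable lborel w" unfolding w_def using i[of "\<lambda>_. 1"] by simp
    show "-l < l" using l by simp
    show "-l < snd p \<and> snd p < l" if "w p \<noteq> 0" for p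
      using that by (cases "p \<in> Omega l") (auto simp: w_def Omega_def)
    show "(\<integral>p. w p * \<beta> (snd p) \<partial>lborel) = 0" if \<beta>: "cc_smooth (-l) l \<beta>" for \<beta>
      using wk[of \<beta>] 1[OF \<beta>] smooth_cont[OF cc_smoothD[OF \<beta>], of 0] by simp
  qed
  then show ?thesis using wk[OF k] test_int_sine[OF k] by simp
qed

text \<open>In x the cosine is nonzero at 0 and pi, but the slice integrals vanish there. In y the
  end values of \<open>sine_coef\<close> remain; they cancel later against those produced by
  u_yy.\<close>

lemma uxy_test:
  assumes \<theta>: "\<theta> \<in> borel_measurable borel" "\<And>s. s \<in> {-l..l} \<Longrightarrow> \<bar>\<theta> s\<bar> \<le> C"
    and FTC: "\<And>t. t \<in> {-l..l} \<Longrightarrow> (\<theta> has_integral (k l - k t)) {t..l}"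
  shows "(LINT p:Omega l|lborel. uxy p * (cos (real m * fst p) * k (snd p)))
    = real m * (k l * sine_coef l - k (-l) * sine_coef (-l) - integral {-l..l} (\<lambda>s. \<theta> s * sine_coef s))"
proof -
  have 1: "(LINT p:Omega l|lborel. uxy p * (cos (real m * fst p) * \<beta> (snd p)))
      = - (real m * integral {-l..l} (\<lambda>y. sine_coef y * deriv \<beta> y))" if \<beta>: "cc_smooth (-l) l \<beta>" for \<beta>
  proof -
    define v where "v = (\<lambda>p. indicator (Omega l) p * (uxy p * \<beta> (snd p)))"
    define V where "V = (\<lambda>x. - integral {-l..l} (\<lambda>y. u (x, y) * deriv \<beta> y))"
    have \<beta>c: "continuous_on UNIV \<beta>" "continuous_on UNIV (deriv \<beta>)"
      using smooth_cont[OF cc_smoothD[OF \<beta>], of 0] smooth_cont[OF cc_smoothD[OF \<beta>], of 1] by simp_all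
    have "(\<integral>p. v p * cos (real m * fst p) \<partial>lborel)
       = cos (real m * pi) * V pi - cos (real m * 0) * V 0 - integral {0..pi} (\<lambda>s. - real m * sin (real m * s) * V s)"
    proof (rule weak_deriv_by_parts[OF sigma_finite_lborel, where a = 0 and b = pi and v = v and Y = fst
        and k = "\<lambda>x. cos (real m * x)" and U = V and \<theta> = "\<lambda>s. - real m * sin (real m * s)"])
      show "integrable lborel v" unfolding v_def by (intro Omega_mult_integrable u_int cont_on_fst_snd \<beta>c)
      show "fst \<in> borel_measurable (lborel :: (real \<times> real) measure)" by (rule fst_snd_measurable)
      show "0 < fst p \<and> fst p < pi" if "v p \<noteq> 0" for p using Omega_supp that unfolding v_def by blast
      show "continuous_on {0..pi} V" unfolding V_def by (intro continuous_on_minus slice_cont(1) \<beta>c)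
      show "(\<integral>p. v p * \<alpha> (fst p) \<partial>lborel) = - integral {0..pi} (\<lambda>t. V t * deriv \<alpha> t)" if \<alpha>: "cc_smooth 0 pi \<alpha>" for \<alpha>
      proof -
        have "(\<integral>p. v p * \<alpha> (fst p) \<partial>lborel) = (LINT p:Omega l|lborel. uxy p * (\<alpha> (fst p) * \<beta> (snd p)))"
          by (simp add: LINT_fst v_def mult_ac)
        also have "\<dots> = (LINT p:Omega l|lborel. u p * (deriv \<alpha> (fst p) * deriv \<beta> (snd p)))"
          using weak_deriv_test_separated[OF u_weak(4) \<alpha> \<beta>] by simp
        also have "\<dots> = integral {0..pi} (\<lambda>t. integral {-l..l} (\<lambda>y. u (t, y) * deriv \<beta> y) * deriv \<alpha> t)"
          using smooth_cont[OF cc_smoothD[OF \<alpha>], of 1] by (intro test_int(1) \<beta>c) simp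
        finally show ?thesis by (simp add: V_def)
      qed
      show "(\<lambda>s. - real m * sin (real m * s)) \<in> borel_measurable borel" by measurable
      show "\<bar>- real m * sin (real m * s)\<bar> \<le> real m" for s by (rule trig_bounds)
      show "((\<lambda>s. - real m * sin (real m * s)) has_integral cos (real m * pi) - cos (real m * t)) {t..pi}" if "t \<in> {0..pi}" for t
        using kink_has_integral[OF _ trig_derivs(2) trig_derivs(2), of t pi 0] that by simp
    qed auto
    also have "\<dots> = - (real m * integral {0..pi} (\<lambda>s. integral {-l..l} (\<lambda>y. u (s, y) * deriv \<beta> y) * sin (real m * s)))"
      unfolding V_def slice_zero by (simp add: mult_ac)
    also have "integral {0..pi} (\<lambda>s. integral {-l..l} (\<lambda>y. u (s, y) * deriv \<beta> y) * sin (real m * s))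
       = (LINT p:Omega l|lborel. u p * (sin (real m * fst p) * deriv \<beta> (snd p)))"
      by (rule test_int(1)[symmetric]) (intro continuous_intros \<beta>c)+
    also have "\<dots> = integral {-l..l} (\<lambda>y. sine_coef y * deriv \<beta> y)" by (rule test_int_sine[OF \<beta>c(2)])
    finally show ?thesis by (simp add: LINT_fst v_def mult_ac)
  qed
  define v where "v = (\<lambda>p. indicator (Omega l) p * (uxy p * cos (real m * fst p)))"
  have "(\<integral>p. v p * k (snd p) \<partial>lborel) = k l * (real m * sine_coef l) - k (-l) * (real m * sine_coef (-l))
     - integral {-l..l} (\<lambda>s. \<theta> s * (real m * sine_coef s))"
  proof (rule weak_deriv_by_parts[where v = v and Y = snd and U = "\<lambda>y. real m * sine_coef y",
        OF sigma_finite_lborel _ fst_snd_measurable(2) _ _ _ _ \<theta> FTC])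
    show "integrable lborel v" unfolding v_def by (intro Omega_mult_integrable u_int continuous_intros)
    show "-l < l" using l by simp
    show "-l < snd p \<and> snd p < l" if "v p \<noteq> 0" for p using Omega_supp that unfolding v_def by blast
    show "continuous_on {-l..l} (\<lambda>y. real m * sine_coef y)" by (intro continuous_intros sine_coef_cont)
    show "(\<integral>p. v p * \<beta> (snd p) \<partial>lborel) = - integral {-l..l} (\<lambda>t. real m * sine_coef t * deriv \<beta> t)"
      if \<beta>: "cc_smooth (-l) l \<beta>" for \<beta>
      using 1[OF \<beta>] by (simp add: LINT_fst v_def mult_ac)
  qed auto
  then show ?thesis by (simp add: LINT_fst v_def algebra_simps)
qed

text \<open>First sin (m x) replaces the compactly supported factor in x by annihilation, then two
  integrations by parts in y act on \<open>sine_coef\<close>. The formula for h at t = -l gives h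
  (-l) = 0, so together with h l = 0 no derivative of u on the edges y = -l, l is involved.\<close>

lemma uyy_test:
  assumes \<theta>: "\<theta> \<in> borel_measurable borel" "\<And>s. s \<in> {-l..l} \<Longrightarrow> \<bar>\<theta> s\<bar> \<le> C"
    and h: "\<And>t. t \<in> {-l..l} \<Longrightarrow> ((\<lambda>s. max 0 (t - s) * \<theta> s) has_integral (h t - c * (t - (-l)) - J * max 0 (t - y0))) {-l..l}"
    and hb: "h l = 0" and y0: "y0 \<in> {-l..l}" and d: "(\<theta> has_integral (d - c - J)) {-l..l}"
  shows "(LINT p:Omega l|lborel. uyy p * (sin (real m * fst p) * h (snd p)))
    = c * sine_coef (-l) - d * sine_coef l + J * sine_coef y0 + integral {-l..l} (\<lambda>s. \<theta> s * sine_coef s)"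
proof -
  have 1: "(LINT p:Omega l|lborel. uyy p * (sin (real m * fst p) * \<beta> (snd p)))
      = integral {-l..l} (\<lambda>y. sine_coef y * deriv (deriv \<beta>) y)" if \<beta>: "cc_smooth (-l) l \<beta>" for \<beta>
  proof -
    have \<beta>c: "continuous_on UNIV \<beta>" "continuous_on UNIV (deriv (deriv \<beta>))"
      using smooth_cont[OF cc_smoothD[OF \<beta>], of 0] smooth_cont[OF cc_smoothD[OF \<beta>], of 2] by (simp_all add: numeral_2_eq_2)
    define v where "v = (\<lambda>p. indicator (Omega l) p * (uyy p * \<beta> (snd p)) - indicator (Omega l) p * (u p * deriv (deriv \<beta>) (snd p)))"
    have i: "integrable lborel (\<lambda>p. indicator (Omega l) p * (uyy p * (f (fst p) * \<beta> (snd p))))"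
      "integrable lborel (\<lambda>p. indicator (Omega l) p * (u p * (f (fst p) * deriv (deriv \<beta>) (snd p))))" if "continuous_on UNIV f" for f
      by (intro Omega_mult_integrable u_int continuous_on_mult cont_on_fst_snd \<beta>c that)+
    have vf: "(\<integral>p. v p * f (fst p) \<partial>lborel) = (LINT p:Omega l|lborel. uyy p * (f (fst p) * \<beta> (snd p)))
       - (LINT p:Omega l|lborel. u p * (f (fst p) * deriv (deriv \<beta>) (snd p)))" if "continuous_on UNIV f" for f
    proof -
      have "(\<integral>p. v p * f (fst p) \<partial>lborel) = (\<integral>p. indicator (Omega l) p * (uyy p * (f (fst p) * \<beta> (snd p)))
         - indicator (Omega l) p * (u p * (f (fst p) * deriv (deriv \<beta>) (snd p))) \<partial>lborel)"
        by (simp add: v_def algebra_simps)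
      also have "\<dots> = (LINT p:Omega l|lborel. uyy p * (f (fst p) * \<beta> (snd p)))
       - (LINT p:Omega l|lborel. u p * (f (fst p) * deriv (deriv \<beta>) (snd p)))"
        unfolding LINT_fst by (rule Bochner_Integration.integral_diff) (rule i[OF that])+
      finally show ?thesis .
    qed
    have "(\<integral>p. v p * sin (real m * fst p) \<partial>lborel) = 0"
    proof (rule annihilates_absolutely_continuous[where a = 0 and b = pi and v = v and Y = fst
        and k = "\<lambda>x. sin (real m * x)" and \<theta> = "\<lambda>s. real m * cos (real m * s)", OF _ fst_snd_measurable(1)])
      show "integrable lborel v" unfolding v_def using i[of "\<lambda>_. 1"] by simp
      show "0 < fst p \<and> fst p < pi" if "v p \<noteq> 0" for p
        using that by (cases "p \<in> Omega l") (auto simp: v_def Omega_def)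
      show "(\<integral>p. v p * \<alpha> (fst p) \<partial>lborel) = 0" if \<alpha>: "cc_smooth 0 pi \<alpha>" for \<alpha>
        using vf[of \<alpha>] smooth_cont[OF cc_smoothD[OF \<alpha>], of 0] weak_deriv_test_separated[OF u_weak(6) \<alpha> \<beta>]
        by (simp add: numeral_2_eq_2)
      show "(\<lambda>s. real m * cos (real m * s)) \<in> borel_measurable borel" by measurable
      show "\<bar>real m * cos (real m * s)\<bar> \<le> real m" for s by (rule trig_bounds)
      show "((\<lambda>s. real m * cos (real m * s)) has_integral sin (real m * pi) - sin (real m * t)) {t..pi}" if "t \<in> {0..pi}" for t
        using kink_has_integral[OF _ trig_derivs(1) trig_derivs(1), of t pi 0] that by simp
    qed auto
    moreover have "continuous_on UNIV (\<lambda>x. sin (real m * x))" by (intro continuous_intros)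
    ultimately show ?thesis using vf[of "\<lambda>x. sin (real m * x)"] test_int_sine[OF \<beta>c(2)] by simp
  qed
  define v where "v = (\<lambda>p. indicator (Omega l) p * (uyy p * sin (real m * fst p)))"
  have "(\<integral>p. v p * h (snd p) \<partial>lborel) = c * sine_coef (-l) - d * sine_coef l + J * sine_coef y0 + integral {-l..l} (\<lambda>s. \<theta> s * sine_coef s)"
  proof (rule weak_second_deriv_by_parts[where v = v and Y = snd, OF sigma_finite_lborel _ fst_snd_measurable(2) _ _ sine_coef_cont _ \<theta> h hb y0 d])
    show "integrable lborel v" unfolding v_def by (intro Omega_mult_integrable u_int continuous_intros)
    show "-l < l" using l by simp
    show "-l < snd p \<and> snd p < l" if "v p \<noteq> 0" for p using Omega_supp that unfolding v_def by blast
    show "(\<integral>p. v p * \<beta> (snd p) \<partial>lborel) = integral {-l..l} (\<lambda>t. sine_coef t * deriv (deriv \<beta>) t)"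
      if \<beta>: "cc_smooth (-l) l \<beta>" for \<beta>
      using 1[OF \<beta>] by (simp add: LINT_fst v_def mult_ac)
  qed auto
  then show ?thesis by (simp add: LINT_fst v_def mult_ac)
qed

end

section \<open>The products sin (m x) g_m(y) as elements of the energy space\<close>

definition sine_mode :: "nat \<Rightarrow> nat \<Rightarrow> real \<Rightarrow> real" where
  "sine_mode m k x = (if k = 0 then sin (real m * x) else if k = 1 then real m * cos (real m * x)
     else - (real m)\<^sup>2 * sin (real m * x))"

lemma sine_mode_deriv: "k < 2 \<Longrightarrow> (sine_mode m k has_real_derivative sine_mode m (Suc k) x) (at x)"
  by (cases k) (auto simp: sine_mode_def[abs_def] power2_eq_square intro!: derivative_eq_intros)

lemma sine_mode_cont: "continuous_on S (sine_mode m k)"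
  unfolding sine_mode_def[abs_def] by (cases "k = 0"; cases "k = 1") (auto intro!: continuous_intros)

definition mode_test :: "real \<Rightarrow> real \<Rightarrow> nat \<Rightarrow> real \<Rightarrow> real \<times> real \<Rightarrow> real" where
  "mode_test \<sigma> l m w = (\<lambda>(x, y). sine_mode m 0 x * beam_green \<sigma> l (real m) w 0 y)"

lemma mode_test_weak:
  assumes "l > 0" "i + j \<le> 2"
  shows "(\<lambda>(x, y). sine_mode m i x * beam_green \<sigma> l (real m) w j y) \<in> L2 (Omega l)"
    "has_weak_deriv (Omega l) i j (mode_test \<sigma> l m w) (\<lambda>(x, y). sine_mode m i x * beam_green \<sigma> l (real m) w j y)"
proof -
  have "j \<le> 2" using assms by simp
  then show "(\<lambda>(x, y). sine_mode m i x * beam_green \<sigma> l (real m) w j y) \<in> L2 (Omega l)"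
    unfolding case_prod_beta
    by (intro cont_in_L2 continuous_on_mult cont_on_fst_snd sine_mode_cont beam_green_cont)
  show "has_weak_deriv (Omega l) i j (mode_test \<sigma> l m w) (\<lambda>(x, y). sine_mode m i x * beam_green \<sigma> l (real m) w j y)"
    unfolding mode_test_def
    by (rule separated_has_weak_deriv[OF assms(1)]) (use assms in \<open>auto intro: sine_mode_deriv sine_mode_cont beam_green_deriv beam_green_cont\<close>)
qed

lemma mode_test_H2star:
  assumes "l > 0"
  shows "mode_test \<sigma> l m w \<in> H2star l"
proof -
  have "mode_test \<sigma> l m w \<in> L2 (Omega l)" using mode_test_weak(1)[OF assms, of 0 0] by (simp add: mode_test_def)
  moreover have "\<exists>g\<in>L2 (Omega l). has_weak_deriv (Omega l) i j (mode_test \<sigma> l m w) g" if "i + j \<le> 2" for i j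
    using mode_test_weak[OF assms that] by blast
  moreover have "continuous_on (closure (Omega l)) (mode_test \<sigma> l m w)"
    unfolding mode_test_def case_prod_beta by (intro continuous_on_mult cont_on_fst_snd sine_mode_cont beam_green_cont) simp
  moreover have "mode_test \<sigma> l m w p = 0" if "p \<in> {0, pi} \<times> {-l<..<l}" for p
    using that by (auto simp: mode_test_def sine_mode_def)
  ultimately show ?thesis by (auto simp: H2star_def H2_def)
qed

lemma mode_test_AE:
  assumes "l > 0" "i + j \<le> 2"
  shows "AE p in lborel. p \<in> Omega l \<longrightarrow>
    weak_deriv (Omega l) i j (mode_test \<sigma> l m w) p = sine_mode m i (fst p) * beam_green \<sigma> l (real m) w j (snd p)"
proof -
  have "mode_test \<sigma> l m w \<in> H2 (Omega l)" using mode_test_H2star[OF assms(1)] by (simp add: H2star_def)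
  from weak_deriv_unique_AE[OF assms(1) weak_deriv_props[OF this assms(2)] mode_test_weak[OF assms]]
  show ?thesis by (simp add: case_prod_beta)
qed

text \<open>All derivatives are moved to the test function; its fourth order equation, the natural
  boundary conditions and the unit jump of its third derivative leave only the point value at \<open>w\<close>.\<close>
lemma inner_mode_test:
  assumes par: "0 \<le> \<sigma>" "\<sigma> < 1" and l: "l > 0" and u: "u \<in> H2star l" and m: "m \<ge> 1" and w: "w \<in> {-l..l}"
  shows "H2star_inner l \<sigma> u (mode_test \<sigma> l m w) = sine_coef u m w"
proof -
  define g where "g = beam_green \<sigma> l (real m) w"
  define M where "M = (real m)\<^sup>2"
  define U where "U = sine_coef u m"
  have m0: "real m > 0" using m by simp
  have gc: "continuous_on S (g k)" if "k \<le> 2" for k S unfolding g_def by (rule beam_green_cont[OF that])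
  have gI: "(g (Suc k) has_integral (g k l - g k t)) {t..l}" if "k \<le> 2" "t \<in> {-l..l}" for k t
    unfolding g_def by (rule beam_has_integral) (use that in auto)
  have gm: "g k \<in> borel_measurable borel" for k unfolding g_def by (rule beam_measurable)
  obtain C1 where C1: "\<And>s. s \<in> {-l..l} \<Longrightarrow> \<bar>g 1 s\<bar> \<le> C1" unfolding g_def using beam_bounded by blast
  obtain C2 where C2: "\<And>s. s \<in> {-l..l} \<Longrightarrow> \<bar>g 2 s\<bar> \<le> C2" unfolding g_def using beam_bounded by blast
  obtain C3 where C3: "\<And>s. s \<in> {-l..l} \<Longrightarrow> \<bar>g 3 s\<bar> \<le> C3" unfolding g_def using beam_bounded by blast
  have Uc: "continuous_on {-l..l} U" unfolding U_def by (rule sine_coef_cont[OF l u m])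
  \<comment> \<open>The scalar product with v = \<open>mode_test\<close> is sorted by derivatives of
    u: u_xx meets v_xx + \<sigma> v_yy = sin (m x) K and u_yy meets v_yy + \<sigma> v_xx = sin (m x)
    h. The natural boundary condition says that h vanishes at both ends.\<close>
  define K where "K = (\<lambda>y. \<sigma> * g 2 y - M * g 0 y)"
  define h where "h = (\<lambda>y. g 2 y - \<sigma> * M * g 0 y)"
  have xx: "(LINT p:Omega l|lborel. uxx l u p * (sin (real m * fst p) * K (snd p))) = - M * integral {-l..l} (\<lambda>y. U y * K y)"
    unfolding M_def U_def
  proof (rule uxx_test[OF l u m, where \<theta> = "\<lambda>s. \<sigma> * g 3 s - M * g 1 s" and C = "\<bar>\<sigma>\<bar> * C3 + \<bar>M\<bar> * C1"])
    show "continuous_on UNIV K" unfolding K_def by (intro continuous_intros gc) auto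
    show "(\<lambda>s. \<sigma> * g 3 s - M * g 1 s) \<in> borel_measurable borel" using gm[of 3] gm[of 1] by measurable
    show "\<bar>\<sigma> * g 3 s - M * g 1 s\<bar> \<le> \<bar>\<sigma>\<bar> * C3 + \<bar>M\<bar> * C1" if "s \<in> {-l..l}" for s
    proof -
      have "\<bar>\<sigma> * g 3 s\<bar> \<le> \<bar>\<sigma>\<bar> * C3" "\<bar>M * g 1 s\<bar> \<le> \<bar>M\<bar> * C1"
        unfolding abs_mult using C1[OF that] C3[OF that] by (auto intro!: mult_left_mono)
      then show ?thesis by linarith
    qed
    fix t assume t: "t \<in> {-l..l}"
    have "((\<lambda>s. \<sigma> * g 3 s - M * g 1 s) has_integral \<sigma> * (g 2 l - g 2 t) - M * (g 0 l - g 0 t)) {t..l}"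
      using gI[OF _ t, of 2] gI[OF _ t, of 0] by (intro has_integral_diff has_integral_mult_right) (simp_all add: eval_nat_numeral)
    then show "((\<lambda>s. \<sigma> * g 3 s - M * g 1 s) has_integral K l - K t) {t..l}" by (simp add: K_def algebra_simps)
  qed
  have xy: "(LINT p:Omega l|lborel. uxy l u p * (cos (real m * fst p) * g 1 (snd p)))
      = real m * (g 1 l * U l - g 1 (-l) * U (-l) - integral {-l..l} (\<lambda>s. g 2 s * U s))"
    unfolding U_def using gI[of 1] gm[of 2] C2
    by (intro uxy_test[OF l u m, where C = C2]) (auto simp: numeral_2_eq_2)
  \<comment> \<open>\<open>\<theta>\<close> is h'' with the fourth derivative eliminated by the
    differential equation; in this form it is continuous across w.\<close>
  define \<theta> where "\<theta> = (\<lambda>s. 2 * M * g 2 s - M\<^sup>2 * g 0 s - \<sigma> * M * g 2 s)"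
  define hl where "hl = (\<lambda>y. beam_left \<sigma> l (real m) w 2 y - \<sigma> * M * beam_left \<sigma> l (real m) w 0 y)"
  define hr where "hr = (\<lambda>y. beam_right \<sigma> l (real m) w 2 y - \<sigma> * M * beam_right \<sigma> l (real m) w 0 y)"
  define hl' where "hl' = (\<lambda>y. beam_left \<sigma> l (real m) w 3 y - \<sigma> * M * beam_left \<sigma> l (real m) w 1 y)"
  define hr' where "hr' = (\<lambda>y. beam_right \<sigma> l (real m) w 3 y - \<sigma> * M * beam_right \<sigma> l (real m) w 1 y)"
  define hl'' where "hl'' = (\<lambda>y. beam_left \<sigma> l (real m) w 4 y - \<sigma> * M * beam_left \<sigma> l (real m) w 2 y)"
  define hr'' where "hr'' = (\<lambda>y. beam_right \<sigma> l (real m) w 4 y - \<sigma> * M * beam_right \<sigma> l (real m) w 2 y)"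
  have dL: "(beam_left \<sigma> l (real m) w 0 has_real_derivative beam_left \<sigma> l (real m) w 1 t) (at t)"
    "(beam_left \<sigma> l (real m) w 1 has_real_derivative beam_left \<sigma> l (real m) w 2 t) (at t)"
    "(beam_left \<sigma> l (real m) w 2 has_real_derivative beam_left \<sigma> l (real m) w 3 t) (at t)"
    "(beam_left \<sigma> l (real m) w 3 has_real_derivative beam_left \<sigma> l (real m) w 4 t) (at t)" for t
    using beam_left_deriv[of \<sigma> l "real m" w 0 t] beam_left_deriv[of \<sigma> l "real m" w 1 t]
      beam_left_deriv[of \<sigma> l "real m" w 2 t] beam_left_deriv[of \<sigma> l "real m" w 3 t] by (simp_all add: eval_nat_numeral)
  have dR: "(beam_right \<sigma> l (real m) w 0 has_real_derivative beam_right \<sigma> l (real m) w 1 t) (at t)"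
    "(beam_right \<sigma> l (real m) w 1 has_real_derivative beam_right \<sigma> l (real m) w 2 t) (at t)"
    "(beam_right \<sigma> l (real m) w 2 has_real_derivative beam_right \<sigma> l (real m) w 3 t) (at t)"
    "(beam_right \<sigma> l (real m) w 3 has_real_derivative beam_right \<sigma> l (real m) w 4 t) (at t)" for t
    using beam_right_deriv[of \<sigma> l "real m" w 0 t] beam_right_deriv[of \<sigma> l "real m" w 1 t]
      beam_right_deriv[of \<sigma> l "real m" w 2 t] beam_right_deriv[of \<sigma> l "real m" w 3 t] by (simp_all add: eval_nat_numeral)
  have d: "(hl has_real_derivative hl' t) (at t)" "(hr has_real_derivative hr' t) (at t)"
    "(hl' has_real_derivative hl'' t) (at t)" "(hr' has_real_derivative hr'' t) (at t)" for t
    unfolding hl_def hl'_def hl''_def hr_def hr'_def hr''_def by (intro DERIV_diff DERIV_cmult dL dR)+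
  have hw: "hl w = hr w" using beam_agree[of 0 \<sigma> l "real m" w] beam_agree[of 2 \<sigma> l "real m" w] by (simp add: hl_def hr_def)
  have jump: "hr' w - hl' w = 1"
    using beam_jump[OF m0, of \<sigma> l w] beam_agree[of 1 \<sigma> l "real m" w] by (simp add: hl'_def hr'_def)
  have hh: "h t = (if t \<le> w then hl t else hr t)" for t
    by (simp add: h_def hl_def hr_def g_def beam_green_eq)
  have M4: "M\<^sup>2 = real m ^ 4" by (simp add: M_def flip: power_mult)
  have \<theta>\<theta>: "(if s \<le> w then hl'' s else hr'' s) = \<theta> s" for s
    unfolding \<theta>_def hl''_def hr''_def beam_left_ode[OF m0] beam_right_ode[OF m0] M4 by (simp add: g_def beam_green_eq M_def)
  have ends: "h l = 0" "hl (-l) = 0" "hr' l = 2 * (1 - \<sigma>) * M * g 1 l" "hl' (-l) = 2 * (1 - \<sigma>) * M * g 1 (-l)"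
  proof -
    have gl: "g 0 l = beam_right \<sigma> l (real m) w 0 l" "g 1 l = beam_right \<sigma> l (real m) w 1 l" "g 2 l = beam_right \<sigma> l (real m) w 2 l"
      "g 1 (-l) = beam_left \<sigma> l (real m) w 1 (-l)"
      using w beam_green_right[of w l] beam_green_left[of "-l" w] by (simp_all add: g_def)
    note bc = beam_bc[OF par l m0, of w, folded M_def]
    show "h l = 0" "hl (-l) = 0" by (simp_all add: h_def hl_def gl bc)
    show "hr' l = 2 * (1 - \<sigma>) * M * g 1 l" "hl' (-l) = 2 * (1 - \<sigma>) * M * g 1 (-l)"
      unfolding hr'_def hl'_def gl bc by (simp_all add: algebra_simps)
  qed
  have \<theta>c: "continuous_on S \<theta>" for S unfolding \<theta>_def by (intro continuous_intros gc) auto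
  obtain C where C: "\<And>s. s \<in> {-l..l} \<Longrightarrow> \<bar>\<theta> s\<bar> \<le> C" using cont_bounded_Icc[OF \<theta>c] by blast
  have yy: "(LINT p:Omega l|lborel. uyy l u p * (sin (real m * fst p) * h (snd p)))
     = hl' (-l) * U (-l) - hr' l * U l + 1 * U w + integral {-l..l} (\<lambda>s. \<theta> s * U s)"
    unfolding U_def
  proof (rule uyy_test[where h = h and J = 1 and c = "hl' (-l)" and d = "hr' l", OF l u m _ C _ ends(1) w])
    show "\<theta> \<in> borel_measurable borel" using \<theta>c by (intro borel_measurable_continuous_onI)
    show "((\<lambda>s. max 0 (t - s) * \<theta> s) has_integral h t - hl' (- l) * (t - - l) - 1 * max 0 (t - w)) {- l..l}" if "t \<in> {-l..l}" for t
      using kink_taylor[OF d hw w that] unfolding \<theta>\<theta> hh[symmetric] jump ends(2) by simp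
    show "(\<theta> has_integral hr' l - hl' (- l) - 1) {- l..l}"
    proof -
      \<comment> \<open>h' jumps by 1 at w. Subtracting 1 from the right branch restores continuity,
        and this is the J = 1 required by \<open>uyy_test\<close>.\<close>
      have "((\<lambda>s. if s \<le> w then hl'' s else hr'' s) has_integral
        ((if l \<le> w then hl' l else hr' l - 1) - (if - l \<le> w then hl' (- l) else hr' (- l) - 1))) {- l..l}"
        by (rule kink_has_integral[where hl = hl' and hr = "\<lambda>s. hr' s - 1"])
          (use l d jump in \<open>auto intro!: derivative_eq_intros\<close>)
      moreover have "(if l \<le> w then hl' l else hr' l - 1) = hr' l - 1"
        using w jump by (auto simp: order_antisym_conv)
      ultimately show ?thesis unfolding \<theta>\<theta> using w by (simp add: algebra_simps)
    qed
  qed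
  note ui = u_int[OF l u m]
  have Kc: "continuous_on UNIV (\<lambda>p. sin (real m * fst p) * K (snd p))"
    "continuous_on UNIV (\<lambda>p. sin (real m * fst p) * h (snd p))"
    "continuous_on UNIV (\<lambda>p. cos (real m * fst p) * g 1 (snd p))"
  proof -
    have s: "continuous_on UNIV (\<lambda>x. sin (real m * x))" "continuous_on UNIV (\<lambda>x. cos (real m * x))" by (intro continuous_intros)+
    have k: "continuous_on UNIV K" "continuous_on UNIV h" "continuous_on UNIV (g 1)"
      unfolding K_def h_def by (intro continuous_intros gc; simp)+
    show "continuous_on UNIV (\<lambda>p. sin (real m * fst p) * K (snd p))"
    "continuous_on UNIV (\<lambda>p. sin (real m * fst p) * h (snd p))"
    "continuous_on UNIV (\<lambda>p. cos (real m * fst p) * g 1 (snd p))"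
      by (intro continuous_on_mult cont_on_fst_snd[OF s(1)] cont_on_fst_snd[OF s(2)] cont_on_fst_snd[OF k(1)]
        cont_on_fst_snd[OF k(2)] cont_on_fst_snd[OF k(3)])+
  qed
  define I1 where "I1 = (\<lambda>p. indicator (Omega l) p * (uxx l u p * (sin (real m * fst p) * K (snd p))))"
  define I2 where "I2 = (\<lambda>p. indicator (Omega l) p * (uyy l u p * (sin (real m * fst p) * h (snd p))))"
  define I3 where "I3 = (\<lambda>p. indicator (Omega l) p * (uxy l u p * (cos (real m * fst p) * g 1 (snd p))))"
  have I: "integrable lborel I1" "integrable lborel I2" "integrable lborel I3"
    unfolding I1_def I2_def I3_def by (intro Omega_mult_integrable ui Kc)+
  have "H2star_inner l \<sigma> u (mode_test \<sigma> l m w) = (\<integral>p. I1 p + I2 p + 2 * (1 - \<sigma>) * real m * I3 p \<partial>lborel)"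
    unfolding H2star_inner_def Let_def set_lebesgue_integral_def
  proof (rule integral_cong_AE)
    let ?D = "\<lambda>i j. weak_deriv (Omega l) i j (mode_test \<sigma> l m w)"
    let ?E = "\<lambda>i j. weak_deriv (Omega l) i j u"
    have H: "mode_test \<sigma> l m w \<in> H2 (Omega l)" "u \<in> H2 (Omega l)"
      using mode_test_H2star[OF l] u by (simp_all add: H2star_def)
    have [measurable]: "(\<lambda>p. indicator (Omega l) p * weak_deriv (Omega l) i j f p) \<in> borel_measurable lborel"
      if "i + j \<le> 2" "f \<in> H2 (Omega l)" for i j f
      using weak_deriv_props(1)[OF that(2,1)] by (simp add: L2_def set_borel_measurable_def)
    have le: "2 + 0 \<le> (2::nat)" "1 + 1 \<le> (2::nat)" "0 + 2 \<le> (2::nat)" by simp_all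
    \<comment> \<open>Weak derivatives are known to be measurable on the rectangle only, so every
      factor is cut off before the integrand is assembled.\<close>
    define P where "P = (\<lambda>i j p. indicator (Omega l) p * ?D i j p)"
    define R where "R = (\<lambda>i j p. indicator (Omega l) p * ?E i j p)"
    have PR: "P i j \<in> borel_measurable lborel" "R i j \<in> borel_measurable lborel" if "i + j \<le> 2" for i j
      unfolding P_def R_def using H that by measurable
    have [measurable]: "P 2 0 \<in> borel_measurable borel" "P 1 1 \<in> borel_measurable borel" "P 0 2 \<in> borel_measurable borel"
      "R 2 0 \<in> borel_measurable borel" "R 1 1 \<in> borel_measurable borel" "R 0 2 \<in> borel_measurable borel"
      using PR[of 2 0] PR[of 1 1] PR[of 0 2] by simp_all
    have eq: "(\<lambda>p. indicator (Omega l) p *\<^sub>R ((?E 2 0 p + ?E 0 2 p) * (?D 2 0 p + ?D 0 2 p)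
        + (1 - \<sigma>) * (2 * ?E 1 1 p * ?D 1 1 p - ?E 2 0 p * ?D 0 2 p - ?E 0 2 p * ?D 2 0 p)))
      = (\<lambda>p. (R 2 0 p + R 0 2 p) * (P 2 0 p + P 0 2 p)
        + (1 - \<sigma>) * (2 * R 1 1 p * P 1 1 p - R 2 0 p * P 0 2 p - R 0 2 p * P 2 0 p))"
      by (auto simp: P_def R_def indicator_def fun_eq_iff)
    have "(\<lambda>p. (R 2 0 p + R 0 2 p) * (P 2 0 p + P 0 2 p)
        + (1 - \<sigma>) * (2 * R 1 1 p * P 1 1 p - R 2 0 p * P 0 2 p - R 0 2 p * P 2 0 p)) \<in> borel_measurable lborel"
      by measurable
    then show "(\<lambda>p. indicator (Omega l) p *\<^sub>R ((?E 2 0 p + ?E 0 2 p) * (?D 2 0 p + ?D 0 2 p)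
        + (1 - \<sigma>) * (2 * ?E 1 1 p * ?D 1 1 p - ?E 2 0 p * ?D 0 2 p - ?E 0 2 p * ?D 2 0 p))) \<in> borel_measurable lborel"
      unfolding eq .
    show "(\<lambda>p. I1 p + I2 p + 2 * (1 - \<sigma>) * real m * I3 p) \<in> borel_measurable lborel" using I by auto
    show "AE p in lborel. indicator (Omega l) p *\<^sub>R ((?E 2 0 p + ?E 0 2 p) * (?D 2 0 p + ?D 0 2 p)
        + (1 - \<sigma>) * (2 * ?E 1 1 p * ?D 1 1 p - ?E 2 0 p * ?D 0 2 p - ?E 0 2 p * ?D 2 0 p))
      = I1 p + I2 p + 2 * (1 - \<sigma>) * real m * I3 p"
      using mode_test_AE[OF l le(1), of \<sigma> m w] mode_test_AE[OF l le(2), of \<sigma> m w] mode_test_AE[OF l le(3), of \<sigma> m w]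
    proof eventually_elim
      case (elim p)
      show ?case
      proof (cases "p \<in> Omega l")
        case True
        define s where "s = sin (real m * fst p)"
        define c where "c = cos (real m * fst p)"
        have D: "?D 2 0 p = - M * s * g 0 (snd p)" "?D 1 1 p = real m * c * g 1 (snd p)" "?D 0 2 p = s * g 2 (snd p)"
          using elim True by (simp_all add: sine_mode_def g_def M_def s_def c_def)
        show ?thesis unfolding D I1_def I2_def I3_def s_def[symmetric] c_def[symmetric] K_def h_def
            uxx_def[OF l u m] uxy_def[OF l u m] uyy_def[OF l u m]
          using True by (simp add: algebra_simps)
      qed (simp add: I1_def I2_def I3_def)
    qed
  qed
  also have "\<dots> = (\<integral>p. I1 p \<partial>lborel) + (\<integral>p. I2 p \<partial>lborel) + 2 * (1 - \<sigma>) * real m * (\<integral>p. I3 p \<partial>lborel)"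
    using I by simp
  also have "\<dots> = - M * integral {-l..l} (\<lambda>y. U y * K y)
     + (hl' (-l) * U (-l) - hr' l * U l + 1 * U w + integral {-l..l} (\<lambda>s. \<theta> s * U s))
     + 2 * (1 - \<sigma>) * real m * (real m * (g 1 l * U l - g 1 (-l) * U (-l) - integral {-l..l} (\<lambda>s. g 2 s * U s)))"
    using xx xy yy by (simp add: I1_def I2_def I3_def set_lebesgue_integral_def)
  also have "\<dots> = U w + (- M * integral {-l..l} (\<lambda>y. U y * K y) + integral {-l..l} (\<lambda>s. \<theta> s * U s)
      - 2 * (1 - \<sigma>) * M * integral {-l..l} (\<lambda>s. g 2 s * U s))"
    unfolding ends by (simp add: M_def power2_eq_square algebra_simps)
  also have "- M * integral {-l..l} (\<lambda>y. U y * K y) + integral {-l..l} (\<lambda>s. \<theta> s * U s)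
      - 2 * (1 - \<sigma>) * M * integral {-l..l} (\<lambda>s. g 2 s * U s) = 0"
  proof -
    have i: "(\<lambda>y. U y * K y) integrable_on {-l..l}" "(\<lambda>y. \<theta> y * U y) integrable_on {-l..l}" "(\<lambda>y. g 2 y * U y) integrable_on {-l..l}"
      unfolding K_def by (intro integrable_continuous_real continuous_intros Uc \<theta>c gc; simp)+
    have A: "((\<lambda>y. - M * (U y * K y) + \<theta> y * U y - 2 * (1 - \<sigma>) * M * (g 2 y * U y)) has_integral
      (- M * integral {-l..l} (\<lambda>y. U y * K y) + integral {-l..l} (\<lambda>s. \<theta> s * U s)
      - 2 * (1 - \<sigma>) * M * integral {-l..l} (\<lambda>s. g 2 s * U s))) {-l..l}"
      by (intro has_integral_add has_integral_diff has_integral_mult_right integrable_integral i)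
    \<comment> \<open>The remaining integrand vanishes pointwise, since - m^2 K + \<theta> = 2 (1 -
      \<sigma>) m^2 g''.\<close>
    have E: "(\<lambda>y. - M * (U y * K y) + \<theta> y * U y - 2 * (1 - \<sigma>) * M * (g 2 y * U y)) = (\<lambda>y. 0)"
      by (rule ext) (simp add: K_def \<theta>_def algebra_simps power2_eq_square)
    show ?thesis by (rule has_integral_unique[OF A[unfolded E] has_integral_0])
  qed
  finally show ?thesis by (simp add: U_def)
qed

section \<open>Sine expansion of the Green function in x\<close>

lemma integral_cos_npi:
  assumes "k \<noteq> 0"
  shows "((\<lambda>x. cos (real_of_int k * x)) has_integral 0) {0..pi}"
proof -
  have "((\<lambda>x. cos (real_of_int k * x)) has_integral sin (real_of_int k * pi) / real_of_int k - sin (real_of_int k * 0) / real_of_int k) {0..pi}"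
    by (rule fundamental_theorem_of_calculus)
      (use assms in \<open>auto intro!: derivative_eq_intros simp flip: has_real_derivative_iff_has_vector_derivative\<close>)
  then show ?thesis by (simp add: sin_npi_int mult.commute)
qed

lemma sine_orthogonal:
  assumes "j \<ge> 1" "m \<ge> 1"
  shows "((\<lambda>x. sin (real m * x) * sin (real j * x)) has_integral (if m = j then pi / 2 else 0)) {0..pi}"
proof -
  have e: "sin (real m * x) * sin (real j * x) = cos (real_of_int (int m - int j) * x) / 2 - cos (real_of_int (int m + int j) * x) / 2" for x
    by (simp add: sin_times_sin left_diff_distrib distrib_right diff_divide_distrib)
  have p: "((\<lambda>x. cos (real_of_int (int m + int j) * x)) has_integral 0) {0..pi}"
    using assms by (intro integral_cos_npi) auto
  have q: "((\<lambda>x. cos (real_of_int (int m - int j) * x)) has_integral (if m = j then pi else 0)) {0..pi}"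
  proof (cases "m = j")
    case True
    then show ?thesis using has_integral_const_real[of "1::real" 0 pi] by simp
  next
    case False
    then show ?thesis using integral_cos_npi[of "int m - int j"] by simp
  qed
  show ?thesis unfolding e
    using has_integral_diff[OF has_integral_divide[OF q, of 2] has_integral_divide[OF p, of 2]] by (cases "m = j") simp_all
qed

text \<open>The quadratic decay of c gives uniform convergence, so the sum is continuous with the
  same coefficients as f, and completeness identifies the two. The factor 2 / pi is the reciprocal
  of the integral of the squared sine.\<close>

lemma sine_series_expansion:
  fixes f :: "real \<Rightarrow> real" and c :: "nat \<Rightarrow> real"
  assumes f: "continuous_on {0..pi} f"
    and coef: "\<And>m. m \<ge> 1 \<Longrightarrow> integral {0..pi} (\<lambda>x. f x * sin (real m * x)) = c m"
    and bound: "\<And>m. m \<ge> 1 \<Longrightarrow> \<bar>c m\<bar> \<le> C / (real m)\<^sup>2"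
    and x: "x \<in> {0..pi}"
  shows "(\<lambda>k. 2 / pi * c (Suc k) * sin (real (Suc k) * x)) sums f x"
proof -
  define t where "t = (\<lambda>k x. 2 / pi * c (Suc k) * sin (real (Suc k) * x))"
  define s where "s = (\<lambda>x. \<Sum>k. t k x)"
  have tb: "norm (t k x) \<le> 2 / pi * C * (1 / (real (Suc k))\<^sup>2)" for k x
  proof -
    have "\<bar>c (Suc k)\<bar> * \<bar>sin (real (Suc k) * x)\<bar> \<le> (C / (real (Suc k))\<^sup>2) * 1"
      using bound[of "Suc k"] by (intro mult_mono) (auto simp del: of_nat_Suc)
    then have "2 / pi * (\<bar>c (Suc k)\<bar> * \<bar>sin (real (Suc k) * x)\<bar>) \<le> 2 / pi * (C / (real (Suc k))\<^sup>2)"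
      by (intro mult_left_mono) auto
    then show ?thesis by (simp add: t_def abs_mult mult.assoc del: of_nat_Suc)
  qed
  have sm: "summable (\<lambda>k. 2 / pi * C * (1 / (real (Suc k))\<^sup>2))"
    using inverse_power_summable[of 2, where 'a = real] by (intro summable_mult) (subst summable_Suc_iff, simp add: inverse_eq_divide)
  have ul: "uniform_limit UNIV (\<lambda>n x. \<Sum>k<n. t k x) s sequentially"
    unfolding s_def by (rule Weierstrass_m_test[OF _ sm]) (rule tb)
  have tc: "continuous_on S (t k)" for S k unfolding t_def by (intro continuous_intros)
  have sc: "continuous_on S s" for S
    by (rule uniform_limit_theorem[OF _ uniform_limit_on_subset[OF ul]]) (auto intro!: always_eventually continuous_on_sum tc)
  have "f y - s y = 0" if y: "y \<in> {0..pi}" for y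
  proof (rule sine_system_complete[of "\<lambda>x. f x - s x", OF _ _ y])
    show "continuous_on {0..pi} (\<lambda>x. f x - s x)" by (intro continuous_intros f sc)
    fix j :: nat assume j: "j \<ge> 1"
    have ulj: "uniform_limit {0..pi} (\<lambda>n x. (\<Sum>k<n. t k x) * sin (real j * x)) (\<lambda>x. s x * sin (real j * x)) sequentially"
      by (rule uniform_lim_mult[OF uniform_limit_on_subset[OF ul] uniform_limit_const])
        (auto intro!: compact_imp_bounded compact_continuous_image sc continuous_intros)
    have I: "((\<lambda>x. t k x * sin (real j * x)) has_integral (if Suc k = j then c j else 0)) {0..pi}" for k
    proof -
      have "((\<lambda>x. 2 / pi * c (Suc k) * (sin (real (Suc k) * x) * sin (real j * x))) has_integral
          2 / pi * c (Suc k) * (if Suc k = j then pi / 2 else 0)) {0..pi}"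
        by (intro has_integral_mult_right sine_orthogonal j) simp
      then show ?thesis by (auto simp: t_def mult.assoc split: if_splits)
    qed
    have In: "((\<lambda>x. (\<Sum>k<n. t k x) * sin (real j * x)) has_integral (\<Sum>k<n. if Suc k = j then c j else 0)) {0..pi}" for n
      unfolding sum_distrib_right by (intro has_integral_sum I) auto
    obtain i where ij: "j = Suc i" using j by (cases j) auto
    have Iv: "(\<Sum>k<n. if Suc k = j then c j else 0) = c j" if "n \<ge> j" for n
      using that by (simp add: ij sum.delta)
    have lim1: "(\<lambda>n. integral {0..pi} (\<lambda>x. (\<Sum>k<n. t k x) * sin (real j * x))) \<longlonglongrightarrow> integral {0..pi} (\<lambda>x. s x * sin (real j * x))"
    proof -
      obtain A J where A: "\<And>n. ((\<lambda>x. (\<Sum>k<n. t k x) * sin (real j * x)) has_integral A n) {0..pi}"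
        and J: "((\<lambda>x. s x * sin (real j * x)) has_integral J) {0..pi}" and lim: "A \<longlonglongrightarrow> J"
        by (rule uniform_limit_integral[OF ulj]) (auto intro!: continuous_intros tc)
      show ?thesis using lim unfolding integral_unique[OF A] integral_unique[OF J] .
    qed
    have ev: "eventually (\<lambda>n. integral {0..pi} (\<lambda>x. (\<Sum>k<n. t k x) * sin (real j * x)) = c j) sequentially"
      using eventually_ge_at_top[of j] by eventually_elim (simp only: integral_unique[OF In] Iv)
    have "integral {0..pi} (\<lambda>x. s x * sin (real j * x)) = c j"
      by (rule LIMSEQ_unique[OF lim1 tendsto_eventually[OF ev]])
    then show "integral {0..pi} (\<lambda>x. (f x - s x) * sin (real j * x)) = 0"
      unfolding left_diff_distrib
      by (subst integral_diff) (auto intro!: integrable_continuous_real continuous_intros f sc simp: coef[OF j])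
  qed
  then have "f x = s x" using x by simp
  moreover have "(\<lambda>k. t k x) sums s x"
    unfolding s_def by (rule summable_sums, rule summable_comparison_test'[OF sm tb])
  ultimately show ?thesis by (simp add: t_def)
qed

text \<open>The scalar product of G with the mode centred at y is evaluated twice:
  \<open>inner_mode_test\<close> gives the sine coefficient at height y, the reproducing property
  gives the value of the mode at (\<rho>, w).\<close>

lemma green_sine_expansion:
  assumes par: "l > 0" "0 \<le> \<sigma>" "\<sigma> < 1" and G: "green_function l \<sigma> G"
    and xy: "x \<in> {0..pi}" "y \<in> {-l..l}" and q: "\<rho> \<in> {0..pi}" "w \<in> {-l..l}"
  shows "(\<lambda>k. 2 / pi * (sin (real (Suc k) * \<rho>) * beam_green \<sigma> l (real (Suc k)) y 0 w) * sin (real (Suc k) * x))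
    sums G x y \<rho> w"
proof -
  define u where "u = (\<lambda>(x, y). G x y \<rho> w)"
  have "(\<rho>, w) \<in> closure (Omega l)" using q closure_Omega[OF par(1)] by simp
  then have u: "u \<in> H2star l" and rep: "\<And>\<phi>. \<phi> \<in> H2star l \<Longrightarrow> H2star_inner l \<sigma> u \<phi> = \<phi> (\<rho>, w)"
    using G by (auto simp: green_function_def u_def)
  have c: "sine_coef u m y = sin (real m * \<rho>) * beam_green \<sigma> l (real m) y 0 w" if m: "m \<ge> 1" for m
    using rep[OF mode_test_H2star[OF par(1)]] inner_mode_test[OF par(2,3,1) u m xy(2)]
    by (simp add: mode_test_def sine_mode_def)
  have B0: "beam_green \<sigma> l (real m) y 0 w > 0" if "m \<ge> 1" for m
    using beam_bounds(1)[OF par(2,3,1) _ xy(2) q(2)] that by simp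
  \<comment> \<open>Comparing m^2 g_m with its value at m = 1 supplies the decay needed for uniform
    convergence.\<close>
  have B: "beam_green \<sigma> l (real m) y 0 w \<le> beam_green \<sigma> l 1 y 0 w / (real m)\<^sup>2" if m: "m \<ge> 1" for m
  proof (cases "m = 1")
    case False
    then have "(real m)\<^sup>2 * beam_green \<sigma> l (real m) y 0 w < 1\<^sup>2 * beam_green \<sigma> l 1 y 0 w"
      using beam_decreasing[OF par(2,3,1) _ xy(2) q(2), of 1 "real m"] m by simp
    then show ?thesis using m by (simp add: field_simps)
  qed simp
  show ?thesis
  proof (rule sine_series_expansion[where f = "\<lambda>x. G x y \<rho> w" and c = "\<lambda>m. sin (real m * \<rho>) * beam_green \<sigma> l (real m) y 0 w"
        and C = "beam_green \<sigma> l 1 y 0 w"])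
    have "continuous_on {0..pi} (\<lambda>x. u (x, y))"
      by (rule continuous_on_compose2[OF u_cont[OF par(1) u order_refl]]) (use xy in \<open>auto intro!: continuous_intros\<close>)
    then show "continuous_on {0..pi} (\<lambda>x. G x y \<rho> w)" by (simp add: u_def)
    show "integral {0..pi} (\<lambda>x. G x y \<rho> w * sin (real m * x)) = sin (real m * \<rho>) * beam_green \<sigma> l (real m) y 0 w" if "m \<ge> 1" for m
      using c[OF that, unfolded sine_coef_def[OF par(1) u that]] by (simp add: u_def)
    show "\<bar>sin (real m * \<rho>) * beam_green \<sigma> l (real m) y 0 w\<bar> \<le> beam_green \<sigma> l 1 y 0 w / (real m)\<^sup>2" if m: "m \<ge> 1" for m
    proof -
      have "\<bar>sin (real m * \<rho>)\<bar> * \<bar>beam_green \<sigma> l (real m) y 0 w\<bar> \<le> 1 * (beam_green \<sigma> l 1 y 0 w / (real m)\<^sup>2)"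
        using B[OF m] B0[OF m] by (intro mult_mono) auto
      then show ?thesis by (simp add: abs_mult)
    qed
  qed (rule xy(1))
qed

text \<open>Each frequency only picks up a sign, so reflecting x or reflecting \<rho> has the same
  effect on the series, and reflecting both has none.\<close>

lemma sin_reflect: "sin (real m * (pi - x)) = (-1) ^ Suc m * sin (real m * x)"
  by (simp add: right_diff_distrib sin_diff)

theorem lemma6p4:
  fixes l \<sigma> :: real and G :: "real \<Rightarrow> real \<Rightarrow> real \<Rightarrow> real \<Rightarrow> real"
    and x y \<rho> w :: real
  assumes "l > 0" and "0 \<le> \<sigma>" and "\<sigma> < 1"
    and "green_function l \<sigma> G"
    and "(x, y) \<in> left_half \<inter> closure (Omega l)"
    and "(\<rho>, w) \<in> left_half \<inter> closure (Omega l)"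
  shows "(G x y \<rho> w \<ge> max (G (pi - x) y \<rho> w) (G x y (pi - \<rho>) w)
          \<and> (x \<notin> {0, pi / 2} \<and> \<rho> \<notin> {0, pi / 2} \<longrightarrow>
               G x y \<rho> w > max (G (pi - x) y \<rho> w) (G x y (pi - \<rho>) w)))
       \<and> G x y \<rho> w = G (pi - x) y (pi - \<rho>) w
       \<and> G (pi - x) y \<rho> w = G x y (pi - \<rho>) w"
proof -
  have x: "0 \<le> x" "x \<le> pi / 2" "x \<in> {0..pi}" "pi - x \<in> {0..pi}" and y: "y \<in> {-l..l}"
    and \<rho>: "0 \<le> \<rho>" "\<rho> \<le> pi / 2" "\<rho> \<in> {0..pi}" "pi - \<rho> \<in> {0..pi}" and w: "w \<in> {-l..l}"
    using assms(5,6) closure_Omega[OF assms(1)] pi_gt_zero by (auto simp: left_half_def)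
  define B where "B = (\<lambda>m. beam_green \<sigma> l (real m) y 0 w)"
  have S: "(\<lambda>k. 2 / pi * (sin (real (Suc k) * \<rho>) * B (Suc k)) * sin (real (Suc k) * x)) sums G x y \<rho> w"
    if "x \<in> {0..pi}" "\<rho> \<in> {0..pi}" for x \<rho>
    unfolding B_def by (rule green_sine_expansion[OF assms(1-4) that(1) y that(2) w])
  have ii: "G x y \<rho> w = G (pi - x) y (pi - \<rho>) w" if "x \<in> {0..pi}" "\<rho> \<in> {0..pi}" for x \<rho>
  proof -
    have "pi - x \<in> {0..pi}" "pi - \<rho> \<in> {0..pi}" using that by auto
    from S[OF this] have "(\<lambda>k. 2 / pi * (sin (real (Suc k) * \<rho>) * B (Suc k)) * sin (real (Suc k) * x)) sums G (pi - x) y (pi - \<rho>) w"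
      unfolding sin_reflect by (simp add: mult_ac flip: power_add del: of_nat_Suc)
    then show ?thesis using S[OF that] sums_unique2 by blast
  qed
  \<comment> \<open>This is (ii) at the point with abscissas pi - x and \<rho>. The two entries of
    the maximum are therefore equal, and one comparison is enough.\<close>
  have iii: "G (pi - x) y \<rho> w = G x y (pi - \<rho>) w" using ii[OF x(4) \<rho>(3)] by simp
  have strict: "G x y \<rho> w > G (pi - x) y \<rho> w" if xx: "x \<notin> {0, pi / 2}" and rr: "\<rho> \<notin> {0, pi / 2}"
  proof -
    \<comment> \<open>Up to the constant 1 / pi this is m^2 g_m at m = 2 k, scaled so that 4 / pi
      times B (2 k) equals C k / k^2.\<close>
    define C where "C = (\<lambda>k. (real (2 * k))\<^sup>2 * B (2 * k) / pi)"
    define F where "F = (\<lambda>k. 2 / pi * (sin (real (Suc k) * \<rho>) * B (Suc k)) * sin (real (Suc k) * x)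
       - 2 / pi * (sin (real (Suc k) * \<rho>) * B (Suc k)) * sin (real (Suc k) * (pi - x)))"
    have "F sums (G x y \<rho> w - G (pi - x) y \<rho> w)"
      unfolding F_def by (rule sums_diff[OF S[OF x(3) \<rho>(3)] S[OF x(4) \<rho>(3)]])
    \<comment> \<open>Index n carries frequency n + 1: for even n the reflection changes nothing and
      F n = 0, for odd n it flips the sign and the term doubles.\<close>
    then have "(\<lambda>k. F (2 * k + 1)) sums (G x y \<rho> w - G (pi - x) y \<rho> w)"
    proof (subst sums_mono_reindex)
      show "strict_mono (\<lambda>k::nat. 2 * k + 1)" by (simp add: strict_mono_def)
      show "F n = 0" if "n \<notin> range (\<lambda>k::nat. 2 * k + 1)" for n
      proof -
        have "even n" using that by (metis oddE rangeI)
        then show ?thesis unfolding F_def sin_reflect by simp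
      qed
    qed
    moreover have "F (2 * k + 1) = C (Suc k) / (real (Suc k))\<^sup>2 * (sin (real (Suc k) * (2 * x)) * sin (real (Suc k) * (2 * \<rho>)))" for k
    proof -
      have k: "Suc (2 * k + 1) = 2 * Suc k" by simp
      have e: "real (2 * Suc k) * t = real (Suc k) * (2 * t)" for t by simp
      have "F (2 * k + 1) = 4 / pi * B (2 * Suc k) * (sin (real (Suc k) * (2 * x)) * sin (real (Suc k) * (2 * \<rho>)))"
        unfolding F_def k sin_reflect unfolding e by (simp del: of_nat_Suc)
      also have "4 / pi * B (2 * Suc k) = C (Suc k) / (real (Suc k))\<^sup>2"
        unfolding C_def of_nat_mult power_mult_distrib by (simp del: of_nat_Suc)
      finally show ?thesis .
    qed
    ultimately have s: "(\<lambda>k. C (Suc k) / (real (Suc k))\<^sup>2 * (sin (real (Suc k) * (2 * x)) * sin (real (Suc k) * (2 * \<rho>))))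
       sums (G x y \<rho> w - G (pi - x) y \<rho> w)" by simp
    have "G x y \<rho> w - G (pi - x) y \<rho> w > 0"
    \<comment> \<open>The surviving sines have arguments k (2 x) and k (2 \<rho>), and doubling maps
      (0, pi / 2) onto (0, pi), the range of \<open>sine_series_pos\<close>.\<close>
    proof (rule sine_series_pos[OF _ _ _ _ _ _ s])
      show "C (Suc k) < C k" if "k \<ge> 1" for k
        using beam_decreasing[OF assms(2,3,1) _ y w, of "real (2 * k)" "real (2 * Suc k)"] that
        unfolding C_def B_def by (intro divide_strict_right_mono) auto
      show "C k > 0" if "k \<ge> 1" for k
        using beam_bounds(1)[OF assms(2,3,1) _ y w, of "real (2 * k)"] that by (simp add: C_def B_def)
    qed (use x \<rho> xx rr in auto)
    then show ?thesis by simp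
  qed
  have weak: "G x y \<rho> w \<ge> G (pi - x) y \<rho> w"
  proof (cases "x \<in> {0, pi / 2} \<or> \<rho> \<in> {0, pi / 2}")
    case False
    then show ?thesis using strict by force
  next
    case True
    have "G x y \<rho> w = G (pi - x) y \<rho> w"
    \<comment> \<open>On the midline a point is its own reflection and (iii) gives equality; for x =
      0 or \<rho> = 0 every term of both series contains a vanishing sine.\<close>
    proof (cases "x = pi / 2 \<or> \<rho> = pi / 2")
      case True
      then have "pi - x = x \<or> pi - \<rho> = \<rho>" by auto
      then show ?thesis using iii by metis
    next
      case False
      then have z: "2 / pi * (sin (real (Suc k) * \<rho>) * B (Suc k)) * sin (real (Suc k) * x) = 0"
        "2 / pi * (sin (real (Suc k) * \<rho>) * B (Suc k)) * sin (real (Suc k) * (pi - x)) = 0" for k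
        using True unfolding sin_reflect by auto
      have "G x y \<rho> w = 0" "G (pi - x) y \<rho> w = 0"
        using sums_unique2[OF S[OF x(3) \<rho>(3), unfolded z(1)] sums_zero]
          sums_unique2[OF S[OF x(4) \<rho>(3), unfolded z(2)] sums_zero] by simp_all
      then show ?thesis by simp
    qed
    then show ?thesis by simp
  qed
  show ?thesis using weak strict ii[OF x(3) \<rho>(3)] iii by auto
qed

end
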